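(* Suppose that there exist constants $R_\infty\ge1$, $\upsilon\in(0,1)$ and a function $\varPhi$ such that the conditions $\mathrm{VRD}^{R_\infty}(\upsilon)$, $\mathrm{ULS}^{R_\infty}(\varPhi)$, $\mathrm{Tail}^{R_\infty}(\varPhi,\upsilon,\le)$ and $\mathrm{NDL}^{R_\infty}(\varPhi,\upsilon)$ (defined in the context) hold, and let $\varphi(r)=\int_1^rs^{-1}\varPhi(s)\,ds$ for $r>1$. Then there exists a deterministic non-increasing strictly positive function $f_\infty:(0,\infty)\to(0,1]$ such that for every $x\in M$ and $\kappa>0$, $$\limsup_{r\to\infty}\frac{\mathcal U\big(B(x,r),\,\kappa\varphi(r)\log\log\varphi(r)\big)}{\kappa\varphi(r)\log\log\varphi(r)}=f_\infty(\kappa),\qquad\mathbb P^z\text{-a.s., for all }z\in M.$$ Moreover, there exists a constant $\kappa_\infty>0$ such that $f_\infty(\kappa)=1$ for all $\kappa\le\kappa_\infty$, and $\lim_{\kappa\to\infty}f_\infty(\kappa)=0$.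
   Context: $(M,d)$ is a locally compact separable metric space with a base point $o\in M$, $\mu$ is a positive Radon measure on $M$ with full support, $B(x,r)$ is the open ball, $V(x,r)=\mu(B(x,r))$, and $\mathsf d(x)=d(x,o)+1$. $\partial$ is a cemetery point, $M_\partial=M\cup\{\partial\}$; functions on $M$ are extended by $0$ at $\partial$. $X=(\Omega,\mathcal F_t,X_t,t\ge0;\mathbb P^x,x\in M_\partial)$ is a Borel standard Markov process on $M_\partial$ with a Lévy system of the form $(J(x,\cdot),ds)$: $(J(x,dy):x\in M)$ are Borel measures on $M_\partial$ such that for all $z\in M$, $t>0$ and all non-negative Borel $F$ on $M\times M_\partial$ vanishing on the diagonal, $\mathbb E^z[\sum_{s\le t}F(X_{s-},X_s)]=\mathbb E^z[\int_0^t\int_{M_\partial}F(X_s,y)J(X_s,dy)ds]$. For a Borel set $D\subset M$, $\tau_D=\inf\{t>0:X_t\in M_\partial\setminus D\}$, $\mathcal U(D,t)=\int_0^t\mathbf 1_D(X_s)ds$, and $X^D$ is the part process of $X$ killed upon leaving $D$. The heat kernel of $X^D$ is a Borel function $p^D:(0,\infty)\times D\times D\to[0,\infty]$ with $\mathbb E^x[f(X^D_t)]=\int_Dp^D(t,x,y)f(y)\mu(dy)$ for all $f\in L^\infty(D;\mu)$, $t>0$, $x\in D$, and $p^D(t+s,x,y)=\int_Dp^D(t,x,z)p^D(s,z,y)\mu(dz)$ for all $t,s>0$, $x,y\in D$. $\varPhi:(0,\infty)\to(0,\infty)$ is increasing and continuous. Conditions: $\mathrm{VRD}^{R_\infty}(\upsilon)$: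 there are $d_1,d_2,c_\mu,C_\mu>0$ with $c_\mu(r/s)^{d_1}\le V(x,r)/V(x,s)\le C_\mu(r/s)^{d_2}$ for all $x\in M$ and $r\ge s>R_\infty\mathsf d(x)^\upsilon$. $\mathrm{ULS}^{R_\infty}(\varPhi)$: there are $\ell>1$, $C_2>0$ with $2\varPhi(s/\ell)\le\varPhi(s)\le C_2\varPhi(s/2)$ for all $s>R_\infty$. $\mathrm{Tail}^{R_\infty}(\varPhi,\upsilon,\le)$: there is $C_3>0$ with $J(x,M_\partial\setminus B(x,r))\le C_3/\varPhi(r)$ for all $x\in M$, $r>R_\infty\mathsf d(x)^\upsilon$. $\mathrm{NDL}^{R_\infty}(\varPhi,\upsilon)$: there are $\eta\in(0,1)$, $c_l>0$ such that for all $x\in M$ and $r>R_\infty\mathsf d(x)^\upsilon$, the heat kernel $p^{B(x,r)}$ of $X^{B(x,r)}$ exists and $p^{B(x,r)}(\varPhi(\eta r),y,z)\ge c_l/V(x,r)$ for all $y,z\in B(x,\eta^2r)$. *)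

theory Defs
  imports "HOL-Probability.Probability"
begin

class lc_separable_metric_space = metric_space +
  assumes locally_compact_UNIV: "locally_compact_space euclidean"
    and separable_UNIV: "separable_space euclidean"

text \<open>Separable metric spaces are second countable, so that the library's results on the Borel
  sets of such spaces and of their products are available.\<close>

instance lc_separable_metric_space \<subseteq> second_countable_topology
proof
  obtain D :: "'a set" where D: "countable D" "closure D = UNIV"
    using separable_UNIV unfolding separable_space_def by auto
  define B where "B = (\<lambda>(x, n). ball x (inverse (real (Suc n)))) ` (D \<times> UNIV)"
  have "topological_basis B"
  proof (rule topological_basisI)
    fix b assume "b \<in> B" then show "open b"
      by (auto simp: B_def)
  next
    fix U :: "'a set" and x assume "open U" "x \<in> U"
    then obtain e where e: "e > 0" "ball x e \<subseteq> U"
      by (meson openE)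
    obtain n where n: "inverse (real (Suc n)) < e / 2"
      using reals_Archimedean[of "e / 2"] e by auto
    have "x \<in> closure D"
      using D by simp
    then obtain y where y: "y \<in> D" "dist y x < inverse (real (Suc n))"
      using closure_approachable[of x D]
      by (metis inverse_positive_iff_positive of_nat_0_less_iff zero_less_Suc)
    have "ball y (inverse (real (Suc n))) \<subseteq> ball x e"
    proof
      fix z assume "z \<in> ball y (inverse (real (Suc n)))"
      then have "dist y z < inverse (real (Suc n))" by simp
      moreover have "dist x z \<le> dist y x + dist y z"
        by (metis dist_commute dist_triangle)
      ultimately show "z \<in> ball x e"
        using y n by simp
    qed
    moreover have "ball y (inverse (real (Suc n))) \<in> B"
      unfolding B_def using y by (intro image_eqI[of _ _ "(y, n)"]) auto
    moreover have "x \<in> ball y (inverse (real (Suc n)))"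
      using y by simp
    ultimately show "\<exists>b\<in>B. x \<in> b \<and> b \<subseteq> U"
      using e by blast
  qed
  moreover have "countable B"
    unfolding B_def using D by auto
  ultimately show "\<exists>B :: 'a set set. countable B \<and> open = generate_topology B"
    using topological_basis_imp_subbasis by blast
qed

definition radon_measure :: "'a::topological_space measure \<Rightarrow> bool" where
  "radon_measure \<mu> \<longleftrightarrow> sets \<mu> = sets borel \<and>
     (\<forall>K. compact K \<longrightarrow> emeasure \<mu> K < \<infinity>) \<and>
     (\<forall>A\<in>sets borel. emeasure \<mu> A = (INF U\<in>{U. open U \<and> A \<subseteq> U}. emeasure \<mu> U)) \<and>
     (\<forall>U. open U \<longrightarrow> emeasure \<mu> U = (SUP K\<in>{K. compact K \<and> K \<subseteq> U}. emeasure \<mu> K))"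

definition full_support :: "'a::topological_space measure \<Rightarrow> bool" where
  "full_support \<mu> \<longleftrightarrow> (\<forall>U. open U \<and> U \<noteq> {} \<longrightarrow> emeasure \<mu> U > 0)"

text \<open>
  The space with the cemetery point adjoined is \<^typ>\<open>'a option\<close>, where \<^const>\<open>None\<close> is the
  cemetery point. Whether that point is isolated or the point at infinity of the one-point
  compactification, the Borel sets are the following ones.
\<close>

definition cemetery_borel :: "'a::topological_space option measure" where
  "cemetery_borel = sigma UNIV {B. Some -` B \<in> sets borel}"

lemma sets_cemetery_borel:
  "sets (cemetery_borel :: 'a::topological_space option measure) = {B. Some -` B \<in> sets borel}"
proof -
  interpret sigma_algebra "UNIV :: 'a option set" "{B. Some -` B \<in> sets borel}"
    unfolding sigma_algebra_iff2 by (auto simp: vimage_Diff vimage_UN)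
  show ?thesis
    unfolding cemetery_borel_def by (rule sets_measure_of_eq)
qed

text \<open>
  Convergence to a point \<open>y\<close> of the original space, which is open in the extended space, so that
  the neighbourhood filter of \<open>Some y\<close> does not depend on the topology near the cemetery point.
\<close>

definition tends_to_point :: "('b \<Rightarrow> 'a::topological_space option) \<Rightarrow> 'a \<Rightarrow> 'b filter \<Rightarrow> bool" where
  "tends_to_point g y G \<longleftrightarrow> filterlim g (filtermap Some (nhds y)) G"

definition lifetime :: "(ennreal \<Rightarrow> 'w \<Rightarrow> 'a option) \<Rightarrow> 'w \<Rightarrow> ennreal" where
  "lifetime X \<omega> = Inf {t. X t \<omega> = None}"

text \<open>
  Time runs through \<open>[0, \<infinity>]\<close> with the usual convention that the process is at the cemetery point
  at time \<open>\<infinity>\<close>; \<^term>\<open>F \<infinity>\<close> is the ambient sigma-algebra, on which all the \<^term>\<open>P x\<close> are defined.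
  The strong Markov property contains the simple one (constant stopping times). On the event
  \<open>T = \<infinity>\<close> its two sides agree trivially, by \<open>infinity\<close>, \<open>cemetery\<close> and \<open>normal\<close>.
\<close>

locale borel_standard_process = filtration \<Omega> F
  for \<Omega> :: "'w set" and F :: "ennreal \<Rightarrow> 'w measure" +
  fixes X :: "ennreal \<Rightarrow> 'w \<Rightarrow> 'a::lc_separable_metric_space option"
    and P :: "'a option \<Rightarrow> 'w measure"
  assumes prob: "\<And>x. prob_space (P x)"
    and sets_P: "\<And>x. sets (P x) = sets (F \<infinity>)"
    and filtration_right_continuous: "\<And>t. t < \<infinity> \<Longrightarrow> sets (F t) = (\<Inter>s\<in>{t<..}. sets (F s))"
    and adapted: "\<And>t. X t \<in> measurable (F t) cemetery_borel"
    and borel_transition: "\<And>t B. B \<in> sets cemetery_borel \<Longrightarrow>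
      (\<lambda>x. emeasure (P x) {\<omega>\<in>\<Omega>. X t \<omega> \<in> B}) \<in> borel_measurable cemetery_borel"
    and normal: "\<And>x. AE \<omega> in P x. X 0 \<omega> = x"
    and infinity: "\<And>\<omega>. \<omega> \<in> \<Omega> \<Longrightarrow> X \<infinity> \<omega> = None"
    and cemetery: "\<And>\<omega> t. \<omega> \<in> \<Omega> \<Longrightarrow> lifetime X \<omega> \<le> t \<Longrightarrow> X t \<omega> = None"
    and right_continuous: "\<And>\<omega> t y. \<omega> \<in> \<Omega> \<Longrightarrow> X t \<omega> = Some y \<Longrightarrow>
      tends_to_point (\<lambda>s. X s \<omega>) y (at_right t)"
    and left_limits: "\<And>x. AE \<omega> in P x. \<forall>t. 0 < t \<and> t < lifetime X \<omega> \<longrightarrow>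
      (\<exists>y. tends_to_point (\<lambda>s. X s \<omega>) y (at_left t))"
    and strong_Markov: "\<And>T A t B x. stopping_time F T \<Longrightarrow> A \<in> sets (pre_sigma T) \<Longrightarrow>
      B \<in> sets cemetery_borel \<Longrightarrow>
      emeasure (P x) {\<omega>\<in>A. X (T \<omega> + t) \<omega> \<in> B} =
      (\<integral>\<^sup>+\<omega>\<in>A. emeasure (P (X (T \<omega>) \<omega>)) {\<omega>'\<in>\<Omega>. X t \<omega>' \<in> B} \<partial>P x)"
    and quasi_left_continuous: "\<And>T x. (\<And>n. stopping_time F (T n)) \<Longrightarrow>
      (\<And>n \<omega>. \<omega> \<in> \<Omega> \<Longrightarrow> T n \<omega> \<le> T (Suc n) \<omega>) \<Longrightarrow>
      AE \<omega> in P x. (SUP n. T n \<omega>) < lifetime X \<omega> \<longrightarrow>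
        (\<exists>y. X (SUP n. T n \<omega>) \<omega> = Some y \<and>
             tends_to_point (\<lambda>n. X (T n \<omega>) \<omega>) y sequentially)"

text \<open>The value \<^const>\<open>None\<close> means that there is no left limit in the original space; such times do
  not contribute to the sum in the Levy system formula.\<close>

definition left_limit :: "(ennreal \<Rightarrow> 'w \<Rightarrow> 'a::t2_space option) \<Rightarrow> ennreal \<Rightarrow> 'w \<Rightarrow> 'a option" where
  "left_limit X s \<omega> =
     (if \<exists>y. tends_to_point (\<lambda>u. X u \<omega>) y (at_left s)
      then Some (THE y. tends_to_point (\<lambda>u. X u \<omega>) y (at_left s)) else None)"

definition extend0 :: "('a \<Rightarrow> 'b::zero) \<Rightarrow> 'a option \<Rightarrow> 'b" where
  "extend0 f z = (case z of None \<Rightarrow> 0 | Some x \<Rightarrow> f x)"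

definition has_levy_system ::
  "('a::lc_separable_metric_space option \<Rightarrow> 'w measure) \<Rightarrow> (ennreal \<Rightarrow> 'w \<Rightarrow> 'a option) \<Rightarrow>
   ('a \<Rightarrow> 'a option measure) \<Rightarrow> bool" where
  "has_levy_system P X J \<longleftrightarrow>
     (\<forall>x. sets (J x) = sets cemetery_borel) \<and>
     (\<forall>H \<in> borel_measurable (borel \<Otimes>\<^sub>M cemetery_borel). (\<forall>x. H (x, Some x) = (0::ennreal)) \<longrightarrow>
        (\<lambda>x. \<integral>\<^sup>+y. H (x, y) \<partial>J x) \<in> borel_measurable borel \<and>
        (\<forall>z. \<forall>t>0.
          (\<integral>\<^sup>+\<omega>. (\<Sum>\<^sub>\<infinity>s\<in>{0<..ennreal t}. extend0 (\<lambda>x. H (x, X s \<omega>)) (left_limit X s \<omega>)) \<partial>P (Some z)) =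
          (\<integral>\<^sup>+\<omega>. (\<integral>\<^sup>+s\<in>{0..t}. extend0 (\<lambda>x. \<integral>\<^sup>+y. H (x, y) \<partial>J x) (X (ennreal s) \<omega>) \<partial>lborel)
             \<partial>P (Some z))))"

definition exit_time :: "(ennreal \<Rightarrow> 'w \<Rightarrow> 'a option) \<Rightarrow> 'a set \<Rightarrow> 'w \<Rightarrow> ennreal" where
  "exit_time X D \<omega> = Inf {t. 0 < t \<and> X t \<omega> \<notin> Some ` D}"

definition part_process :: "(ennreal \<Rightarrow> 'w \<Rightarrow> 'a option) \<Rightarrow> 'a set \<Rightarrow> ennreal \<Rightarrow> 'w \<Rightarrow> 'a option" where
  "part_process X D t \<omega> = (if t < exit_time X D \<omega> then X t \<omega> else None)"

definition occupation_time ::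
  "(ennreal \<Rightarrow> 'w \<Rightarrow> 'a option) \<Rightarrow> 'a set \<Rightarrow> real \<Rightarrow> 'w \<Rightarrow> real" where
  "occupation_time X D t \<omega> = (LBINT s:{0..t}. indicator (Some ` D) (X (ennreal s) \<omega>))"

definition L_infinity :: "'a measure \<Rightarrow> ('a \<Rightarrow> real) set" where
  "L_infinity N = {f \<in> borel_measurable N. \<exists>C. AE y in N. \<bar>f y\<bar> \<le> C}"

text \<open>The integral of \<open>p t x y * f y\<close> over \<open>D\<close> is written with the measure of density \<open>p t x\<close>,
  because \<open>p\<close> may take the value \<open>\<infinity>\<close>; integrability is part of the requirement.\<close>

definition heat_kernel ::
  "'a::lc_separable_metric_space measure \<Rightarrow> ('a option \<Rightarrow> 'w measure) \<Rightarrow>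
   (ennreal \<Rightarrow> 'w \<Rightarrow> 'a option) \<Rightarrow> 'a set \<Rightarrow> (real \<Rightarrow> 'a \<Rightarrow> 'a \<Rightarrow> ennreal) \<Rightarrow> bool" where
  "heat_kernel \<mu> P X D p \<longleftrightarrow>
     (\<lambda>(t, x, y). p t x y) \<in> borel_measurable (restrict_space borel ({0<..} \<times> D \<times> D)) \<and>
     (\<forall>f \<in> L_infinity (restrict_space \<mu> D). \<forall>t>0. \<forall>x\<in>D.
        has_bochner_integral (density (restrict_space \<mu> D) (p t x)) f
          (\<integral>\<omega>. extend0 f (part_process X D (ennreal t) \<omega>) \<partial>P (Some x))) \<and>
     (\<forall>t>0. \<forall>s>0. \<forall>x\<in>D. \<forall>y\<in>D.
        p (t + s) x y = (\<integral>\<^sup>+z. p t x z * p s z y \<partial>restrict_space \<mu> D))"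

definition dfun :: "'a::metric_space \<Rightarrow> 'a \<Rightarrow> real" where
  "dfun b x = dist x b + 1"

definition vol :: "'a::metric_space measure \<Rightarrow> 'a \<Rightarrow> real \<Rightarrow> ennreal" where
  "vol \<mu> x r = emeasure \<mu> (ball x r)"

text \<open>As \<open>\<infinity> / \<infinity> = 0\<close> in \<^typ>\<open>ennreal\<close>, the two bounds force the volumes involved to be finite.\<close>

definition VRD :: "'a::metric_space \<Rightarrow> 'a measure \<Rightarrow> real \<Rightarrow> real \<Rightarrow> bool" where
  "VRD b \<mu> R \<upsilon> \<longleftrightarrow> (\<exists>d1>0. \<exists>d2>0. \<exists>c>0. \<exists>C>0. \<forall>x r s.
     r \<ge> s \<and> s > R * dfun b x powr \<upsilon> \<longrightarrow>
     ennreal (c * (r / s) powr d1) \<le> vol \<mu> x r / vol \<mu> x s \<and>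
     vol \<mu> x r / vol \<mu> x s \<le> ennreal (C * (r / s) powr d2))"

definition ULS :: "real \<Rightarrow> (real \<Rightarrow> real) \<Rightarrow> bool" where
  "ULS R \<Phi> \<longleftrightarrow> (\<exists>l>1. \<exists>C>0. \<forall>s>R. 2 * \<Phi> (s / l) \<le> \<Phi> s \<and> \<Phi> s \<le> C * \<Phi> (s / 2))"

definition Tail_upper ::
  "'a::metric_space \<Rightarrow> ('a \<Rightarrow> 'a option measure) \<Rightarrow> real \<Rightarrow> (real \<Rightarrow> real) \<Rightarrow> real \<Rightarrow> bool" where
  "Tail_upper b J R \<Phi> \<upsilon> \<longleftrightarrow> (\<exists>C>0. \<forall>x r. r > R * dfun b x powr \<upsilon> \<longrightarrow>
     emeasure (J x) (UNIV - Some ` ball x r) \<le> ennreal (C / \<Phi> r))"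

definition NDL ::
  "'a::lc_separable_metric_space \<Rightarrow> 'a measure \<Rightarrow> ('a option \<Rightarrow> 'w measure) \<Rightarrow>
   (ennreal \<Rightarrow> 'w \<Rightarrow> 'a option) \<Rightarrow> real \<Rightarrow> (real \<Rightarrow> real) \<Rightarrow> real \<Rightarrow> bool" where
  "NDL b \<mu> P X R \<Phi> \<upsilon> \<longleftrightarrow> (\<exists>\<eta>. 0 < \<eta> \<and> \<eta> < 1 \<and> (\<exists>c>0. \<forall>x r. r > R * dfun b x powr \<upsilon> \<longrightarrow>
     (\<exists>p. heat_kernel \<mu> P X (ball x r) p \<and>
        (\<forall>y\<in>ball x (\<eta>\<^sup>2 * r). \<forall>z\<in>ball x (\<eta>\<^sup>2 * r).
           p (\<Phi> (\<eta> * r)) y z \<ge> ennreal c / vol \<mu> x r))))"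


end

theory Submission
  imports Defs
begin

text \<open>
  Fix the base point \<open>b\<close>. The near-diagonal lower bound says that from anywhere in a ball around \<open>b\<close>
  of radius comparable to \<open>r\<close>, after the time \<open>\<Phi> (\<eta> * r)\<close> the process has a law that dominates a fixed
  multiple of the normalised volume on that ball, without having left a slightly larger ball. Everything
  follows from this, essentially by the Markov property at fixed times.

  \<^item> The process does not die: jumps to the cemetery point are excluded by the Levy system and the tail
    bound, and a lifetime without left limit is announced by hitting times, which contradicts the
    uniformly positive probability of surviving.
  \<^item> An invariant function is constant (Doeblin's argument over arbitrarily large balls), so the upper
    limit is almost surely a constant \<open>f \<kappa>\<close>, independent of the starting point; as the time scale is
    asymptotically invariant under bounded shifts of the radius, it does not depend on the centre
    either. A larger \<open>\<kappa>\<close> amounts to a smaller ball for the same time, so \<open>f\<close> is non-increasing.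
  \<^item> From a ball the process moves with probability at least \<open>a\<close> to a surrounding annulus one time unit
    later, so the mean time in the ball is at most \<open>1 / (1 + a)\<close> times the mean time in the larger ball.
    Iterating over scales, the mean proportion of time spent in a ball is small over long times from
    every starting point; consecutive blocks of time give an exponential deviation bound, and the
    Borel-Cantelli lemma along radii with \<open>\<phi> r = exp n\<close> shows \<open>f \<kappa> \<longlonglongrightarrow> 0\<close>.
  \<^item> The process stays in a ball throughout the time \<open>\<kappa> * \<phi> r * ln (ln (\<phi> r))\<close> with probability at least
    \<open>c / n\<close> along radii with \<open>\<phi> r = exp (n ^ 2)\<close> if \<open>\<kappa>\<close> is small; this happens infinitely often
    with positive probability, hence \<open>f \<kappa> = 1\<close>.
\<close>

section \<open>Path space\<close>

lemma space_cemetery_borel [simp]: "space cemetery_borel = UNIV"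
  by (simp add: cemetery_borel_def space_measure_of_conv)

lemma measurable_Some_cemetery [measurable]: "Some \<in> borel \<rightarrow>\<^sub>M cemetery_borel"
  by (rule measurableI) (auto simp: sets_cemetery_borel)

lemma Some_image_cemetery [measurable]: "D \<in> sets borel \<Longrightarrow> Some ` D \<in> sets cemetery_borel"
  by (simp add: sets_cemetery_borel inj_vimage_image_eq)

lemma None_cemetery [measurable]: "{None} \<in> sets cemetery_borel"
proof -
  have *: "Some -` {None} = {}" by auto
  show ?thesis unfolding sets_cemetery_borel mem_Collect_eq * by simp
qed

lemma tends_to_point_iff:
  "tends_to_point g y G \<longleftrightarrow> (\<forall>S. open S \<and> y \<in> S \<longrightarrow> eventually (\<lambda>s. g s \<in> Some ` S) G)"
proof
  assume L: "tends_to_point g y G"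
  show "\<forall>S. open S \<and> y \<in> S \<longrightarrow> eventually (\<lambda>s. g s \<in> Some ` S) G"
  proof (intro allI impI)
    fix S assume "open S \<and> y \<in> S"
    then have "eventually (\<lambda>x. x \<in> Some ` S) (filtermap Some (nhds y))"
      unfolding eventually_filtermap by (auto simp: eventually_nhds)
    with L show "eventually (\<lambda>s. g s \<in> Some ` S) G"
      unfolding tends_to_point_def filterlim_iff by blast
  qed
next
  assume R: "\<forall>S. open S \<and> y \<in> S \<longrightarrow> eventually (\<lambda>s. g s \<in> Some ` S) G"
  show "tends_to_point g y G"
    unfolding tends_to_point_def filterlim_iff
  proof (intro allI impI)
    fix Q assume "eventually Q (filtermap Some (nhds y))"
    then obtain S where S: "open S" "y \<in> S" "\<forall>x\<in>S. Q (Some x)"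
      unfolding eventually_filtermap eventually_nhds by blast
    with R have "eventually (\<lambda>s. g s \<in> Some ` S) G" by blast
    then show "eventually (\<lambda>s. Q (g s)) G"
      by eventually_elim (use S in auto)
  qed
qed

definition rc_paths :: "(ennreal \<Rightarrow> 'a::topological_space option) set" where
  "rc_paths = {w. (\<forall>t y. w t = Some y \<longrightarrow> tends_to_point w y (at_right t)) \<and>
     (\<forall>s t. w s = None \<longrightarrow> s \<le> t \<longrightarrow> w t = None)}"

definition path_space :: "(ennreal \<Rightarrow> 'a::topological_space option) measure" where
  "path_space = restrict_space (Pi\<^sub>M UNIV (\<lambda>_. cemetery_borel)) rc_paths"

lemma space_path_space: "space path_space = rc_paths"
  by (simp add: path_space_def space_restrict_space space_PiM)

lemma measurable_coordinate [measurable]: "(\<lambda>w. w t) \<in> path_space \<rightarrow>\<^sub>M cemetery_borel"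
  unfolding path_space_def by (intro measurable_restrict_space1) measurable

lemma measurable_path_spaceI:
  assumes "\<And>\<omega>. \<omega> \<in> space M \<Longrightarrow> f \<omega> \<in> rc_paths"
    and "\<And>t. (\<lambda>\<omega>. f \<omega> t) \<in> M \<rightarrow>\<^sub>M cemetery_borel"
  shows "f \<in> M \<rightarrow>\<^sub>M path_space"
  unfolding path_space_def
proof (rule measurable_restrict_space2)
  show "f \<in> M \<rightarrow>\<^sub>M Pi\<^sub>M UNIV (\<lambda>_. cemetery_borel)"
  proof (rule measurable_PiM_single')
    show "(\<lambda>\<omega>. f \<omega> t) \<in> M \<rightarrow>\<^sub>M cemetery_borel" for t by (rule assms(2))
    show "f \<in> space M \<rightarrow> UNIV \<rightarrow>\<^sub>E space cemetery_borel" by (simp add: PiE_UNIV_domain)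
  qed
  show "f \<in> space M \<rightarrow> rc_paths" by (rule Pi_I) (rule assms(1))
qed

lemma rc_paths_rightD:
  assumes "w \<in> rc_paths" "w t = Some y" "open S" "y \<in> S" "t < \<infinity>"
  obtains u where "u > t" "\<And>s. t \<le> s \<Longrightarrow> s < u \<Longrightarrow> w s \<in> Some ` S"
proof -
  have "eventually (\<lambda>s. w s \<in> Some ` S) (at_right t)"
    using assms unfolding rc_paths_def tends_to_point_iff by blast
  then obtain u where u: "u > t" "\<forall>s>t. s < u \<longrightarrow> w s \<in> Some ` S"
    unfolding eventually_at_right[OF assms(5)] by blast
  show thesis
  proof (rule that[OF u(1)])
    fix s assume "t \<le> s" "s < u"
    then show "w s \<in> Some ` S"
      using u assms by (cases "s = t") auto
  qed
qed

lemma rc_pathsI: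
  assumes "\<And>t y S. t < \<infinity> \<Longrightarrow> w t = Some y \<Longrightarrow> open S \<Longrightarrow> y \<in> S \<Longrightarrow>
      \<exists>u>t. \<forall>s. t < s \<longrightarrow> s < u \<longrightarrow> w s \<in> Some ` S"
    and "\<And>s t. w s = None \<Longrightarrow> s \<le> t \<Longrightarrow> w t = None"
  shows "w \<in> rc_paths"
  unfolding rc_paths_def
proof (intro CollectI conjI allI impI)
  fix t y assume w: "w t = Some y"
  show "tends_to_point w y (at_right t)"
  proof (cases "t < \<infinity>")
    case True
    show ?thesis
      unfolding tends_to_point_iff eventually_at_right[OF True] using assms(1)[OF True w] by simp
  next
    case False
    then have "t = top" by (metis infinity_ennreal_def less_top)
    then show ?thesis by (simp add: tends_to_point_iff trivial_limit_at_right_top)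
  qed
next
  show "w t = None" if "w s = None" "s \<le> t" for s t using assms(2)[OF that] .
qed

lemma rc_paths_NoneD: "w \<in> rc_paths \<Longrightarrow> w s = None \<Longrightarrow> s \<le> t \<Longrightarrow> w t = None"
  unfolding rc_paths_def by blast

definition path_shift :: "ennreal \<Rightarrow> (ennreal \<Rightarrow> 'b) \<Rightarrow> ennreal \<Rightarrow> 'b" where
  "path_shift t w = (\<lambda>s. w (t + s))"

definition stopped :: "ennreal \<Rightarrow> (ennreal \<Rightarrow> 'b) \<Rightarrow> ennreal \<Rightarrow> 'b" where
  "stopped t w = (\<lambda>s. w (min s t))"

lemma path_shift_rc_paths:
  assumes w: "w \<in> rc_paths"
  shows "path_shift t w \<in> rc_paths"
proof (cases "t < \<infinity>")
  case True
  show ?thesis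
  proof (rule rc_pathsI)
    fix s y S assume *: "s < \<infinity>" "path_shift t w s = Some y" "open S" "y \<in> S"
    have "t + s < \<infinity>" using True * by simp
    then obtain u where u: "u > t + s" "\<And>v. t + s \<le> v \<Longrightarrow> v < u \<Longrightarrow> w v \<in> Some ` S"
      using rc_paths_rightD[OF w, of "t + s" y S] * unfolding path_shift_def by metis
    have "s < u - t" using u(1) True
      by (simp add: less_diff_eq_ennreal add.commute)
    moreover have "path_shift t w v \<in> Some ` S" if "s < v" "v < u - t" for v
    proof -
      have "t + v < u" using that True by (simp add: less_diff_eq_ennreal add.commute)
      moreover have "t + s \<le> t + v" using that by (simp add: add_left_mono)
      ultimately show ?thesis unfolding path_shift_def by (intro u(2))
    qed
    ultimately show "\<exists>u>s. \<forall>v. s < v \<longrightarrow> v < u \<longrightarrow> path_shift t w v \<in> Some ` S" by blast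
  next
    fix r s assume *: "path_shift t w r = None" "r \<le> s"
    show "path_shift t w s = None"
      unfolding path_shift_def
    proof (rule rc_paths_NoneD[OF w, of "t + r"])
      show "w (t + r) = None" using * by (simp add: path_shift_def)
      show "t + r \<le> t + s" using * by (simp add: add_left_mono)
    qed
  qed
next
  case False
  then have [simp]: "t = top" by (metis infinity_ennreal_def less_top)
  show ?thesis
    by (rule rc_pathsI) (auto simp: path_shift_def intro!: exI[of _ top])
qed

lemma stopped_rc_paths:
  assumes w: "w \<in> rc_paths"
  shows "stopped t w \<in> rc_paths"
proof (rule rc_pathsI)
  fix s y S assume *: "s < \<infinity>" "stopped t w s = Some y" "open S" "y \<in> S"
  show "\<exists>u>s. \<forall>v. s < v \<longrightarrow> v < u \<longrightarrow> stopped t w v \<in> Some ` S"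
  proof (cases "s < t")
    case True
    then have "min s t = s" by simp
    then have "w s = Some y" using * by (simp add: stopped_def)
    then obtain u where u: "u > s" "\<And>v. s \<le> v \<Longrightarrow> v < u \<Longrightarrow> w v \<in> Some ` S"
      using rc_paths_rightD[OF w _ *(3,4,1)] by metis
    have "stopped t w v \<in> Some ` S" if "s < v" "v < min u t" for v
    proof -
      have "min v t = v" using that by simp
      then show ?thesis unfolding stopped_def using u(2)[of v] that by simp
    qed
    moreover have "s < min u t" using u True by simp
    ultimately show ?thesis by blast
  next
    case False
    then have "min v t = min s t" if "s < v" for v using that by simp
    then have "stopped t w v = Some y" if "s < v" for v
      using that *(2) unfolding stopped_def by metis
    then have "\<forall>v. s < v \<longrightarrow> v < top \<longrightarrow> stopped t w v \<in> Some ` S" using *(4) by simp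
    moreover have "s < top" using *(1) by simp
    ultimately show ?thesis by blast
  qed
next
  fix r s assume *: "stopped t w r = None" "r \<le> s"
  show "stopped t w s = None"
    unfolding stopped_def
  proof (rule rc_paths_NoneD[OF w, of "min r t"])
    show "w (min r t) = None" using * by (simp add: stopped_def)
    show "min r t \<le> min s t" using * by (intro min.mono) auto
  qed
qed

lemma measurable_path_shift [measurable]: "path_shift t \<in> path_space \<rightarrow>\<^sub>M path_space"
proof (rule measurable_path_spaceI)
  show "(\<lambda>w. path_shift t w s) \<in> path_space \<rightarrow>\<^sub>M cemetery_borel" for s
    unfolding path_shift_def by (rule measurable_coordinate)
qed (simp add: space_path_space path_shift_rc_paths)

lemma path_shift_stopped: "path_shift s (stopped (s + t) w) = stopped t (path_shift s w)"
proof -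
  have "min (s + x) (s + t) = s + min x t" for x :: ennreal
    by (cases "x \<le> t") (simp_all add: min_def add_left_mono antisym not_le less_imp_le)
  then show ?thesis unfolding path_shift_def stopped_def by simp
qed

definition grid :: "nat \<Rightarrow> real \<Rightarrow> ennreal" where
  "grid n s = ennreal ((real_of_int \<lfloor>2 ^ n * s\<rfloor> + 1) / 2 ^ n)"

lemma grid_bounds:
  assumes "0 \<le> s"
  shows "ennreal s < grid n s" "grid n s \<le> ennreal (s + 1 / 2 ^ n)"
proof -
  define x where "x = 2 ^ n * s"
  have s: "s = x / 2 ^ n" by (simp add: x_def)
  have "x < real_of_int \<lfloor>x\<rfloor> + 1" "real_of_int \<lfloor>x\<rfloor> \<le> x" by linarith+
  then have "s < (real_of_int \<lfloor>x\<rfloor> + 1) / 2 ^ n" "(real_of_int \<lfloor>x\<rfloor> + 1) / 2 ^ n \<le> s + 1 / 2 ^ n"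
    unfolding s add_divide_distrib[symmetric] by (auto intro: divide_strict_right_mono divide_right_mono)
  then show "ennreal s < grid n s" "grid n s \<le> ennreal (s + 1 / 2 ^ n)"
    unfolding grid_def x_def using assms by (auto intro!: ennreal_leI simp: ennreal_less_iff simp del: ennreal_plus)
qed

lemma grid_neg: "s < 0 \<Longrightarrow> grid n s = 0"
proof -
  assume "s < 0"
  then have "2 ^ n * s < 0" by (simp add: mult_less_0_iff)
  then have "\<lfloor>2 ^ n * s\<rfloor> + 1 \<le> 0" by linarith
  then have "real_of_int \<lfloor>2 ^ n * s\<rfloor> + 1 \<le> 0" by linarith
  then show ?thesis unfolding grid_def
    by (intro ennreal_neg divide_nonpos_pos) auto
qed

lemma eventually_grid:
  assumes "u > ennreal s"
  shows "eventually (\<lambda>n. ennreal s \<le> grid n s \<and> grid n s < u) sequentially"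
proof (cases "0 \<le> s")
  case True
  have "(\<lambda>n. ennreal (s + (1/2) ^ n)) \<longlonglongrightarrow> ennreal (s + 0)"
    by (intro tendsto_ennrealI tendsto_intros LIMSEQ_power_zero) auto
  then have "eventually (\<lambda>n. ennreal (s + (1/2)^n) < u) sequentially"
    using assms by (intro order_tendstoD) auto
  then show ?thesis
    proof eventually_elim
    case (elim n)
    then have "ennreal (s + 1 / 2 ^ n) < u" by (simp add: power_one_over)
    then show ?case
      using grid_bounds[OF True, of n] by (meson le_less_trans less_imp_le)
  qed
next
  case False
  then show ?thesis using assms by (auto simp: grid_neg ennreal_neg)
qed

definition inner_part :: "'a::metric_space set \<Rightarrow> nat \<Rightarrow> 'a set" where
  "inner_part D k = (\<Inter>y\<in>-D. {x. dist x y \<ge> 1 / real (Suc k)})"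

lemma closed_inner_part: "closed (inner_part D k)"
  unfolding inner_part_def by (intro closed_INT ballI closed_Collect_le continuous_intros)

lemma inner_part_subset: "inner_part D k \<subseteq> D"
proof
  fix x assume x: "x \<in> inner_part D k"
  show "x \<in> D"
  proof (rule ccontr)
    assume "x \<notin> D"
    with x have "dist x x \<ge> 1 / real (Suc k)" unfolding inner_part_def by blast
    then show False by (simp add: divide_le_0_iff)
  qed
qed

lemma inner_part_nhd:
  assumes "open D" "x \<in> D"
  obtains k e where "e > 0" "ball x e \<subseteq> inner_part D k"
proof -
  obtain e where e: "e > 0" "ball x e \<subseteq> D" using assms openE by blast
  obtain k where k: "1 / real (Suc k) < e / 2"
    using nat_approx_posE[of "e/2"] e by (metis half_gt_zero)
  have "ball x (e/2) \<subseteq> inner_part D k"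
    unfolding inner_part_def
  proof (intro subsetI INT_I CollectI)
    fix z y assume z: "z \<in> ball x (e/2)" and y: "y \<in> - D"
    then have "dist x y \<ge> e" using e by force
    moreover have "dist x y \<le> dist x z + dist z y" by (rule dist_triangle)
    ultimately show "1 / real (Suc k) \<le> dist z y" using z k by simp
  qed
  then show thesis using that[of "e/2" k] e by auto
qed

lemma rc_path_in_open_iff:
  assumes w: "w \<in> rc_paths" and D: "open (D :: 'a::metric_space set)"
  shows "w (ennreal s) \<in> Some ` D \<longleftrightarrow> (\<exists>k. \<exists>N. \<forall>n\<ge>N. w (grid n s) \<in> Some ` inner_part D k)"
proof
  assume "w (ennreal s) \<in> Some ` D"
  then obtain x where x: "w (ennreal s) = Some x" "x \<in> D" by auto
  obtain k e where k: "e > 0" "ball x e \<subseteq> inner_part D k"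
    using inner_part_nhd[OF D x(2)] .
  obtain u where u: "u > ennreal s" "\<And>v. ennreal s \<le> v \<Longrightarrow> v < u \<Longrightarrow> w v \<in> Some ` ball x e"
    using rc_paths_rightD[OF w x(1), of "ball x e"] k by auto
  have "eventually (\<lambda>n. w (grid n s) \<in> Some ` inner_part D k) sequentially"
    using eventually_grid[OF u(1)]
  proof eventually_elim
    case (elim n)
    then have "w (grid n s) \<in> Some ` ball x e" using u(2)[of "grid n s"] by simp
    then show ?case using image_mono[OF k(2), of Some] by (rule rev_subsetD)
  qed
  then show "\<exists>k. \<exists>N. \<forall>n\<ge>N. w (grid n s) \<in> Some ` inner_part D k"
    unfolding eventually_sequentially by blast
next
  assume "\<exists>k. \<exists>N. \<forall>n\<ge>N. w (grid n s) \<in> Some ` inner_part D k"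
  then obtain k where k: "eventually (\<lambda>n. w (grid n s) \<in> Some ` inner_part D k) sequentially"
    unfolding eventually_sequentially by blast
  have le: "eventually (\<lambda>n. ennreal s \<le> grid n s \<and> grid n s < top) sequentially"
    by (rule eventually_grid) simp
  show "w (ennreal s) \<in> Some ` D"
  proof (cases "w (ennreal s)")
    case None
    obtain n where n: "w (grid n s) \<in> Some ` inner_part D k" "ennreal s \<le> grid n s"
      using eventually_happens'[OF sequentially_bot eventually_conj[OF k le]] by blast
    show ?thesis using n(1) rc_paths_NoneD[OF w None n(2)] by simp
  next
    case (Some x)
    have "x \<in> inner_part D k"
    proof (rule ccontr)
      assume "x \<notin> inner_part D k"
      then have "open (- inner_part D k)" "x \<in> - inner_part D k"
        using closed_inner_part by auto
      then obtain u where u: "u > ennreal s"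
        "\<And>v. ennreal s \<le> v \<Longrightarrow> v < u \<Longrightarrow> w v \<in> Some ` (- inner_part D k)"
        using rc_paths_rightD[OF w Some, of "- inner_part D k"] by auto
      obtain n where "w (grid n s) \<in> Some ` inner_part D k" "ennreal s \<le> grid n s" "grid n s < u"
        using eventually_happens'[OF sequentially_bot eventually_conj[OF k eventually_grid[OF u(1)]]] by blast
      then show False using u(2)[of "grid n s"] by (metis ComplD imageE option.inject)
    qed
    then have "x \<in> D" using inner_part_subset[of D k] by blast
    then show ?thesis using Some by simp
  qed
qed

lemma measurable_path_eval:
  assumes D: "open (D :: 'a::metric_space set)"
  shows "Measurable.pred (borel \<Otimes>\<^sub>M path_space) (\<lambda>p. snd p (ennreal (fst p)) \<in> Some ` D)"
proof (rule measurable_cong[THEN iffD2])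
  show "(snd p (ennreal (fst p)) \<in> Some ` D) \<longleftrightarrow>
      (\<exists>k. \<exists>N. \<forall>n\<ge>N. snd p (grid n (fst p)) \<in> Some ` inner_part D k)"
    if "p \<in> space (borel \<Otimes>\<^sub>M path_space)" for p
  proof (rule rc_path_in_open_iff[OF _ D])
    show "snd p \<in> rc_paths"
      using that by (simp add: space_pair_measure space_path_space mem_Times_iff)
  qed
  have grid_eval: "(\<lambda>p. snd p (grid n (fst p))) \<in> borel \<Otimes>\<^sub>M path_space \<rightarrow>\<^sub>M cemetery_borel" for n
    unfolding grid_def
  proof (rule measurable_compose_countable[where g="\<lambda>p. \<lfloor>(2::real) ^ n * fst p\<rfloor>"
        and f="\<lambda>i p. snd p (ennreal ((real_of_int i + 1) / 2 ^ n))"])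
    show "(\<lambda>p. snd p (ennreal ((real_of_int i + 1) / 2 ^ n))) \<in> borel \<Otimes>\<^sub>M path_space \<rightarrow>\<^sub>M cemetery_borel" for i
      by (rule measurable_compose[OF measurable_snd measurable_coordinate])
    show "(\<lambda>p. \<lfloor>(2::real) ^ n * fst p\<rfloor>) \<in> borel \<Otimes>\<^sub>M path_space \<rightarrow>\<^sub>M count_space UNIV"
      by measurable
  qed
  have "Some ` inner_part D k \<in> sets cemetery_borel" for k
    using closed_inner_part by (intro Some_image_cemetery borel_closed)
  then have *: "Measurable.pred (borel \<Otimes>\<^sub>M path_space) (\<lambda>p. snd p (grid n (fst p)) \<in> Some ` inner_part D k)" for k n
    using grid_eval by (rule pred_sets2)
  show "Measurable.pred (borel \<Otimes>\<^sub>M path_space)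
      (\<lambda>p. \<exists>k. \<exists>N. \<forall>n\<ge>N. snd p (grid n (fst p)) \<in> Some ` inner_part D k)"
    by (intro pred_intros_countable pred_intros_imp' *)
qed

section \<open>Occupation functional and Markov property\<close>

definition sojourn :: "'a set \<Rightarrow> real \<Rightarrow> (ennreal \<Rightarrow> 'a option) \<Rightarrow> real" where
  "sojourn D t w = measure lborel {s \<in> {0..<t}. w (ennreal s) \<in> Some ` D}"

lemma sojourn_set_measurable:
  assumes w: "w \<in> rc_paths" and D: "open (D :: 'a::metric_space set)"
  shows "{s \<in> {a..<t}. w (ennreal s) \<in> Some ` D} \<in> sets borel"
proof -
  have "(\<lambda>s. (s, w)) \<in> borel \<rightarrow>\<^sub>M borel \<Otimes>\<^sub>M path_space"
    using w by (intro measurable_Pair measurable_ident_sets measurable_const) (auto simp: space_path_space)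
  from measurable_compose[OF this measurable_path_eval[OF D]]
  have [measurable]: "Measurable.pred borel (\<lambda>s. w (ennreal s) \<in> Some ` D)" by simp
  show ?thesis by measurable
qed

lemma sojourn_fmeasurable:
  assumes w: "w \<in> rc_paths" and D: "open (D :: 'a::metric_space set)"
  shows "{s \<in> {a..<t}. w (ennreal s) \<in> Some ` D} \<in> fmeasurable lborel"
proof (rule fmeasurableI2)
  show "{a..t} \<in> fmeasurable lborel"
    by (intro fmeasurableI) (auto simp: emeasure_lborel_Icc_eq)
qed (use sojourn_set_measurable[OF assms] in auto)

lemma occupation_time_eq_sojourn:
  fixes D :: "'a::metric_space set"
  assumes w: "(\<lambda>s. X s \<omega>) \<in> rc_paths" and D: "open D"
  shows "occupation_time X D t \<omega> = sojourn D t (\<lambda>s. X s \<omega>)"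
proof -
  have "occupation_time X D t \<omega> =
      (LINT s|lborel. indicator {s \<in> {0..t}. X (ennreal s) \<omega> \<in> Some ` D} s)"
    unfolding occupation_time_def set_lebesgue_integral_def
    by (intro Bochner_Integration.integral_cong) (auto simp: indicator_def)
  also have "\<dots> = measure lborel {s \<in> {0..t}. X (ennreal s) \<omega> \<in> Some ` D}"
    by simp
  also have "{s \<in> {0..t}. X (ennreal s) \<omega> \<in> Some ` D} =
     {s \<in> {0..<t}. X (ennreal s) \<omega> \<in> Some ` D} \<union> {s \<in> {t}. 0 \<le> t \<and> X (ennreal s) \<omega> \<in> Some ` D}"
    by auto
  also have "measure lborel \<dots> = measure lborel {s \<in> {0..<t}. X (ennreal s) \<omega> \<in> Some ` D}"
  proof (rule measure_Un_null_set)
    show "{s \<in> {0..<t}. X (ennreal s) \<omega> \<in> Some ` D} \<in> sets lborel"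
      using sojourn_set_measurable[OF w D, of 0 t] by simp
    show "{s \<in> {t}. 0 \<le> t \<and> X (ennreal s) \<omega> \<in> Some ` D} \<in> null_sets lborel"
      by (rule countable_imp_null_set_lborel) (rule countable_subset[of _ "{t}"], auto)
  qed
  finally show ?thesis by (simp add: sojourn_def)
qed

lemma sojourn_nonneg: "0 \<le> sojourn D t w"
  by (simp add: sojourn_def)

lemma sojourn_le:
  assumes "w \<in> rc_paths" "open (D :: 'a::metric_space set)" "0 \<le> t"
  shows "sojourn D t w \<le> t"
proof -
  have "sojourn D t w \<le> measure lborel {0..<t}"
    unfolding sojourn_def
  proof (rule measure_mono_fmeasurable)
    show "{0..<t} \<in> fmeasurable lborel" by (intro fmeasurableI) (use assms in auto)
  qed (use sojourn_set_measurable[OF assms(1,2)] in auto)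
  also have "\<dots> = t" using assms by simp
  finally show ?thesis .
qed

lemma sojourn_mono:
  assumes "w \<in> rc_paths" "open (D :: 'a::metric_space set)" "open E" "D \<subseteq> E" "t \<le> u"
  shows "sojourn D t w \<le> sojourn E u w"
  unfolding sojourn_def
proof (rule measure_mono_fmeasurable)
  show "{s \<in> {0..<t}. w (ennreal s) \<in> Some ` D} \<subseteq> {s \<in> {0..<u}. w (ennreal s) \<in> Some ` E}"
    using assms by auto
qed (use sojourn_set_measurable[OF assms(1,2)] sojourn_fmeasurable[OF assms(1,3)] in auto)

lemma sojourn_add:
  assumes w: "w \<in> rc_paths" and D: "open (D :: 'a::metric_space set)" and tu: "0 \<le> t" "0 \<le> u"
  shows "sojourn D (t + u) w = sojourn D t w + sojourn D u (path_shift (ennreal t) w)"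
proof -
  let ?B = "{s \<in> {t..<t + u}. w (ennreal s) \<in> Some ` D}"
  have "{s \<in> {0..<t + u}. w (ennreal s) \<in> Some ` D} = {s \<in> {0..<t}. w (ennreal s) \<in> Some ` D} \<union> ?B"
    using tu by auto
  moreover have "measure lborel ({s \<in> {0..<t}. w (ennreal s) \<in> Some ` D} \<union> ?B) =
      measure lborel {s \<in> {0..<t}. w (ennreal s) \<in> Some ` D} + measure lborel ?B"
  proof -
    have "{s \<in> {0..<t}. w (ennreal s) \<in> Some ` D} \<inter> ?B = {}" by auto
    with measure_Un3[OF sojourn_fmeasurable[OF w D, of 0 t] sojourn_fmeasurable[OF w D, of t "t + u"]]
    show ?thesis by simp
  qed
  moreover have "measure lborel ?B = measure (distr lborel borel ((+) t)) ?B"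
    by (simp add: lborel_distr_plus)
  moreover have "\<dots> = measure lborel ((+) t -` ?B)"
    using sojourn_set_measurable[OF w D] by (subst measure_distr) auto
  moreover have "(+) t -` ?B = {s \<in> {0..<u}. path_shift (ennreal t) w (ennreal s) \<in> Some ` D}"
    using tu by (auto simp: path_shift_def)
  ultimately show ?thesis by (simp add: sojourn_def)
qed

lemma sojourn_blocks:
  assumes w: "w \<in> rc_paths" and D: "open (D :: 'a::metric_space set)" and t: "0 \<le> t"
  shows "sojourn D (real N * t) w = (\<Sum>i<N. sojourn D t (path_shift (ennreal (real i * t)) w))"
proof (induction N)
  case 0
  then show ?case using sojourn_le[OF w D, of 0] sojourn_nonneg[of D 0 w] by simp
next
  case (Suc N)
  have "real (Suc N) * t = real N * t + t" by (simp add: distrib_right)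
  then show ?case using sojourn_add[OF w D _ t, of "real N * t"] Suc t by simp
qed

lemma sojourn_stopped: "sojourn D t (stopped (ennreal t) w) = sojourn D t w"
proof -
  have "stopped (ennreal t) w (ennreal s) = w (ennreal s)" if "s \<in> {0..<t}" for s
    using that by (auto simp: stopped_def min_def ennreal_leI)
  then have "{s \<in> {0..<t}. stopped (ennreal t) w (ennreal s) \<in> Some ` D} = {s \<in> {0..<t}. w (ennreal s) \<in> Some ` D}"
    by auto
  then show ?thesis by (simp add: sojourn_def)
qed

lemma measurable_sojourn:
  assumes D: "open (D :: 'a::metric_space set)"
  shows "sojourn D t \<in> borel_measurable path_space"
proof -
  let ?Q = "{p \<in> space (path_space \<Otimes>\<^sub>M lborel). snd p \<in> {0..<t} \<and> fst p (ennreal (snd p)) \<in> Some ` D}"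
  have "(\<lambda>p. (snd p, fst p)) \<in> path_space \<Otimes>\<^sub>M lborel \<rightarrow>\<^sub>M borel \<Otimes>\<^sub>M path_space"
    by measurable
  from measurable_compose[OF this measurable_path_eval[OF D]]
  have [measurable]: "Measurable.pred (path_space \<Otimes>\<^sub>M lborel) (\<lambda>p. fst p (ennreal (snd p)) \<in> Some ` D)"
    by simp
  have "?Q \<in> sets (path_space \<Otimes>\<^sub>M lborel)" by measurable
  from lborel.measurable_emeasure_Pair[OF this]
  have "(\<lambda>w. enn2real (emeasure lborel (Pair w -` ?Q))) \<in> borel_measurable path_space"
    by measurable
  then show ?thesis
  proof (rule measurable_cong[THEN iffD1, rotated])
    fix w :: "ennreal \<Rightarrow> 'a option" assume "w \<in> space path_space"
    then have "Pair w -` ?Q = {s \<in> {0..<t}. w (ennreal s) \<in> Some ` D}"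
      by (auto simp: space_pair_measure)
    then show "enn2real (emeasure lborel (Pair w -` ?Q)) = sojourn D t w"
      by (simp add: sojourn_def measure_def)
  qed
qed

context borel_standard_process
begin

abbreviation path :: "'w \<Rightarrow> ennreal \<Rightarrow> 'a option" where
  "path \<omega> \<equiv> (\<lambda>t. X t \<omega>)"

lemma space_P: "space (P x) = \<Omega>"
  using sets_eq_imp_space_eq[OF sets_P] space_F by simp

lemma path_rc: "\<omega> \<in> \<Omega> \<Longrightarrow> path \<omega> \<in> rc_paths"
proof -
  assume \<omega>: "\<omega> \<in> \<Omega>"
  have "X t \<omega> = None" if "X s \<omega> = None" "s \<le> t" for s t
  proof (rule cemetery[OF \<omega>])
    have "lifetime X \<omega> \<le> s" unfolding lifetime_def using that by (intro Inf_lower) auto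
    then show "lifetime X \<omega> \<le> t" using that by simp
  qed
  then show ?thesis using right_continuous[OF \<omega>] unfolding rc_paths_def by blast
qed

lemma measurable_X: "sets (F t) \<subseteq> sets M \<Longrightarrow> space M = \<Omega> \<Longrightarrow> X t \<in> M \<rightarrow>\<^sub>M cemetery_borel"
  by (rule measurable_mono[THEN subsetD, OF _ _ _ _ adapted]) (auto simp: space_F)

lemma sets_F_le_P: "sets (F t) \<subseteq> sets (P x)"
  unfolding sets_P by (intro sets_F_mono) simp

lemma measurable_X_P [measurable]: "X t \<in> P x \<rightarrow>\<^sub>M cemetery_borel"
  by (rule measurable_X[OF sets_F_le_P space_P])

lemma X_set_P: "B \<in> sets cemetery_borel \<Longrightarrow> {\<omega>\<in>\<Omega>. X t \<omega> \<in> B} \<in> sets (P x)"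
  using measurable_sets[OF measurable_X_P, of B t x] by (simp add: space_P vimage_def Int_def conj_commute)

lemma X_set_F: "B \<in> sets cemetery_borel \<Longrightarrow> s \<le> t \<Longrightarrow> {\<omega>\<in>\<Omega>. X s \<omega> \<in> B} \<in> sets (F t)"
  using measurable_sets[OF adapted, of B s] sets_F_mono[of s t]
  by (auto simp: space_F vimage_def Int_def conj_commute)

lemma measurable_path [measurable]: "path \<in> P x \<rightarrow>\<^sub>M path_space"
  by (rule measurable_path_spaceI) (auto simp: space_P path_rc)

lemma measurable_path_stopped: "(\<lambda>\<omega>. stopped t (path \<omega>)) \<in> F t \<rightarrow>\<^sub>M path_space"
proof (rule measurable_path_spaceI)
  show "(\<lambda>\<omega>. stopped t (path \<omega>) s) \<in> F t \<rightarrow>\<^sub>M cemetery_borel" for s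
    unfolding stopped_def by (rule measurable_X) (auto simp: space_F sets_F_mono)
qed (auto simp: space_F path_rc stopped_rc_paths)

lemma stopped_event_F:
  assumes E: "E \<in> sets path_space" and "\<And>w. w \<in> rc_paths \<Longrightarrow> w \<in> E \<longleftrightarrow> stopped t w \<in> E"
  shows "{\<omega>\<in>\<Omega>. path \<omega> \<in> E} \<in> sets (F t)"
proof -
  have "{\<omega>\<in>\<Omega>. path \<omega> \<in> E} = (\<lambda>\<omega>. stopped t (path \<omega>)) -` E \<inter> space (F t)"
    using assms(2)[OF path_rc] by (auto simp: space_F)
  then show ?thesis using measurable_sets[OF measurable_path_stopped E] by simp
qed

lemma path_event_P: "E \<in> sets path_space \<Longrightarrow> {\<omega>\<in>\<Omega>. path \<omega> \<in> E} \<in> sets (P x)"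
  using measurable_sets[OF measurable_path, of E x] by (simp add: space_P vimage_def Int_def conj_commute)

lemma stopping_time_const_F: "A \<in> sets (F t) \<Longrightarrow> A \<in> sets (pre_sigma (\<lambda>_. t))"
proof (rule sets_pre_sigmaI[OF stopping_time_const])
  fix s assume "A \<in> sets (F t)"
  then show "{\<omega>\<in>A. t \<le> s} \<in> sets (F s)"
    using sets_F_mono[of t s] by (cases "t \<le> s") auto
qed

lemma Markov_one:
  assumes "A \<in> sets (F t)" "B \<in> sets cemetery_borel"
  shows "emeasure (P x) {\<omega>\<in>A. X (t + u) \<omega> \<in> B} =
      (\<integral>\<^sup>+\<omega>\<in>A. emeasure (P (X t \<omega>)) {\<omega>'\<in>\<Omega>. X u \<omega>' \<in> B} \<partial>P x)"
  using strong_Markov[OF stopping_time_const stopping_time_const_F[OF assms(1)] assms(2)] .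

definition transition :: "ennreal \<Rightarrow> 'a option \<Rightarrow> 'a option measure" where
  "transition u y = distr (P y) cemetery_borel (X u)"

lemma emeasure_transition:
  "B \<in> sets cemetery_borel \<Longrightarrow> emeasure (transition u y) B = emeasure (P y) {\<omega>\<in>\<Omega>. X u \<omega> \<in> B}"
  unfolding transition_def
  by (subst emeasure_distr) (auto simp: space_P vimage_def Int_def conj_commute)

lemma measurable_transition [measurable]: "transition u \<in> cemetery_borel \<rightarrow>\<^sub>M subprob_algebra cemetery_borel"
proof (rule measurable_subprob_algebra)
  fix y show "subprob_space (transition u y)"
    unfolding transition_def
    by (intro prob_space_imp_subprob_space prob_space.prob_space_distr prob) measurable
  show "sets (transition u y) = sets cemetery_borel" by (simp add: transition_def)
next
  fix B :: "'a option set" assume "B \<in> sets cemetery_borel"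
  then show "(\<lambda>y. emeasure (transition u y) B) \<in> borel_measurable cemetery_borel"
    using borel_transition[of B u] by (simp add: emeasure_transition)
qed

lemma Markov_fun:
  assumes A: "A \<in> sets (F t)" and g: "g \<in> borel_measurable cemetery_borel"
  shows "(\<integral>\<^sup>+\<omega>\<in>A. g (X (t + u) \<omega>) \<partial>P x) = (\<integral>\<^sup>+\<omega>\<in>A. (\<integral>\<^sup>+\<omega>'. g (X u \<omega>') \<partial>P (X t \<omega>)) \<partial>P x)"
proof -
  have AP: "A \<in> sets (P x)" using A sets_F_le_P by blast
  have A\<Omega>: "A \<subseteq> \<Omega>" using sets.sets_into_space[OF A] by (simp add: space_F)
  have dens: "emeasure (density (P x) (indicator A)) B = emeasure (P x) (A \<inter> B)" if "B \<in> sets (P x)" for B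
    using that AP by (simp add: emeasure_density nn_integral_set_ennreal[symmetric] indicator_inter_arith[symmetric])
  let ?D = "density (P x) (indicator A)"
  have eq: "distr ?D cemetery_borel (X (t + u)) = distr ?D cemetery_borel (X t) \<bind> transition u"
  proof (rule measure_eqI)
    show "sets (distr ?D cemetery_borel (X (t + u))) = sets (distr ?D cemetery_borel (X t) \<bind> transition u)"
      by (subst sets_bind[where N=cemetery_borel]) (auto simp: transition_def)
    fix B assume "B \<in> sets (distr ?D cemetery_borel (X (t + u)))"
    then have B: "B \<in> sets cemetery_borel" by simp
    have "emeasure (distr ?D cemetery_borel (X (t + u))) B = emeasure ?D {\<omega>\<in>\<Omega>. X (t + u) \<omega> \<in> B}"
      using B by (subst emeasure_distr) (auto simp: space_P vimage_def Int_def conj_commute)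
    also have "\<dots> = emeasure (P x) {\<omega>\<in>A. X (t + u) \<omega> \<in> B}"
      using A\<Omega> by (subst dens[OF X_set_P[OF B]]) (auto intro!: arg_cong[where f="emeasure (P x)"])
    also have "\<dots> = (\<integral>\<^sup>+\<omega>\<in>A. emeasure (P (X t \<omega>)) {\<omega>'\<in>\<Omega>. X u \<omega>' \<in> B} \<partial>P x)"
      by (rule Markov_one[OF A B])
    also have "\<dots> = (\<integral>\<^sup>+\<omega>. emeasure (transition u (X t \<omega>)) B \<partial>?D)"
    proof -
      have "(\<integral>\<^sup>+\<omega>. emeasure (transition u (X t \<omega>)) B \<partial>?D) =
          (\<integral>\<^sup>+\<omega>. indicator A \<omega> * emeasure (transition u (X t \<omega>)) B \<partial>P x)"
        by (intro nn_integral_density borel_measurable_indicator AP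
              measurable_compose[OF measurable_X_P measurable_compose[OF measurable_transition
                measurable_emeasure_subprob_algebra[OF B]]])
      then show ?thesis using B by (simp add: emeasure_transition mult.commute)
    qed
    also have "\<dots> = (\<integral>\<^sup>+y. emeasure (transition u y) B \<partial>distr ?D cemetery_borel (X t))"
      using B by (subst nn_integral_distr) auto
    also have "\<dots> = emeasure (distr ?D cemetery_borel (X t) \<bind> transition u) B"
      using B by (subst emeasure_bind[where N=cemetery_borel]) auto
    finally show "emeasure (distr ?D cemetery_borel (X (t + u))) B =
        emeasure (distr ?D cemetery_borel (X t) \<bind> transition u) B" .
  qed
  have "(\<integral>\<^sup>+\<omega>\<in>A. g (X (t + u) \<omega>) \<partial>P x) = (\<integral>\<^sup>+y. g y \<partial>distr ?D cemetery_borel (X (t + u)))"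
    using g AP by (subst nn_integral_distr) (auto simp: nn_integral_density mult.commute)
  also have "\<dots> = (\<integral>\<^sup>+y. (\<integral>\<^sup>+z. g z \<partial>transition u y) \<partial>distr ?D cemetery_borel (X t))"
    unfolding eq using g by (subst nn_integral_bind[where B=cemetery_borel]) auto
  also have "\<dots> = (\<integral>\<^sup>+\<omega>. (\<integral>\<^sup>+z. g z \<partial>transition u (X t \<omega>)) \<partial>?D)"
    using g by (subst nn_integral_distr) (auto intro!: measurable_compose[OF _ nn_integral_measurable_subprob_algebra2[where N=cemetery_borel]])
  also have "\<dots> = (\<integral>\<^sup>+\<omega>. indicator A \<omega> * (\<integral>\<^sup>+z. g z \<partial>transition u (X t \<omega>)) \<partial>P x)"
    using g AP by (subst nn_integral_density) auto
  also have "\<dots> = (\<integral>\<^sup>+\<omega>\<in>A. (\<integral>\<^sup>+\<omega>'. g (X u \<omega>') \<partial>P (X t \<omega>)) \<partial>P x)"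
    unfolding transition_def using g by (simp add: nn_integral_distr mult.commute)
  finally show ?thesis .
qed

lemma measurable_transition_fun:
  assumes "g \<in> borel_measurable cemetery_borel"
  shows "(\<lambda>y. \<integral>\<^sup>+\<omega>. g (X u \<omega>) \<partial>P y) \<in> borel_measurable cemetery_borel"
proof -
  have "(\<lambda>y. \<integral>\<^sup>+z. g z \<partial>transition u y) \<in> borel_measurable cemetery_borel"
    using assms by measurable
  then show ?thesis unfolding transition_def using assms by (simp add: nn_integral_distr)
qed

text \<open>Induction on the number of times: the smallest time is split off and the others are
  measured from there.\<close>

lemma Markov_cylinder:
  assumes "finite J" "\<And>j. B j \<in> sets cemetery_borel"
  shows "(\<lambda>y. emeasure (P y) {\<omega>\<in>\<Omega>. \<forall>j\<in>J. X j \<omega> \<in> B j}) \<in> borel_measurable cemetery_borel"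
    and "A \<in> sets (F t) \<Longrightarrow> emeasure (P x) {\<omega>\<in>A. \<forall>j\<in>J. X (t + j) \<omega> \<in> B j} =
      (\<integral>\<^sup>+\<omega>\<in>A. emeasure (P (X t \<omega>)) {\<omega>'\<in>\<Omega>. \<forall>j\<in>J. X j \<omega>' \<in> B j} \<partial>P x)"
proof -
  have "(\<lambda>y. emeasure (P y) {\<omega>\<in>\<Omega>. \<forall>j\<in>J. X j \<omega> \<in> B j}) \<in> borel_measurable cemetery_borel \<and>
    (\<forall>A t x. A \<in> sets (F t) \<longrightarrow> emeasure (P x) {\<omega>\<in>A. \<forall>j\<in>J. X (t + j) \<omega> \<in> B j} =
      (\<integral>\<^sup>+\<omega>\<in>A. emeasure (P (X t \<omega>)) {\<omega>'\<in>\<Omega>. \<forall>j\<in>J. X j \<omega>' \<in> B j} \<partial>P x))"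
    using assms
  proof (induction "card J" arbitrary: J B rule: less_induct)
    case less
    show ?case
    proof (cases "J = {}")
      case True
      have one: "emeasure (P y) \<Omega> = 1" for y
        using prob_space.emeasure_space_1[OF prob, of y] by (simp add: space_P)
      have "emeasure (P x) A = (\<integral>\<^sup>+\<omega>\<in>A. 1 \<partial>P x)" if "A \<in> sets (F t)" for A t x
      proof -
        have "A \<in> sets (P x)" using that sets_F_le_P by blast
        then show ?thesis by simp
      qed
      then show ?thesis using True by (simp add: one)
    next
      case False
      define j0 where "j0 = Min J"
      define J' where "J' = (\<lambda>j. j - j0) ` (J - {j0})"
      define B' where "B' k = B (j0 + k)" for k
      have j0: "j0 \<in> J" "\<And>j. j \<in> J \<Longrightarrow> j0 \<le> j"
        using False less.prems by (auto simp: j0_def)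
      have J_split: "(\<forall>j\<in>J. X (s + j) \<omega> \<in> B j) \<longleftrightarrow>
          X (s + j0) \<omega> \<in> B j0 \<and> (\<forall>k\<in>J'. X ((s + j0) + k) \<omega> \<in> B' k)" for s \<omega>
      proof -
        have *: "j0 + (j - j0) = j" if "j \<in> J - {j0}" for j
          using j0(2)[of j] that by (intro add_diff_inverse_ennreal) blast
        have "(\<forall>k\<in>J'. X ((s + j0) + k) \<omega> \<in> B' k) \<longleftrightarrow>
            (\<forall>j\<in>J - {j0}. X (s + (j0 + (j - j0))) \<omega> \<in> B (j0 + (j - j0)))"
          unfolding J'_def B'_def add.assoc by blast
        also have "\<dots> \<longleftrightarrow> (\<forall>j\<in>J - {j0}. X (s + j) \<omega> \<in> B j)"
          by (rule ball_cong[OF refl]) (simp only: *)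
        finally show ?thesis using j0(1) by blast
      qed
      have "card J' < card J"
      proof -
        have "card J' \<le> card (J - {j0})" unfolding J'_def using less.prems by (intro card_image_le) auto
        also have "\<dots> < card J" using less.prems(1) j0(1) by (rule card_Diff1_less)
        finally show ?thesis .
      qed
      moreover have "finite J'" using less.prems by (simp add: J'_def)
      moreover have B': "B' k \<in> sets cemetery_borel" for k using less.prems by (simp add: B'_def)
      ultimately have IH:
        "(\<lambda>y. emeasure (P y) {\<omega>\<in>\<Omega>. \<forall>k\<in>J'. X k \<omega> \<in> B' k}) \<in> borel_measurable cemetery_borel"
        "\<And>A t x. A \<in> sets (F t) \<Longrightarrow> emeasure (P x) {\<omega>\<in>A. \<forall>k\<in>J'. X (t + k) \<omega> \<in> B' k} =
          (\<integral>\<^sup>+\<omega>\<in>A. emeasure (P (X t \<omega>)) {\<omega>'\<in>\<Omega>. \<forall>k\<in>J'. X k \<omega>' \<in> B' k} \<partial>P x)"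
        using less.hyps[of J' B'] by blast+
      define g where "g y = emeasure (P y) {\<omega>\<in>\<Omega>. \<forall>k\<in>J'. X k \<omega> \<in> B' k} * indicator (B j0) y" for y
      have g [measurable]: "g \<in> borel_measurable cemetery_borel"
        unfolding g_def using IH(1) less.prems by (intro borel_measurable_times_ennreal borel_measurable_indicator) auto
      have step: "emeasure (P x) {\<omega>\<in>A. \<forall>j\<in>J. X (t + j) \<omega> \<in> B j} = (\<integral>\<^sup>+\<omega>\<in>A. g (X (t + j0) \<omega>) \<partial>P x)"
        if A: "A \<in> sets (F t)" for A t x
      proof -
        let ?A = "{\<omega>\<in>A. X (t + j0) \<omega> \<in> B j0}"
        have A\<Omega>: "A \<subseteq> \<Omega>" using sets.sets_into_space[OF A] by (simp add: space_F)
        have "?A = A \<inter> {\<omega>\<in>\<Omega>. X (t + j0) \<omega> \<in> B j0}" using A\<Omega> by auto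
        moreover have "A \<in> sets (F (t + j0))" using A sets_F_mono[of t "t + j0"] by auto
        ultimately have "?A \<in> sets (F (t + j0))"
          using X_set_F[of "B j0" "t + j0" "t + j0"] less.prems by auto
        from IH(2)[OF this, of x]
        have "emeasure (P x) {\<omega>\<in>?A. \<forall>k\<in>J'. X ((t + j0) + k) \<omega> \<in> B' k} =
          (\<integral>\<^sup>+\<omega>\<in>?A. emeasure (P (X (t + j0) \<omega>)) {\<omega>'\<in>\<Omega>. \<forall>k\<in>J'. X k \<omega>' \<in> B' k} \<partial>P x)" .
        also have "\<dots> = (\<integral>\<^sup>+\<omega>\<in>A. g (X (t + j0) \<omega>) \<partial>P x)"
          by (intro nn_integral_cong) (auto simp: g_def indicator_def)
        also have "{\<omega>\<in>?A. \<forall>k\<in>J'. X ((t + j0) + k) \<omega> \<in> B' k} = {\<omega>\<in>A. \<forall>j\<in>J. X (t + j) \<omega> \<in> B j}"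
          by (auto simp: J_split)
        finally show ?thesis .
      qed
      have "\<Omega> \<in> sets (F 0)" using sets.top[of "F 0"] by (simp add: space_F)
      from step[OF this]
      have G: "emeasure (P y) {\<omega>\<in>\<Omega>. \<forall>j\<in>J. X j \<omega> \<in> B j} = (\<integral>\<^sup>+\<omega>. g (X j0 \<omega>) \<partial>P y)" for y
        by (simp add: space_P[of y, symmetric] cong: nn_integral_cong)
      show ?thesis
      proof (intro conjI allI impI)
        show "(\<lambda>y. emeasure (P y) {\<omega>\<in>\<Omega>. \<forall>j\<in>J. X j \<omega> \<in> B j}) \<in> borel_measurable cemetery_borel"
          unfolding G by (rule measurable_transition_fun[OF g])
        show "emeasure (P x) {\<omega>\<in>A. \<forall>j\<in>J. X (t + j) \<omega> \<in> B j} =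
          (\<integral>\<^sup>+\<omega>\<in>A. emeasure (P (X t \<omega>)) {\<omega>'\<in>\<Omega>. \<forall>j\<in>J. X j \<omega>' \<in> B j} \<partial>P x)"
          if "A \<in> sets (F t)" for A t x
          unfolding G step[OF that] by (rule Markov_fun[OF that g])
      qed
    qed
  qed
  then show "(\<lambda>y. emeasure (P y) {\<omega>\<in>\<Omega>. \<forall>j\<in>J. X j \<omega> \<in> B j}) \<in> borel_measurable cemetery_borel"
    and "A \<in> sets (F t) \<Longrightarrow> emeasure (P x) {\<omega>\<in>A. \<forall>j\<in>J. X (t + j) \<omega> \<in> B j} =
      (\<integral>\<^sup>+\<omega>\<in>A. emeasure (P (X t \<omega>)) {\<omega>'\<in>\<Omega>. \<forall>j\<in>J. X j \<omega>' \<in> B j} \<partial>P x)"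
    by blast+
qed

lemma Markov_product_space:
  assumes E: "E \<in> sets (Pi\<^sub>M UNIV (\<lambda>_. cemetery_borel))"
  shows "{\<omega>\<in>\<Omega>. path \<omega> \<in> E} \<in> sets (P x)" (is ?E)
    and "(\<lambda>y. emeasure (P y) {\<omega>\<in>\<Omega>. path \<omega> \<in> E}) \<in> borel_measurable cemetery_borel" (is ?m)
    and "A \<in> sets (F t) \<Longrightarrow> emeasure (P x) {\<omega>\<in>A. path_shift t (path \<omega>) \<in> E} =
      (\<integral>\<^sup>+\<omega>\<in>A. emeasure (P (X t \<omega>)) {\<omega>'\<in>\<Omega>. path \<omega>' \<in> E} \<partial>P x)"
proof -
  let ?S = "Pi\<^sub>M UNIV (\<lambda>_::ennreal. cemetery_borel :: 'a option measure)"
  have meas_path: "path \<in> P y \<rightarrow>\<^sub>M ?S" for y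
    by (rule measurable_PiM_single') (auto simp: PiE_UNIV_domain)
  have meas_shift: "(\<lambda>\<omega>. path_shift t (path \<omega>)) \<in> P y \<rightarrow>\<^sub>M ?S" for y t
    unfolding path_shift_def by (rule measurable_PiM_single') (auto simp: PiE_UNIV_domain)
  define K where "K y = distr (P y) ?S path" for y
  have K: "emeasure (K y) B = emeasure (P y) {\<omega>\<in>\<Omega>. path \<omega> \<in> B}" if "B \<in> sets ?S" for B y
    unfolding K_def using that meas_path
    by (subst emeasure_distr) (auto simp: space_P vimage_def Int_def conj_commute)
  show ?E using measurable_sets[OF meas_path E, of x] by (simp add: space_P vimage_def Int_def conj_commute)
  have cyl: "prod_emb UNIV (\<lambda>_. cemetery_borel) J (Pi\<^sub>E J B) = {w::ennreal \<Rightarrow> 'a option. \<forall>j\<in>J. w j \<in> B j}" for J B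
    by (auto simp: prod_emb_def PiE_UNIV_domain PiE_iff)
  have fin: "{w. \<forall>j\<in>J. w j \<in> B j} \<in> sets ?S"
    if "finite J" "\<And>j. j \<in> J \<Longrightarrow> B j \<in> sets cemetery_borel" for J and B :: "ennreal \<Rightarrow> 'a option set"
    unfolding cyl[symmetric] using that by (intro sets_PiM_I) auto
  have "K \<in> cemetery_borel \<rightarrow>\<^sub>M subprob_algebra ?S"
  proof (rule measurable_subprob_algebra_generated[OF sets_PiM Int_stable_prod_algebra prod_algebra_sets_into_space])
    show "subprob_space (K y)" for y unfolding K_def
      by (intro prob_space_imp_subprob_space prob_space.prob_space_distr prob meas_path)
    show "sets (K y) = sets ?S" for y by (simp add: K_def)
  next
    fix E assume "E \<in> prod_algebra UNIV (\<lambda>_::ennreal. cemetery_borel :: 'a option measure)"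
    then obtain J B where JB: "E = prod_emb UNIV (\<lambda>_. cemetery_borel) J (Pi\<^sub>E J B)" "finite J"
        "\<And>j. j \<in> J \<Longrightarrow> B j \<in> sets cemetery_borel" by (rule prod_algebraE) blast
    define C where "C j = (if j \<in> J then B j else UNIV)" for j
    have C: "C j \<in> sets cemetery_borel" for j using JB(3) sets.top[of cemetery_borel] by (auto simp: C_def)
    have "E = {w. \<forall>j\<in>J. w j \<in> C j}" unfolding JB(1) cyl by (auto simp: C_def)
    then show "(\<lambda>y. emeasure (K y) E) \<in> borel_measurable cemetery_borel"
      using Markov_cylinder(1)[OF JB(2), of C] C fin[OF JB(2), of C] by (simp add: K)
  next
    have "emeasure (K y) (\<Pi>\<^sub>E i\<in>UNIV. space cemetery_borel) = 1" for y
      using prob_space.emeasure_space_1[OF prob_space.prob_space_distr[OF prob meas_path], of y]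
      by (simp add: K_def space_PiM)
    then show "(\<lambda>y. emeasure (K y) (\<Pi>\<^sub>E i\<in>UNIV. space cemetery_borel)) \<in> borel_measurable cemetery_borel"
      by simp
  qed
  note K_meas [measurable] = this
  show ?m
    using measurable_compose[OF K_meas measurable_emeasure_subprob_algebra[OF E]] by (simp add: K[OF E])
  assume A: "A \<in> sets (F t)"
  have AP: "A \<in> sets (P x)" using A sets_F_le_P by blast
  have A\<Omega>: "A \<subseteq> \<Omega>" using sets.sets_into_space[OF A] by (simp add: space_F)
  let ?D = "density (P x) (indicator A)"
  have dens: "emeasure ?D B = emeasure (P x) (A \<inter> B)" if "B \<in> sets (P x)" for B
    using that AP by (simp add: emeasure_density nn_integral_set_ennreal[symmetric] indicator_inter_arith[symmetric])
  have L: "emeasure (distr ?D ?S (\<lambda>\<omega>. path_shift t (path \<omega>))) B = emeasure (P x) {\<omega>\<in>A. path_shift t (path \<omega>) \<in> B}"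
    if "B \<in> sets ?S" for B
  proof -
    have "emeasure (distr ?D ?S (\<lambda>\<omega>. path_shift t (path \<omega>))) B = emeasure ?D {\<omega>\<in>\<Omega>. path_shift t (path \<omega>) \<in> B}"
      using that meas_shift by (subst emeasure_distr) (auto simp: space_P vimage_def Int_def conj_commute)
    also have "\<dots> = emeasure (P x) (A \<inter> {\<omega>\<in>\<Omega>. path_shift t (path \<omega>) \<in> B})"
      using measurable_sets[OF meas_shift that, of t x]
      by (intro dens) (simp add: space_P vimage_def Int_def conj_commute)
    also have "A \<inter> {\<omega>\<in>\<Omega>. path_shift t (path \<omega>) \<in> B} = {\<omega>\<in>A. path_shift t (path \<omega>) \<in> B}" using A\<Omega> by auto
    finally show ?thesis .
  qed
  have R: "emeasure (distr ?D cemetery_borel (X t) \<bind> K) B =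
      (\<integral>\<^sup>+\<omega>\<in>A. emeasure (P (X t \<omega>)) {\<omega>'\<in>\<Omega>. path \<omega>' \<in> B} \<partial>P x)" if B: "B \<in> sets ?S" for B
  proof -
    have "emeasure (distr ?D cemetery_borel (X t) \<bind> K) B =
        (\<integral>\<^sup>+y. emeasure (K y) B \<partial>distr ?D cemetery_borel (X t))"
      using B by (subst emeasure_bind[where N="?S"]) auto
    also have "\<dots> = (\<integral>\<^sup>+\<omega>. emeasure (K (X t \<omega>)) B \<partial>?D)"
      using measurable_compose[OF K_meas measurable_emeasure_subprob_algebra[OF B]]
      by (subst nn_integral_distr) auto
    also have "\<dots> = (\<integral>\<^sup>+\<omega>. indicator A \<omega> * emeasure (K (X t \<omega>)) B \<partial>P x)"
      by (intro nn_integral_density borel_measurable_indicator AP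
            measurable_compose[OF measurable_X_P measurable_compose[OF K_meas
              measurable_emeasure_subprob_algebra[OF B]]])
    finally show ?thesis using B by (simp add: K mult.commute)
  qed
  have "distr ?D ?S (\<lambda>\<omega>. path_shift t (path \<omega>)) = distr ?D cemetery_borel (X t) \<bind> K"
  proof (rule measure_eqI_PiM_infinite)
    show "sets (distr ?D cemetery_borel (X t) \<bind> K) = sets ?S"
      by (subst sets_bind[where N="?S"]) (auto simp: K_def)
    show "finite_measure (distr ?D ?S (\<lambda>\<omega>. path_shift t (path \<omega>)))"
    proof (rule finite_measureI)
      have "emeasure (distr ?D ?S (\<lambda>\<omega>. path_shift t (path \<omega>))) (space ?S) \<le> emeasure (P x) (space (P x))"
        unfolding L[OF sets.top] by (rule emeasure_space)
      then show "emeasure (distr ?D ?S (\<lambda>\<omega>. path_shift t (path \<omega>))) (space (distr ?D ?S (\<lambda>\<omega>. path_shift t (path \<omega>)))) \<noteq> \<infinity>"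
        using prob_space.emeasure_space_1[OF prob, of x] by (auto simp: top_unique)
    qed
  next
    fix J and B :: "ennreal \<Rightarrow> 'a option set"
    assume J: "finite J" "J \<subseteq> UNIV" "\<And>j. j \<in> J \<Longrightarrow> B j \<in> sets cemetery_borel"
    define C where "C j = (if j \<in> J then B j else UNIV)" for j
    have C: "C j \<in> sets cemetery_borel" for j using J(3) sets.top[of cemetery_borel] by (auto simp: C_def)
    have E: "prod_emb UNIV (\<lambda>_. cemetery_borel) J (Pi\<^sub>E J B) = {w. \<forall>j\<in>J. w j \<in> C j}"
      unfolding cyl by (auto simp: C_def)
    show "emeasure (distr ?D ?S (\<lambda>\<omega>. path_shift t (path \<omega>))) (prod_emb UNIV (\<lambda>_. cemetery_borel) J (Pi\<^sub>E J B)) =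
      emeasure (distr ?D cemetery_borel (X t) \<bind> K) (prod_emb UNIV (\<lambda>_. cemetery_borel) J (Pi\<^sub>E J B))"
      unfolding E L[OF fin[OF J(1) C]] R[OF fin[OF J(1) C]]
      using Markov_cylinder(2)[OF J(1) C A, of x] by (simp add: path_shift_def)
  qed simp
  then show "emeasure (P x) {\<omega>\<in>A. path_shift t (path \<omega>) \<in> E} =
      (\<integral>\<^sup>+\<omega>\<in>A. emeasure (P (X t \<omega>)) {\<omega>'\<in>\<Omega>. path \<omega>' \<in> E} \<partial>P x)"
    using L[OF E] R[OF E] by simp
qed

lemma path_space_trace:
  assumes "E \<in> sets path_space"
  obtains B where "B \<in> sets (Pi\<^sub>M UNIV (\<lambda>_. cemetery_borel))" "\<And>w. w \<in> rc_paths \<Longrightarrow> w \<in> E \<longleftrightarrow> w \<in> B"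
  using assms unfolding path_space_def sets_restrict_space by auto

lemma measurable_path_law:
  assumes "E \<in> sets path_space"
  shows "(\<lambda>y. emeasure (P y) {\<omega>\<in>\<Omega>. path \<omega> \<in> E}) \<in> borel_measurable cemetery_borel"
proof -
  obtain B where B: "B \<in> sets (Pi\<^sub>M UNIV (\<lambda>_. cemetery_borel))" "\<And>w. w \<in> rc_paths \<Longrightarrow> w \<in> E \<longleftrightarrow> w \<in> B"
    by (rule path_space_trace[OF assms]) (rule that)
  then have "{\<omega>\<in>\<Omega>. path \<omega> \<in> E} = {\<omega>\<in>\<Omega>. path \<omega> \<in> B}" using path_rc by blast
  then show ?thesis using Markov_product_space(2)[OF B(1)] by simp
qed

lemma Markov:
  assumes "E \<in> sets path_space" "A \<in> sets (F t)"
  shows "emeasure (P x) {\<omega>\<in>A. path_shift t (path \<omega>) \<in> E} =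
      (\<integral>\<^sup>+\<omega>\<in>A. emeasure (P (X t \<omega>)) {\<omega>'\<in>\<Omega>. path \<omega>' \<in> E} \<partial>P x)"
proof -
  obtain B where B: "B \<in> sets (Pi\<^sub>M UNIV (\<lambda>_. cemetery_borel))" "\<And>w. w \<in> rc_paths \<Longrightarrow> w \<in> E \<longleftrightarrow> w \<in> B"
    by (rule path_space_trace[OF assms(1)]) (rule that)
  have "A \<subseteq> \<Omega>" using sets.sets_into_space[OF assms(2)] by (simp add: space_F)
  then have "{\<omega>\<in>A. path_shift t (path \<omega>) \<in> E} = {\<omega>\<in>A. path_shift t (path \<omega>) \<in> B}"
    "{\<omega>\<in>\<Omega>. path \<omega> \<in> E} = {\<omega>\<in>\<Omega>. path \<omega> \<in> B}"
    using path_rc path_shift_rc_paths B(2) by blast+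
  then show ?thesis using Markov_product_space(3)[OF B(1) assms(2)] by simp
qed

lemma expected_sojourn:
  assumes D: "open D"
  shows "(\<integral>\<^sup>+\<omega>. ennreal (sojourn D t (path \<omega>)) \<partial>P x) =
    (\<integral>\<^sup>+s\<in>{0..<t}. emeasure (P x) {\<omega>\<in>\<Omega>. X (ennreal s) \<omega> \<in> Some ` D} \<partial>lborel)"
    and "(\<lambda>s. emeasure (P x) {\<omega>\<in>\<Omega>. X (ennreal s) \<omega> \<in> Some ` D}) \<in> borel_measurable borel"
proof -
  interpret prob_space "P x" by (rule prob)
  interpret pair_sigma_finite "P x" lborel ..
  have DB: "Some ` D \<in> sets cemetery_borel" using D by simp
  have "(\<lambda>p. (snd p, path (fst p))) \<in> P x \<Otimes>\<^sub>M lborel \<rightarrow>\<^sub>M borel \<Otimes>\<^sub>M path_space"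
    by (intro measurable_Pair measurable_compose[OF measurable_fst measurable_path]) simp
  from measurable_compose[OF this measurable_path_eval[OF D]]
  have m [measurable]: "Measurable.pred (P x \<Otimes>\<^sub>M lborel) (\<lambda>p. X (ennreal (snd p)) (fst p) \<in> Some ` D)"
    by simp
  have f: "(\<lambda>(\<omega>, s). indicator {p. X (ennreal (snd p)) (fst p) \<in> Some ` D \<and> snd p \<in> {0..<t}} (\<omega>, s) :: ennreal)
      \<in> borel_measurable (P x \<Otimes>\<^sub>M lborel)" by measurable
  have "(\<integral>\<^sup>+\<omega>. ennreal (sojourn D t (path \<omega>)) \<partial>P x) =
     (\<integral>\<^sup>+\<omega>. (\<integral>\<^sup>+s. indicator {p. X (ennreal (snd p)) (fst p) \<in> Some ` D \<and> snd p \<in> {0..<t}} (\<omega>, s) \<partial>lborel) \<partial>P x)"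
  proof (rule nn_integral_cong)
    fix \<omega> assume "\<omega> \<in> space (P x)"
    then have w: "path \<omega> \<in> rc_paths" using path_rc by (simp add: space_P)
    have "ennreal (sojourn D t (path \<omega>)) = emeasure lborel {s\<in>{0..<t}. X (ennreal s) \<omega> \<in> Some ` D}"
      unfolding sojourn_def
      by (rule emeasure_eq_ennreal_measure[symmetric, OF fmeasurableD2[OF sojourn_fmeasurable[OF w D, of 0 t]]])
    also have "\<dots> = (\<integral>\<^sup>+s. indicator {s\<in>{0..<t}. X (ennreal s) \<omega> \<in> Some ` D} s \<partial>lborel)"
      using sojourn_set_measurable[OF w D, of 0 t] by (subst nn_integral_indicator) auto
    also have "\<dots> = (\<integral>\<^sup>+s. indicator {p. X (ennreal (snd p)) (fst p) \<in> Some ` D \<and> snd p \<in> {0..<t}} (\<omega>, s) \<partial>lborel)"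
      by (intro nn_integral_cong) (auto simp: indicator_def)
    finally show "ennreal (sojourn D t (path \<omega>)) = \<dots>" .
  qed
  also have "\<dots> = (\<integral>\<^sup>+s. (\<integral>\<^sup>+\<omega>. indicator {p. X (ennreal (snd p)) (fst p) \<in> Some ` D \<and> snd p \<in> {0..<t}} (\<omega>, s) \<partial>P x) \<partial>lborel)"
    using Fubini'[OF f] by simp
  also have "\<dots> = (\<integral>\<^sup>+s\<in>{0..<t}. emeasure (P x) {\<omega>\<in>\<Omega>. X (ennreal s) \<omega> \<in> Some ` D} \<partial>lborel)"
  proof (rule nn_integral_cong)
    fix s
    have "(\<integral>\<^sup>+\<omega>. indicator {p. X (ennreal (snd p)) (fst p) \<in> Some ` D \<and> snd p \<in> {0..<t}} (\<omega>, s) \<partial>P x) =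
       (\<integral>\<^sup>+\<omega>. indicator {\<omega>\<in>\<Omega>. X (ennreal s) \<omega> \<in> Some ` D} \<omega> * indicator {0..<t} s \<partial>P x)"
      by (intro nn_integral_cong) (auto simp: indicator_def space_P)
    also have "\<dots> = emeasure (P x) {\<omega>\<in>\<Omega>. X (ennreal s) \<omega> \<in> Some ` D} * indicator {0..<t} s"
      using X_set_P[OF DB] by (simp add: nn_integral_multc)
    finally show "(\<integral>\<^sup>+\<omega>. indicator {p. X (ennreal (snd p)) (fst p) \<in> Some ` D \<and> snd p \<in> {0..<t}} (\<omega>, s) \<partial>P x) = \<dots>" .
  qed
  finally show "(\<integral>\<^sup>+\<omega>. ennreal (sojourn D t (path \<omega>)) \<partial>P x) =
    (\<integral>\<^sup>+s\<in>{0..<t}. emeasure (P x) {\<omega>\<in>\<Omega>. X (ennreal s) \<omega> \<in> Some ` D} \<partial>lborel)" .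
  have "(\<lambda>p. (fst p, path (snd p))) \<in> borel \<Otimes>\<^sub>M P x \<rightarrow>\<^sub>M borel \<Otimes>\<^sub>M path_space"
    by (intro measurable_Pair measurable_compose[OF measurable_snd measurable_path]) simp
  from measurable_compose[OF this measurable_path_eval[OF D]]
  have [measurable]: "Measurable.pred (borel \<Otimes>\<^sub>M P x) (\<lambda>p. X (ennreal (fst p)) (snd p) \<in> Some ` D)" by simp
  let ?Q = "{p \<in> space (borel \<Otimes>\<^sub>M P x). X (ennreal (fst p)) (snd p) \<in> Some ` D}"
  have "?Q \<in> sets (borel \<Otimes>\<^sub>M P x)" by measurable
  from sigma_finite_measure.measurable_emeasure_Pair[OF prob_space_imp_sigma_finite[OF prob] this]
  show "(\<lambda>s. emeasure (P x) {\<omega>\<in>\<Omega>. X (ennreal s) \<omega> \<in> Some ` D}) \<in> borel_measurable borel"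
    by (simp add: space_pair_measure space_P vimage_def)
qed

end

section \<open>Scale functions\<close>

lemma has_integral_const_div:
  fixes c :: real assumes "0 < a" "a \<le> b"
  shows "((\<lambda>s. c / s) has_integral c * (ln b - ln a)) {a..b}"
proof -
  have "((\<lambda>s. c / s) has_integral (c * ln b - c * ln a)) {a..b}"
  proof (rule fundamental_theorem_of_calculus[OF assms(2)])
    fix x assume "x \<in> {a..b}"
    then have "x > 0" using assms by simp
    then have "((\<lambda>x. c * ln x) has_real_derivative c / x) (at x within {a..b})"
      by (auto intro!: derivative_eq_intros)
    then show "((\<lambda>x. c * ln x) has_vector_derivative c / x) (at x within {a..b})"
      by (simp add: has_real_derivative_iff_has_vector_derivative)
  qed
  then show ?thesis by (simp add: right_diff_distrib)
qed

lemma lnln_ge_1: "y \<ge> exp (exp 1) \<Longrightarrow> ln (ln y) \<ge> (1::real) \<and> ln y \<ge> exp 1"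
proof -
  assume "y \<ge> exp (exp (1::real))"
  then have "ln y \<ge> exp 1" by (metis exp_gt_zero less_le_trans ln_ge_iff)
  then show ?thesis by (metis exp_gt_zero less_le_trans ln_ge_iff)
qed

locale growth_scale =
  fixes R :: real and \<Phi> \<phi> :: "real \<Rightarrow> real"
  assumes R_ge_1: "R \<ge> 1"
    and \<Phi>_pos: "\<And>s. s > 0 \<Longrightarrow> \<Phi> s > 0"
    and \<Phi>_mono_on: "mono_on {0<..} \<Phi>"
    and \<Phi>_cont: "continuous_on {0<..} \<Phi>"
    and \<Phi>_ULS: "ULS R \<Phi>"
    and \<phi>_integral: "\<And>r. r > 1 \<Longrightarrow> \<phi> r = integral {1..r} (\<lambda>s. \<Phi> s / s)"
begin

lemma \<Phi>_mono: "0 < r \<Longrightarrow> r \<le> s \<Longrightarrow> \<Phi> r \<le> \<Phi> s"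
  using \<Phi>_mono_on by (auto intro: mono_onD)

lemma \<Phi>_ge_large: obtains r0 where "r0 > 0" "\<And>r. r \<ge> r0 \<Longrightarrow> \<Phi> r \<ge> K"
proof -
  obtain l where l: "l > 1" "\<And>s. s > R \<Longrightarrow> 2 * \<Phi> (s / l) \<le> \<Phi> s"
    using \<Phi>_ULS unfolding ULS_def by blast
  define s where "s n = (R + 1) * l ^ n" for n :: nat
  have s_pos: "s n > 0" for n using R_ge_1 l by (simp add: s_def)
  have s_gt: "s n > R" for n
  proof -
    have "(R + 1) * 1 \<le> (R + 1) * l ^ n" using R_ge_1 l by (intro mult_left_mono) auto
    then show ?thesis by (simp add: s_def)
  qed
  have "\<Phi> (s n) \<ge> 2 ^ n * \<Phi> (s 0)" for n
  proof (induction n)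
    case (Suc n)
    have "s (Suc n) / l = s n" using l by (simp add: s_def)
    with l(2)[OF s_gt[of "Suc n"]] Suc show ?case by simp
  qed simp
  moreover obtain n where "K / \<Phi> (s 0) < 2 ^ n" using real_arch_pow[of 2] by auto
  then have "K \<le> 2 ^ n * \<Phi> (s 0)" using \<Phi>_pos[OF s_pos[of 0]] by (simp add: field_simps)
  ultimately have "K \<le> \<Phi> (s n)" by (meson order_trans)
  then show thesis using that[of "s n"] s_pos \<Phi>_mono[OF s_pos] by (meson order_trans)
qed

lemma \<Phi>_doubling:
  assumes "K > 0"
  obtains C where "C > 0" "\<And>r. r > R \<Longrightarrow> \<Phi> (K * r) \<le> C * \<Phi> r"
proof -
  obtain C where C: "C > 0" "\<And>s. s > R \<Longrightarrow> \<Phi> s \<le> C * \<Phi> (s / 2)"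
    using \<Phi>_ULS unfolding ULS_def by blast
  have pow: "\<Phi> (2 ^ n * r) \<le> C ^ n * \<Phi> r" if r: "r > R" for n r
  proof (induction n)
    case (Suc n)
    have "r \<le> 2 ^ Suc n * r" using R_ge_1 r mult_right_mono[of 1 "2 ^ Suc n" r] by (simp del: power_Suc)
    then have "\<Phi> (2 ^ Suc n * r) \<le> C * \<Phi> (2 ^ n * r)" using C(2)[of "2 ^ Suc n * r"] r by simp
    also have "\<dots> \<le> C * (C ^ n * \<Phi> r)" using Suc C by simp
    finally show ?case by simp
  qed simp
  obtain n where n: "max K 1 < 2 ^ n" using real_arch_pow[of 2 "max K 1"] by (metis one_less_numeral_iff semiring_norm(76))
  have "\<Phi> (K * r) \<le> C ^ n * \<Phi> r" if r: "r > R" for r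
  proof -
    have "\<Phi> (K * r) \<le> \<Phi> (2 ^ n * r)"
      using n r R_ge_1 assms by (intro \<Phi>_mono mult_right_mono mult_pos_pos) auto
    then show ?thesis using pow[OF r, of n] by simp
  qed
  then show thesis using that[of "C ^ n"] C by simp
qed

lemma \<Phi>_integrable: "0 < a \<Longrightarrow> (\<lambda>s. \<Phi> s / s) integrable_on {a..b}"
  by (rule integrable_continuous_real)
     (auto intro!: continuous_intros continuous_on_subset[OF \<Phi>_cont])

lemma \<phi>_diff:
  assumes "1 < r" "r \<le> r'"
  shows "\<phi> r' - \<phi> r = integral {r..r'} (\<lambda>s. \<Phi> s / s)"
proof -
  have "integral {1..r} (\<lambda>s. \<Phi> s / s) + integral {r..r'} (\<lambda>s. \<Phi> s / s) = integral {1..r'} (\<lambda>s. \<Phi> s / s)"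
    using assms by (intro Henstock_Kurzweil_Integration.integral_combine \<Phi>_integrable) auto
  then show ?thesis using assms \<phi>_integral[of r] \<phi>_integral[of r'] by simp
qed

lemma \<phi>_diff_bounds:
  assumes "1 < r" "r \<le> r'"
  shows "\<Phi> r * (ln r' - ln r) \<le> \<phi> r' - \<phi> r" "\<phi> r' - \<phi> r \<le> \<Phi> r' * (ln r' - ln r)"
proof -
  have i: "((\<lambda>s. \<Phi> s / s) has_integral (\<phi> r' - \<phi> r)) {r..r'}"
    unfolding \<phi>_diff[OF assms] using assms by (intro integrable_integral \<Phi>_integrable) auto
  have j: "((\<lambda>s. c / s) has_integral c * (ln r' - ln r)) {r..r'}" for c :: real
    using assms by (intro has_integral_const_div) auto
  show "\<Phi> r * (ln r' - ln r) \<le> \<phi> r' - \<phi> r"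
    using assms by (intro has_integral_le[OF j i] divide_right_mono \<Phi>_mono) auto
  show "\<phi> r' - \<phi> r \<le> \<Phi> r' * (ln r' - ln r)"
    using assms by (intro has_integral_le[OF i j] divide_right_mono \<Phi>_mono) auto
qed

lemma \<phi>_strict_mono: "1 < r \<Longrightarrow> r < r' \<Longrightarrow> \<phi> r < \<phi> r'"
proof -
  assume "1 < r" "r < r'"
  then have "0 < \<Phi> r * (ln r' - ln r)" using \<Phi>_pos[of r] by simp
  with \<phi>_diff_bounds(1)[of r r'] \<open>1 < r\<close> \<open>r < r'\<close> show ?thesis by simp
qed

lemma \<phi>_mono: "1 < r \<Longrightarrow> r \<le> r' \<Longrightarrow> \<phi> r \<le> \<phi> r'"
  using \<phi>_strict_mono[of r r'] by (cases "r = r'") auto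

lemma \<phi>_le_imp_le: "1 < r \<Longrightarrow> 1 < r' \<Longrightarrow> \<phi> r \<le> \<phi> r' \<Longrightarrow> r \<le> r'"
  using \<phi>_strict_mono[of r' r] by force

lemma \<phi>_cont: "continuous_on {1<..} \<phi>"
proof -
  have c: "continuous_on {1..b} (\<lambda>r. integral {1..r} (\<lambda>s. \<Phi> s / s))" for b
    by (intro indefinite_integral_continuous_1 \<Phi>_integrable) simp
  have "isCont \<phi> r" if r: "r > 1" for r
  proof -
    have "continuous_on {1<..<r + 1} \<phi>"
      using continuous_on_subset[OF c[of "r + 1"], of "{1<..<r + 1}"]
      by (rule continuous_on_eq) (auto simp: \<phi>_integral)
    then show ?thesis using r by (simp add: continuous_on_eq_continuous_at)
  qed
  then show ?thesis by (intro continuous_at_imp_continuous_on) auto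
qed

lemma \<phi>_at_top: "filterlim \<phi> at_top at_top"
proof (rule filterlim_at_top_mono)
  have "filterlim (\<lambda>r. \<Phi> 2 * ln r) at_top at_top"
    using \<Phi>_pos[of 2] by (intro filterlim_tendsto_pos_mult_at_top[OF tendsto_const _ ln_at_top]) auto
  from filterlim_tendsto_add_at_top[OF tendsto_const this, of "\<phi> 2 - \<Phi> 2 * ln 2"]
  show "filterlim (\<lambda>r. \<Phi> 2 * ln r + (\<phi> 2 - \<Phi> 2 * ln 2)) at_top at_top"
    by (simp add: add.commute)
  show "eventually (\<lambda>r. \<Phi> 2 * ln r + (\<phi> 2 - \<Phi> 2 * ln 2) \<le> \<phi> r) at_top"
    using eventually_ge_at_top[of 2]
    by eventually_elim (use \<phi>_diff_bounds(1)[of 2] in \<open>auto simp: algebra_simps\<close>)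
qed

lemma \<phi>_ge_large: obtains r0 where "r0 > 1" "\<And>r. r \<ge> r0 \<Longrightarrow> \<phi> r \<ge> K"
proof -
  obtain N where N: "\<And>r. r \<ge> N \<Longrightarrow> \<phi> r \<ge> K"
    using \<phi>_at_top unfolding filterlim_at_top eventually_at_top_linorder by blast
  then show thesis using that[of "max 2 N"] by auto
qed

lemma \<phi>_inverse:
  assumes "a > 1" "\<phi> a \<le> y"
  obtains r where "r \<ge> a" "\<phi> r = y"
proof -
  obtain r0 where r0: "r0 > 1" "\<And>r. r \<ge> r0 \<Longrightarrow> \<phi> r \<ge> y" by (rule \<phi>_ge_large[of y]) (rule that)
  have "\<exists>r\<ge>a. r \<le> max a r0 \<and> \<phi> r = y"
    using assms r0 by (intro IVT' continuous_on_subset[OF \<phi>_cont]) auto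
  then show thesis using that by blast
qed

lemma \<Phi>_le_\<phi>:
  obtains C where "C > 0" "\<And>r. r > 2 * R \<Longrightarrow> \<Phi> r \<le> C * \<phi> r"
proof -
  obtain C where C: "C > 0" "\<And>s. s > R \<Longrightarrow> \<Phi> s \<le> C * \<Phi> (s / 2)"
    using \<Phi>_ULS unfolding ULS_def by blast
  have "\<Phi> r \<le> C / ln 2 * \<phi> r" if r: "r > 2 * R" for r
  proof -
    have r2: "r / 2 > 1" "r > R" using r R_ge_1 by auto
    have "\<phi> (r / 2) \<ge> 0"
      unfolding \<phi>_integral[OF r2(1)] by (rule Henstock_Kurzweil_Integration.integral_nonneg[OF \<Phi>_integrable])
        (auto intro!: less_imp_le divide_pos_pos \<Phi>_pos)
    moreover have "\<Phi> (r / 2) * ln 2 \<le> \<phi> r - \<phi> (r / 2)"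
      using \<phi>_diff_bounds(1)[of "r / 2" r] r2 by (simp add: ln_div)
    ultimately have "\<Phi> (r / 2) * ln 2 \<le> \<phi> r" by simp
    then have "C * (\<Phi> (r / 2) * ln 2) \<le> C * \<phi> r" using C by simp
    moreover have "\<Phi> r * ln 2 \<le> C * \<Phi> (r / 2) * ln 2"
      using C(2)[OF r2(2)] by (intro mult_right_mono) auto
    ultimately have "\<Phi> r * ln 2 \<le> C * \<phi> r" unfolding mult.assoc by (rule order_trans[rotated])
    then show ?thesis using ln_gt_zero[of 2] by (simp add: pos_le_divide_eq)
  qed
  then show thesis using that[of "C / ln 2"] C by simp
qed

lemma \<phi>_le_\<Phi>:
  obtains C where "C > 0" "\<And>r. r > R + 2 \<Longrightarrow> \<phi> r \<le> C * \<Phi> r"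
proof -
  obtain l where l: "l > 1" "\<And>s. s > R \<Longrightarrow> 2 * \<Phi> (s / l) \<le> \<Phi> s"
    using \<Phi>_ULS unfolding ULS_def by blast
  define s0 where "s0 = R + 2"
  have s0: "s0 > 1" "s0 > R" using R_ge_1 by (auto simp: s0_def)
  have lnl: "ln l > 0" using l by simp
  have *: "\<phi> r \<le> \<phi> s0 + 2 * ln l * \<Phi> r" if "s0 \<le> r" "r \<le> s0 * l ^ Suc n" for n r
    using that
  proof (induction n arbitrary: r)
    case 0
    then have "\<phi> r \<le> \<phi> s0 + \<Phi> r * (ln r - ln s0)" using \<phi>_diff_bounds(2)[of s0 r] s0 by simp
    moreover have "ln r \<le> ln (s0 * l)" using 0 s0 by (intro ln_mono) auto
    then have "ln r - ln s0 \<le> ln l" using s0 l by (simp add: ln_mult)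
    then have "\<Phi> r * (ln r - ln s0) \<le> \<Phi> r * (2 * ln l)"
      using \<Phi>_pos[of r] 0 s0 lnl by (intro mult_left_mono) auto
    ultimately show ?case by (simp add: mult.commute)
  next
    case (Suc n)
    show ?case
    proof (cases "r \<le> s0 * l ^ Suc n")
      case True then show ?thesis using Suc by blast
    next
      case False
      have "1 \<le> l ^ n" using l by (simp add: one_le_power)
      then have "s0 * l * 1 \<le> s0 * l * l ^ n" using s0 l by (intro mult_left_mono) auto
      then have rl: "s0 * l \<le> r" using False by (simp add: mult.assoc)
      then have a: "s0 \<le> r / l" using l by (simp add: pos_le_divide_eq)
      have b: "r / l \<le> s0 * l ^ Suc n" using Suc.prems l by (simp add: pos_divide_le_eq mult_ac)
      have c: "r / l \<le> r" using l Suc.prems s0 by (simp add: pos_divide_le_eq mult_le_cancel_left1)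
      have "\<phi> r \<le> \<phi> (r / l) + \<Phi> r * (ln r - ln (r / l))"
        using \<phi>_diff_bounds(2)[of "r / l" r] a c s0 by simp
      also have "ln r - ln (r / l) = ln l" using Suc.prems s0 l by (simp add: ln_div)
      also have "\<phi> (r / l) \<le> \<phi> s0 + 2 * ln l * \<Phi> (r / l)" by (rule Suc.IH[OF a b])
      also have "2 * ln l * \<Phi> (r / l) = ln l * (2 * \<Phi> (r / l))" by simp
      also have "\<dots> \<le> ln l * \<Phi> r" using l(2)[of r] Suc.prems s0 lnl by (intro mult_left_mono) auto
      finally show ?thesis by (simp add: algebra_simps)
    qed
  qed
  have pos: "\<Phi> s0 > 0" using s0 by (intro \<Phi>_pos) simp
  define C where "C = \<bar>\<phi> s0\<bar> / \<Phi> s0 + 2 * ln l"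
  have "\<phi> r \<le> C * \<Phi> r" if r: "r > R + 2" for r
  proof -
    obtain n where "r / s0 < l ^ n" using real_arch_pow[OF l(1)] by blast
    then have "r < s0 * l ^ n" using s0 by (simp add: pos_divide_less_eq mult.commute)
    also have "\<dots> \<le> s0 * l ^ Suc n" using s0 l by (intro mult_left_mono power_increasing) auto
    finally have "r \<le> s0 * l ^ Suc n" by (rule less_imp_le)
    moreover have "s0 \<le> r" using r by (simp add: s0_def)
    ultimately have "\<phi> r \<le> \<phi> s0 + 2 * ln l * \<Phi> r" by (intro *)
    moreover have "\<phi> s0 \<le> \<bar>\<phi> s0\<bar> / \<Phi> s0 * \<Phi> r"
    proof -
      have "\<phi> s0 \<le> \<bar>\<phi> s0\<bar> / \<Phi> s0 * \<Phi> s0" using pos by simp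
      also have "\<dots> \<le> \<bar>\<phi> s0\<bar> / \<Phi> s0 * \<Phi> r"
        using pos r s0 by (intro mult_left_mono \<Phi>_mono) (auto simp: s0_def)
      finally show ?thesis .
    qed
    ultimately show ?thesis by (simp add: C_def algebra_simps)
  qed
  moreover have "C > 0" using pos lnl by (simp add: C_def add_nonneg_pos)
  ultimately show thesis using that by blast
qed

definition tscale :: "real \<Rightarrow> real" where
  "tscale r = \<phi> r * ln (ln (\<phi> r))"

definition r_init :: real where
  "r_init = (SOME a. a > 2 \<and> (\<forall>r\<ge>a. \<phi> r \<ge> exp (exp 1)))"

lemma r_init: "r_init > 2" "r \<ge> r_init \<Longrightarrow> \<phi> r \<ge> exp (exp 1)"
proof -
  obtain r0 where "r0 > 1" "\<And>r. r \<ge> r0 \<Longrightarrow> \<phi> r \<ge> exp (exp 1)" by (rule \<phi>_ge_large[of "exp (exp 1)"]) (rule that)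
  then have "r0 + 2 > 2 \<and> (\<forall>r\<ge>r0 + 2. \<phi> r \<ge> exp (exp 1))" by auto
  then have "r_init > 2 \<and> (\<forall>r\<ge>r_init. \<phi> r \<ge> exp (exp 1))" unfolding r_init_def by (rule someI)
  then show "r_init > 2" "r \<ge> r_init \<Longrightarrow> \<phi> r \<ge> exp (exp 1)" by auto
qed

lemma \<phi>_pos: "r \<ge> r_init \<Longrightarrow> \<phi> r > 0"
  using r_init(2)[of r] by (meson exp_gt_zero less_le_trans)

lemma tscale_ge_\<phi>: "r \<ge> r_init \<Longrightarrow> \<phi> r \<le> tscale r"
  using lnln_ge_1[OF r_init(2), of r] \<phi>_pos[of r] by (simp add: tscale_def mult_le_cancel_left1)

lemma tscale_pos: "r \<ge> r_init \<Longrightarrow> tscale r > 0"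
  using tscale_ge_\<phi> \<phi>_pos by (meson less_le_trans)

lemma tscale_mono: "r_init \<le> r \<Longrightarrow> r \<le> r' \<Longrightarrow> tscale r \<le> tscale r'"
proof -
  assume r: "r_init \<le> r" "r \<le> r'"
  then have p: "\<phi> r \<le> \<phi> r'" using r_init(1) by (intro \<phi>_mono) auto
  have "ln (\<phi> r) \<le> ln (\<phi> r')" using p \<phi>_pos[OF r(1)] by (intro ln_mono) auto
  moreover have "ln (\<phi> r) > 0"
    using lnln_ge_1[OF r_init(2)[OF r(1)]] exp_gt_zero[of "1::real"] by linarith
  ultimately have "ln (ln (\<phi> r)) \<le> ln (ln (\<phi> r'))" by (intro ln_mono[of "ln _"]) auto
  then show ?thesis unfolding tscale_def
    using p \<phi>_pos[of r'] lnln_ge_1[OF r_init(2)[OF r(1)]] r by (intro mult_mono) (auto intro: less_imp_le)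
qed

lemma tscale_cont: "continuous_on {r_init..} tscale"
proof -
  have "\<phi> r > 0 \<and> ln (\<phi> r) > 0" if "r \<ge> r_init" for r
    using \<phi>_pos[OF that] lnln_ge_1[OF r_init(2)[OF that]] exp_gt_zero[of "1::real"] by linarith
  then show ?thesis
    unfolding tscale_def using r_init(1)
    by (intro continuous_intros continuous_on_subset[OF \<phi>_cont]) force+
qed

lemma tscale_at_top: "filterlim tscale at_top at_top"
  using eventually_mono[OF eventually_ge_at_top tscale_ge_\<phi>] by (rule filterlim_at_top_mono[OF \<phi>_at_top])

lemma tscale_inverse:
  assumes "a \<ge> r_init" "tscale a \<le> y"
  obtains r where "r \<ge> a" "tscale r = y"
proof -
  obtain N where N: "\<And>r. r \<ge> N \<Longrightarrow> tscale r \<ge> y"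
    using tscale_at_top unfolding filterlim_at_top eventually_at_top_linorder by blast
  have "\<exists>r\<ge>a. r \<le> max a N \<and> tscale r = y"
    using assms N by (intro IVT' continuous_on_subset[OF tscale_cont]) auto
  then show thesis using that by blast
qed

lemma tscale_shift_le:
  assumes "d \<ge> 0" "\<epsilon> > 0"
  shows "eventually (\<lambda>r. tscale (r + d) \<le> (1 + \<epsilon>) * tscale r) at_top"
proof -
  obtain C where C: "C > 0" "\<And>r. r > 2 * R \<Longrightarrow> \<Phi> r \<le> C * \<phi> r" by (rule \<Phi>_le_\<phi>) (rule that)
  obtain K where K: "K > 0" "\<And>r. r > R \<Longrightarrow> \<Phi> (2 * r) \<le> K * \<Phi> r" by (rule \<Phi>_doubling[of 2]) (simp, rule that)
  define \<delta> where "\<delta> = min 1 (\<epsilon> / 3)"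
  have \<delta>: "0 < \<delta>" "\<delta> \<le> 1" "(1 + \<delta>) * (1 + \<delta>) \<le> 1 + \<epsilon>"
  proof -
    have "\<delta> * \<delta> \<le> \<delta> * 1" using assms by (intro mult_left_mono) (auto simp: \<delta>_def)
    then have "(1 + \<delta>) * (1 + \<delta>) \<le> 1 + 3 * \<delta>" by (simp add: algebra_simps)
    also have "\<dots> \<le> 1 + \<epsilon>" by (simp add: \<delta>_def)
    finally show "(1 + \<delta>) * (1 + \<delta>) \<le> 1 + \<epsilon>" .
  qed (use assms in \<open>auto simp: \<delta>_def\<close>)
  obtain r1 where r1: "r1 > 1" "\<And>r. r \<ge> r1 \<Longrightarrow> \<phi> r \<ge> exp (ln 2 / \<delta>)"
    by (rule \<phi>_ge_large[of "exp (ln 2 / \<delta>)"]) (rule that)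
  have "tscale (r + d) \<le> (1 + \<epsilon>) * tscale r"
    if r: "r \<ge> r_init" "r > 2 * R" "r \<ge> d" "r \<ge> r1" "r \<ge> K * C * d / \<delta>" for r
  proof -
    have rpos: "r > 1" using r R_ge_1 by simp
    have ln_le: "ln (r + d) - ln r \<le> d / r"
    proof -
      have "ln (r + d) - ln r = ln (1 + d / r)"
      proof -
        have "r + d = r * (1 + d / r)" using rpos by (simp add: field_simps)
        moreover have "ln (r * (1 + d / r)) = ln r + ln (1 + d / r)"
          using rpos assms by (intro ln_mult_pos add_pos_nonneg) auto
        ultimately show ?thesis by simp
      qed
      also have "\<dots> \<le> d / r" using rpos assms by (intro ln_add_one_self_le_self) auto
      finally show ?thesis .
    qed
    have "\<phi> (r + d) \<le> \<phi> r + \<Phi> (r + d) * (ln (r + d) - ln r)"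
      using \<phi>_diff_bounds(2)[of r "r + d"] rpos assms by simp
    also have "\<Phi> (r + d) * (ln (r + d) - ln r) \<le> (K * (C * \<phi> r)) * (d / r)"
    proof (rule mult_mono[OF _ ln_le])
      have "\<Phi> (r + d) \<le> \<Phi> (2 * r)" using r rpos assms by (intro \<Phi>_mono) auto
      also have "\<dots> \<le> K * \<Phi> r" using K(2)[of r] r R_ge_1 by simp
      also have "\<dots> \<le> K * (C * \<phi> r)" using C(2)[OF r(2)] K by (intro mult_left_mono) auto
      finally show "\<Phi> (r + d) \<le> K * (C * \<phi> r)" .
      show "0 \<le> ln (r + d) - ln r" using rpos assms by simp
      show "0 \<le> K * (C * \<phi> r)" using K C \<phi>_pos[OF r(1)] by (intro mult_nonneg_nonneg) auto
    qed
    also have "\<dots> = \<phi> r * (K * C * d / r)" by simp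
    also have "\<dots> \<le> \<phi> r * \<delta>"
      using r(5) rpos \<delta> \<phi>_pos[OF r(1)] by (intro mult_left_mono) (auto simp: field_simps)
    finally have p: "\<phi> (r + d) \<le> (1 + \<delta>) * \<phi> r" by (simp add: algebra_simps)
    have e: "\<phi> r > 0" "ln (\<phi> r) \<ge> exp 1" "ln (ln (\<phi> r)) \<ge> 1"
      using \<phi>_pos lnln_ge_1 r_init(2) r by blast+
    have lpos: "ln (\<phi> r) > 0" using e(2) exp_gt_zero[of "1::real"] by linarith
    have "(1 + \<delta>) * \<phi> r \<le> 2 * \<phi> r" using \<delta>(2) e(1) by (intro mult_right_mono) auto
    with p have "\<phi> (r + d) \<le> 2 * \<phi> r" by linarith
    moreover have "\<phi> (r + d) > 0" using \<phi>_pos[of "r + d"] r assms by simp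
    ultimately have "ln (\<phi> (r + d)) \<le> ln (2 * \<phi> r)" by (intro ln_mono) auto
    also have "\<dots> = ln (\<phi> r) * (1 + ln 2 / ln (\<phi> r))" using e lpos by (simp add: ln_mult field_simps)
    finally have "ln (ln (\<phi> (r + d))) \<le> ln (ln (\<phi> r) * (1 + ln 2 / ln (\<phi> r)))"
    proof (rule ln_mono)
      have "ln (\<phi> (r + d)) \<ge> exp 1" using lnln_ge_1[OF r_init(2)[of "r + d"]] r assms by simp
      then show "0 < ln (\<phi> (r + d))" using exp_gt_zero[of "1::real"] by linarith
    qed
    also have "\<dots> = ln (ln (\<phi> r)) + ln (1 + ln 2 / ln (\<phi> r))"
      using lpos by (intro ln_mult_pos) (auto intro: add_pos_nonneg)
    also have "ln (1 + ln 2 / ln (\<phi> r)) \<le> ln 2 / ln (\<phi> r)"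
      using lpos by (intro ln_add_one_self_le_self) auto
    also have "\<dots> \<le> \<delta>"
    proof -
      have "ln (exp (ln 2 / \<delta>)) \<le> ln (\<phi> r)" using r1(2)[OF r(4)] by (intro ln_mono) auto
      then show ?thesis using lpos \<delta> by (simp add: field_simps)
    qed
    finally have "ln (ln (\<phi> (r + d))) \<le> ln (ln (\<phi> r)) + \<delta>" by simp
    moreover have "\<delta> * 1 \<le> \<delta> * ln (ln (\<phi> r))" using e(3) \<delta>(1) by (intro mult_left_mono) auto
    ultimately have q: "ln (ln (\<phi> (r + d))) \<le> (1 + \<delta>) * ln (ln (\<phi> r))"
      unfolding distrib_right by linarith
    have "tscale (r + d) \<le> ((1 + \<delta>) * \<phi> r) * ((1 + \<delta>) * ln (ln (\<phi> r)))"
      unfolding tscale_def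
    proof (rule mult_mono[OF p q])
      show "0 \<le> (1 + \<delta>) * \<phi> r" using e \<delta> by simp
      have "1 \<le> ln (ln (\<phi> (r + d)))" using lnln_ge_1[OF r_init(2)[of "r + d"]] r assms by simp
      then show "0 \<le> ln (ln (\<phi> (r + d)))" by simp
    qed
    also have "\<dots> = ((1 + \<delta>) * (1 + \<delta>)) * tscale r" by (simp add: tscale_def)
    also have "\<dots> \<le> (1 + \<epsilon>) * tscale r"
      using \<delta>(3) tscale_pos[OF r(1)] by (intro mult_right_mono) auto
    finally show ?thesis .
  qed
  then have "tscale (r + d) \<le> (1 + \<epsilon>) * tscale r"
    if "r \<ge> Max {r_init, 2 * R + 1, d, r1, K * C * d / \<delta>}" for r using that by auto
  then show ?thesis unfolding eventually_at_top_linorder by blast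
qed

end

section \<open>Near-diagonal lower bound\<close>

definition stay :: "'a set \<Rightarrow> real \<Rightarrow> (ennreal \<Rightarrow> 'a::metric_space option) set" where
  "stay C t = {w \<in> rc_paths. \<forall>s. 0 \<le> s \<and> s < t \<longrightarrow> w (ennreal s) \<in> Some ` C}"

lemma rc_path_in_closed:
  assumes w: "w \<in> rc_paths" and C: "closed (C :: 'a::metric_space set)" and "0 \<le> s" "s < t"
    and q: "\<And>q. q \<in> \<rat> \<Longrightarrow> s < q \<Longrightarrow> q < t \<Longrightarrow> w (ennreal q) \<in> Some ` C"
  shows "w (ennreal s) \<in> Some ` C"
proof (rule ccontr)
  assume no: "w (ennreal s) \<notin> Some ` C"
  have "\<exists>u>s. u \<le> t \<and> (\<forall>v. s < v \<longrightarrow> v < u \<longrightarrow> w (ennreal v) \<notin> Some ` C)"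
  proof (cases "w (ennreal s)")
    case None
    then have "w (ennreal v) = None" if "s < v" for v
      using rc_paths_NoneD[OF w None] that by (simp add: ennreal_leI)
    then show ?thesis using assms(4) by (intro exI[of _ t]) auto
  next
    case (Some y)
    then have "y \<in> - C" "open (- C)" using no C by auto
    then obtain u where u: "u > ennreal s" "\<And>v. ennreal s \<le> v \<Longrightarrow> v < u \<Longrightarrow> w v \<in> Some ` (- C)"
      using rc_paths_rightD[OF w Some, of "- C"] by auto
    have "ennreal (min t (if u = top then t else enn2real u)) \<le> u"
    proof (cases "u = top")
      case False
      then have "ennreal (enn2real u) = u" by (simp add: less_top)
      moreover have "ennreal (min t (enn2real u)) \<le> ennreal (enn2real u)" by (intro ennreal_leI) simp
      ultimately show ?thesis using False by simp
    qed simp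
    moreover have "s < (if u = top then t else enn2real u)"
    proof (cases "u = top")
      case False
      then have "ennreal (enn2real u) = u" by (simp add: less_top)
      then have "ennreal s < ennreal (enn2real u)" using u by simp
      then show ?thesis using False assms(3) by (simp add: ennreal_less_iff)
    qed (use assms in simp)
    ultimately obtain u' where u': "s < u'" "u' \<le> t" "ennreal u' \<le> u"
      using assms(4) by (metis min.cobounded1 min_less_iff_conj)
    have "w (ennreal v) \<notin> Some ` C" if "s < v" "v < u'" for v
    proof -
      have "ennreal v < ennreal u'" using that assms(3) by (simp add: ennreal_less_iff)
      then have "w (ennreal v) \<in> Some ` (- C)"
        using u(2)[of "ennreal v"] u'(3) that by (simp add: ennreal_leI)
      then show ?thesis by auto
    qed
    then show ?thesis using u' by blast
  qed
  then obtain u where u: "s < u" "u \<le> t" "\<And>v. s < v \<Longrightarrow> v < u \<Longrightarrow> w (ennreal v) \<notin> Some ` C" by blast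
  obtain q where "q \<in> \<rat>" "s < q" "q < u" using Rats_dense_in_real[OF u(1)] by blast
  then show False using u(2) u(3)[of q] q[of q] by simp
qed

lemma stay_sets:
  assumes C: "closed (C :: 'a::metric_space set)"
  shows "stay C t \<in> sets path_space"
proof -
  have eq: "stay C t = {w \<in> space path_space. \<forall>q\<in>{q\<in>\<rat>. 0 \<le> q \<and> q < t}. w (ennreal q) \<in> Some ` C}"
  proof (intro equalityI subsetI)
    fix w assume *: "w \<in> {w \<in> space path_space. \<forall>q\<in>{q\<in>\<rat>. 0 \<le> q \<and> q < t}. w (ennreal q) \<in> Some ` C}"
    then have w: "w \<in> rc_paths" by (simp add: space_path_space)
    have "w (ennreal s) \<in> Some ` C" if "0 \<le> s" "s < t" for s
      by (rule rc_path_in_closed[OF w C that]) (use * that in auto)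
    then show "w \<in> stay C t" using w by (simp add: stay_def)
  qed (auto simp: stay_def space_path_space)
  have "Measurable.pred path_space (\<lambda>w. w (ennreal q) \<in> Some ` C)" for q
    by (rule pred_sets2[OF Some_image_cemetery measurable_coordinate]) (use C in auto)
  then have "Measurable.pred path_space (\<lambda>w. \<forall>q\<in>{q\<in>\<rat>. 0 \<le> q \<and> q < t}. w (ennreal q) \<in> Some ` C)"
    by (intro measurable_pred_countable countable_subset[OF _ countable_rat]) auto
  then show ?thesis unfolding eq pred_def .
qed

locale occupation_setting = borel_standard_process \<Omega> F X P + growth_scale R \<Phi> \<phi>
  for \<Omega> :: "'w set" and F :: "ennreal \<Rightarrow> 'w measure"
    and X :: "ennreal \<Rightarrow> 'w \<Rightarrow> 'a::lc_separable_metric_space option"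
    and P :: "'a option \<Rightarrow> 'w measure" and R :: real and \<Phi> \<phi> :: "real \<Rightarrow> real" +
  fixes b :: 'a and \<mu> :: "'a measure" and J :: "'a \<Rightarrow> 'a option measure" and \<upsilon> \<eta> c :: real
  assumes sets_\<mu>: "sets \<mu> = sets borel"
    and levy: "has_levy_system P X J"
    and vrd: "VRD b \<mu> R \<upsilon>"
    and tail: "Tail_upper b J R \<Phi> \<upsilon>"
    and \<eta>: "0 < \<eta>" "\<eta> < 1" and c_pos: "0 < c"
    and ndl: "\<And>r. r > R \<Longrightarrow> \<exists>p. heat_kernel \<mu> P X (ball b r) p \<and>
        (\<forall>y\<in>ball b (\<eta>\<^sup>2 * r). \<forall>z\<in>ball b (\<eta>\<^sup>2 * r). p (\<Phi> (\<eta> * r)) y z \<ge> ennreal c / vol \<mu> b r)"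
begin

definition v :: "real \<Rightarrow> real" where
  "v r = measure \<mu> (ball b r)"

lemma VRD_center:
  obtains d1 d2 c1 C1 where "d1 > 0" "d2 > 0" "c1 > 0" "C1 > 0"
    "\<And>r s. r \<ge> s \<Longrightarrow> s > R \<Longrightarrow> ennreal (c1 * (r / s) powr d1) \<le> vol \<mu> b r / vol \<mu> b s"
    "\<And>r s. r \<ge> s \<Longrightarrow> s > R \<Longrightarrow> vol \<mu> b r / vol \<mu> b s \<le> ennreal (C1 * (r / s) powr d2)"
proof -
  obtain d1 d2 c1 C1 where V: "d1 > 0" "d2 > 0" "c1 > 0" "C1 > 0"
    and vr: "\<And>x r s. r \<ge> s \<and> s > R * dfun b x powr \<upsilon> \<Longrightarrow>
      ennreal (c1 * (r / s) powr d1) \<le> vol \<mu> x r / vol \<mu> x s \<and>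
      vol \<mu> x r / vol \<mu> x s \<le> ennreal (C1 * (r / s) powr d2)"
    using vrd unfolding VRD_def by blast
  have d: "R * dfun b b powr \<upsilon> = R" by (simp add: dfun_def)
  show thesis by (rule that[OF V]) (use vr[where x = b, unfolded d] in blast)+
qed

lemma vol_center: assumes "r > R" shows "vol \<mu> b r = ennreal (v r)" "v r > 0"
proof -
  obtain d1 d2 c1 C1 where V: "d1 > 0" "d2 > 0" "c1 > 0" "C1 > 0"
    "\<And>r s. r \<ge> s \<Longrightarrow> s > R \<Longrightarrow> ennreal (c1 * (r / s) powr d1) \<le> vol \<mu> b r / vol \<mu> b s"
    "\<And>r s. r \<ge> s \<Longrightarrow> s > R \<Longrightarrow> vol \<mu> b r / vol \<mu> b s \<le> ennreal (C1 * (r / s) powr d2)"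
    by (rule VRD_center) (rule that)
  have "ennreal c1 \<le> vol \<mu> b r / vol \<mu> b r" using V(5)[of r r] assms R_ge_1 by simp
  moreover have "ennreal c1 > 0" using V by simp
  ultimately have *: "vol \<mu> b r / vol \<mu> b r \<noteq> 0" by auto
  have nz: "vol \<mu> b r \<noteq> 0" using * by auto
  have fin: "vol \<mu> b r \<noteq> top" using * by (auto simp: divide_ennreal_def)
  show "vol \<mu> b r = ennreal (v r)" "v r > 0"
  proof -
    show eq: "vol \<mu> b r = ennreal (v r)"
      using fin unfolding vol_def v_def by (rule emeasure_eq_ennreal_measure)
    show "v r > 0" using nz unfolding eq by (metis ennreal_eq_0_iff not_le)
  qed
qed

lemma v_doubling:
  assumes "0 < \<delta>" "\<delta> \<le> 1"
  obtains K where "K > 0" "\<And>r. \<delta> * r > R \<Longrightarrow> v r \<le> K * v (\<delta> * r)"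
proof -
  obtain d1 d2 c1 C1 where V: "d1 > 0" "d2 > 0" "c1 > 0" "C1 > 0"
    "\<And>r s. r \<ge> s \<Longrightarrow> s > R \<Longrightarrow> ennreal (c1 * (r / s) powr d1) \<le> vol \<mu> b r / vol \<mu> b s"
    "\<And>r s. r \<ge> s \<Longrightarrow> s > R \<Longrightarrow> vol \<mu> b r / vol \<mu> b s \<le> ennreal (C1 * (r / s) powr d2)"
    by (rule VRD_center) (rule that)
  have "v r \<le> (C1 * (1 / \<delta>) powr d2) * v (\<delta> * r)" if r: "\<delta> * r > R" for r
  proof -
    have r0: "r > 0" using r R_ge_1 assms by (smt (verit) zero_less_mult_pos)
    have le: "\<delta> * r \<le> r" using assms r0 by (simp add: mult_le_cancel_right1)
    have "vol \<mu> b r / vol \<mu> b (\<delta> * r) \<le> ennreal (C1 * (r / (\<delta> * r)) powr d2)"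
      by (rule V(6)[OF le r])
    moreover have "vol \<mu> b r / vol \<mu> b (\<delta> * r) = ennreal (v r / v (\<delta> * r))"
      using r le vol_center[of r] vol_center[of "\<delta> * r"] by (simp add: divide_ennreal)
    moreover have "r / (\<delta> * r) = 1 / \<delta>" using r0 by simp
    ultimately have "v r / v (\<delta> * r) \<le> C1 * (1 / \<delta>) powr d2"
      using V by (simp add: ennreal_le_iff)
    then show ?thesis using vol_center(2)[OF r] by (simp add: pos_divide_le_eq)
  qed
  then show thesis using that[of "C1 * (1 / \<delta>) powr d2"] V assms by simp
qed

lemma v_reverse_doubling:
  obtains \<delta> where "0 < \<delta>" "\<delta> < 1" "\<And>r. \<delta> * r > R \<Longrightarrow> 2 * v (\<delta> * r) \<le> v r"
proof -
  obtain d1 d2 c1 C1 where V: "d1 > 0" "d2 > 0" "c1 > 0" "C1 > 0"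
    "\<And>r s. r \<ge> s \<Longrightarrow> s > R \<Longrightarrow> ennreal (c1 * (r / s) powr d1) \<le> vol \<mu> b r / vol \<mu> b s"
    "\<And>r s. r \<ge> s \<Longrightarrow> s > R \<Longrightarrow> vol \<mu> b r / vol \<mu> b s \<le> ennreal (C1 * (r / s) powr d2)"
    by (rule VRD_center) (rule that)
  define K where "K = max 2 ((2 / c1) powr (1 / d1))"
  define \<delta> where "\<delta> = 1 / K"
  have \<delta>: "0 < \<delta>" "\<delta> < 1" by (auto simp: \<delta>_def K_def)
  have "2 / c1 = ((2 / c1) powr (1 / d1)) powr d1" using V by (simp add: powr_powr)
  also have "\<dots> \<le> K powr d1" using V by (intro powr_mono2) (auto simp: K_def)
  finally have K: "2 \<le> c1 * K powr d1" using V by (simp add: pos_divide_le_eq mult.commute)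
  have "2 * v (\<delta> * r) \<le> v r" if r: "\<delta> * r > R" for r
  proof -
    have r0: "r > 0" using r R_ge_1 \<delta> by (smt (verit) zero_less_mult_pos)
    have le: "\<delta> * r \<le> r" using \<delta> r0 by (simp add: mult_le_cancel_right1)
    have "r / (\<delta> * r) = K" using r0 by (simp add: \<delta>_def)
    then have "ennreal (c1 * K powr d1) \<le> vol \<mu> b r / vol \<mu> b (\<delta> * r)"
      using V(5)[OF le r] by simp
    also have "\<dots> = ennreal (v r / v (\<delta> * r))"
      using r le vol_center[of r] vol_center[of "\<delta> * r"] by (simp add: divide_ennreal)
    finally have "c1 * K powr d1 \<le> v r / v (\<delta> * r)"
      using vol_center(2)[OF r] by (subst (asm) ennreal_le_iff) (auto simp: v_def)
    with K have "2 \<le> v r / v (\<delta> * r)" by linarith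
    then show ?thesis using vol_center(2)[OF r] by (simp add: pos_le_divide_eq)
  qed
  then show thesis using that \<delta> by blast
qed

lemma ndl_event:
  assumes r: "r > R" and y: "y \<in> ball b (\<eta>\<^sup>2 * r)" and A: "A \<in> sets borel" "A \<subseteq> ball b (\<eta>\<^sup>2 * r)"
  obtains E where "E \<in> sets (P (Some y))" "ennreal (c * measure \<mu> A / v r) \<le> emeasure (P (Some y)) E"
    "\<And>\<omega>. \<omega> \<in> E \<Longrightarrow> \<omega> \<in> \<Omega> \<and> ennreal (\<Phi> (\<eta> * r)) < exit_time X (ball b r) \<omega> \<and>
        X (ennreal (\<Phi> (\<eta> * r))) \<omega> \<in> Some ` A"
proof -
  define t where "t = \<Phi> (\<eta> * r)"
  define D where "D = ball b r"
  have r0: "r > 0" using r R_ge_1 by simp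
  have t: "t > 0" unfolding t_def using \<eta> r0 by (intro \<Phi>_pos) simp
  have "\<eta>\<^sup>2 \<le> 1" using \<eta> by (simp add: power_le_one)
  then have sub: "ball b (\<eta>\<^sup>2 * r) \<subseteq> D" unfolding D_def using r0 by (intro subset_ball) (simp add: mult_le_cancel_right1)
  have D: "D \<in> sets borel" "space \<mu> = UNIV" using sets_eq_imp_space_eq[OF sets_\<mu>] by (auto simp: D_def)
  obtain p where hk: "heat_kernel \<mu> P X D p"
    and lb: "\<And>z. z \<in> ball b (\<eta>\<^sup>2 * r) \<Longrightarrow> p t y z \<ge> ennreal c / vol \<mu> b r"
    using ndl[OF r] y unfolding t_def D_def by blast
  define f where "f = (indicator A :: 'a \<Rightarrow> real)"
  define N where "N = density (restrict_space \<mu> D) (p t y)"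
  define g where "g \<omega> = extend0 f (part_process X D (ennreal t) \<omega>)" for \<omega>
  define I where "I = (\<integral>\<omega>. g \<omega> \<partial>P (Some y))"
  have yD: "y \<in> D" using y sub by blast
  have f_meas: "f \<in> borel_measurable (restrict_space \<mu> D)"
    unfolding f_def using A by (intro measurable_restrict_space1 borel_measurable_indicator) (simp add: sets_\<mu>)
  have "f \<in> L_infinity (restrict_space \<mu> D)"
    unfolding L_infinity_def using f_meas by (auto simp: f_def intro!: exI[of _ 1])
  then have hb: "has_bochner_integral N f I"
    using hk t yD unfolding heat_kernel_def N_def I_def g_def by blast
  have p_meas: "p t y \<in> borel_measurable (restrict_space \<mu> D)"
  proof -
    have 1: "(\<lambda>(t, x, y). p t x y) \<in> borel_measurable (restrict_space borel ({0<..} \<times> D \<times> D))"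
      using hk unfolding heat_kernel_def by blast
    have 2: "(\<lambda>z. (t, y, z)) \<in> restrict_space \<mu> D \<rightarrow>\<^sub>M restrict_space borel ({0<..} \<times> D \<times> D)"
    proof (rule measurable_restrict_space2)
      have "(\<lambda>z. (t, y, z)) \<in> borel \<rightarrow>\<^sub>M borel"
        by (intro borel_measurable_continuous_onI continuous_intros)
      then have "(\<lambda>z. (t, y, z)) \<in> \<mu> \<rightarrow>\<^sub>M borel" by (subst measurable_cong_sets[OF sets_\<mu> refl])
      then show "(\<lambda>z. (t, y, z)) \<in> restrict_space \<mu> D \<rightarrow>\<^sub>M borel" by (rule measurable_restrict_space1)
      show "(\<lambda>z. (t, y, z)) \<in> space (restrict_space \<mu> D) \<rightarrow> {0<..} \<times> D \<times> D"
        using t yD by (auto simp: space_restrict_space)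
    qed
    show ?thesis using measurable_compose[OF 2 1] by simp
  qed
  have AD: "A \<subseteq> D" using A sub by blast
  have AN: "A \<in> sets (restrict_space \<mu> D)"
    using A AD D by (auto simp: sets_restrict_space_iff sets_\<mu>)
  have I_eq: "I = measure N A"
  proof -
    have "integral\<^sup>L N f = I" using hb by (rule has_bochner_integral_integral_eq)
    moreover have "integral\<^sup>L N f = measure N (A \<inter> space N)" unfolding f_def by simp
    moreover have "A \<inter> space N = A" using AD by (auto simp: N_def space_restrict_space D(2))
    ultimately show ?thesis by simp
  qed
  have fin: "emeasure N A < \<infinity>"
    using integrable.intros[OF hb, unfolded f_def] AN
    by (subst (asm) integrable_indicator_iff) (auto simp: N_def space_restrict_space D(2) Int_absorb2[OF AD])
  have "(ennreal c / vol \<mu> b r) * emeasure \<mu> A = (\<integral>\<^sup>+z. (ennreal c / vol \<mu> b r) * indicator A z \<partial>restrict_space \<mu> D)"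
    using AN AD D by (subst nn_integral_cmult_indicator) (auto simp: emeasure_restrict_space sets_\<mu>)
  also have "\<dots> \<le> (\<integral>\<^sup>+z. p t y z * indicator A z \<partial>restrict_space \<mu> D)"
    using lb A by (intro nn_integral_mono) (auto simp: indicator_def)
  also have "\<dots> = emeasure N A" unfolding N_def using p_meas AN by (simp add: emeasure_density)
  finally have "(ennreal c / vol \<mu> b r) * emeasure \<mu> A \<le> ennreal I"
    using fin by (simp add: I_eq emeasure_eq_ennreal_measure)
  moreover have "emeasure \<mu> A = ennreal (measure \<mu> A)"
  proof -
    have "emeasure \<mu> A \<le> vol \<mu> b r" unfolding vol_def using AD by (intro emeasure_mono) (auto simp: D_def sets_\<mu>)
    then have "emeasure \<mu> A \<noteq> top" using vol_center(1)[OF r] by (auto simp: top_unique)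
    then show ?thesis by (rule emeasure_eq_ennreal_measure)
  qed
  moreover have "ennreal (c / v r * measure \<mu> A) = (ennreal c / vol \<mu> b r) * ennreal (measure \<mu> A)"
    using vol_center[OF r] c_pos by (simp add: divide_ennreal flip: ennreal_mult)
  ultimately have "ennreal (c / v r * measure \<mu> A) \<le> ennreal I" by simp
  then have le: "ennreal (c * measure \<mu> A / v r) \<le> ennreal I" by simp
  have g01: "g \<omega> = 0 \<or> g \<omega> = 1" for \<omega>
    unfolding g_def extend0_def f_def by (auto simp: indicator_def split: option.split)
  show thesis
  proof (cases "integrable (P (Some y)) g")
    case False
    then have "I = 0" by (simp add: I_def not_integrable_integral_eq)
    then show ?thesis using that[of "{}"] le by simp
  next
    case True
    define E where "E = {\<omega> \<in> space (P (Some y)). g \<omega> = 1}"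
    have [measurable]: "g \<in> borel_measurable (P (Some y))" using True by auto
    have E: "E \<in> sets (P (Some y))" unfolding E_def by measurable
    have "I = integral\<^sup>L (P (Some y)) (indicator E)" unfolding I_def
      using g01 by (intro Bochner_Integration.integral_cong) (auto simp: E_def indicator_def)
    also have "\<dots> = measure (P (Some y)) E" using E by simp
    finally have "ennreal I = emeasure (P (Some y)) E"
      using finite_measure.emeasure_eq_measure[OF prob_space.finite_measure[OF prob]] by simp
    moreover have "\<omega> \<in> \<Omega> \<and> ennreal t < exit_time X D \<omega> \<and> X (ennreal t) \<omega> \<in> Some ` A" if "\<omega> \<in> E" for \<omega>
      using that unfolding E_def g_def extend0_def part_process_def f_def
      by (auto simp: indicator_def space_P split: option.splits if_splits)
    ultimately show ?thesis using that[OF E] le by (simp add: t_def D_def)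
  qed
qed

lemma ndl_stay:
  assumes r: "r > R" and y: "y \<in> ball b (\<eta>\<^sup>2 * r)" and A: "A \<in> sets borel" "A \<subseteq> ball b (\<eta>\<^sup>2 * r)"
  shows "ennreal (c * measure \<mu> A / v r) \<le> emeasure (P (Some y))
     {\<omega>\<in>\<Omega>. path \<omega> \<in> stay (cball b r) (\<Phi> (\<eta> * r)) \<and> X (ennreal (\<Phi> (\<eta> * r))) \<omega> \<in> Some ` A}"
proof -
  obtain E where E: "E \<in> sets (P (Some y))" "ennreal (c * measure \<mu> A / v r) \<le> emeasure (P (Some y)) E"
    "\<And>\<omega>. \<omega> \<in> E \<Longrightarrow> \<omega> \<in> \<Omega> \<and> ennreal (\<Phi> (\<eta> * r)) < exit_time X (ball b r) \<omega> \<and>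
        X (ennreal (\<Phi> (\<eta> * r))) \<omega> \<in> Some ` A"
    by (rule ndl_event[OF assms]) (rule that)
  let ?t = "\<Phi> (\<eta> * r)"
  have "E \<subseteq> {\<omega>\<in>\<Omega>. path \<omega> \<in> stay (cball b r) ?t \<and> X (ennreal ?t) \<omega> \<in> Some ` A}"
  proof
    fix \<omega> assume \<omega>: "\<omega> \<in> E"
    have in_ball: "X u \<omega> \<in> Some ` cball b r" if "0 < u" "u \<le> ennreal ?t" for u
    proof (rule ccontr)
      assume "X u \<omega> \<notin> Some ` cball b r"
      then have "u \<in> {t. 0 < t \<and> X t \<omega> \<notin> Some ` ball b r}" using that by auto
      then have "exit_time X (ball b r) \<omega> \<le> u" unfolding exit_time_def by (rule Inf_lower)
      then show False using E(3)[OF \<omega>] that by auto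
    qed
    have w: "path \<omega> \<in> rc_paths" using E(3)[OF \<omega>] path_rc by blast
    have "path \<omega> (ennreal s) \<in> Some ` cball b r" if s: "0 \<le> s" "s < ?t" for s
    proof (rule rc_path_in_closed[OF w closed_cball s])
      fix q assume "s < q" "q < ?t"
      then show "path \<omega> (ennreal q) \<in> Some ` cball b r"
        using s by (intro in_ball) (auto intro: ennreal_leI)
    qed
    then show "\<omega> \<in> {\<omega>\<in>\<Omega>. path \<omega> \<in> stay (cball b r) ?t \<and> X (ennreal ?t) \<omega> \<in> Some ` A}"
      using E(3)[OF \<omega>] w by (simp add: stay_def)
  qed
  moreover have "{\<omega>\<in>\<Omega>. path \<omega> \<in> stay (cball b r) ?t \<and> X (ennreal ?t) \<omega> \<in> Some ` A} \<in> sets (P (Some y))"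
  proof -
    have "{\<omega>\<in>\<Omega>. path \<omega> \<in> stay (cball b r) ?t \<and> X (ennreal ?t) \<omega> \<in> Some ` A} =
      {\<omega>\<in>\<Omega>. path \<omega> \<in> stay (cball b r) ?t} \<inter> {\<omega>\<in>\<Omega>. X (ennreal ?t) \<omega> \<in> Some ` A}" by auto
    then show ?thesis
      using path_event_P[OF stay_sets[OF closed_cball]] X_set_P[OF Some_image_cemetery[OF A(1)]] by simp
  qed
  ultimately show ?thesis using E(2) emeasure_mono by (meson order_trans)
qed

lemma ndl_hit:
  assumes "r > R" "y \<in> ball b (\<eta>\<^sup>2 * r)" "A \<in> sets borel" "A \<subseteq> ball b (\<eta>\<^sup>2 * r)"
  shows "ennreal (c * measure \<mu> A / v r) \<le> emeasure (P (Some y)) {\<omega>\<in>\<Omega>. X (ennreal (\<Phi> (\<eta> * r))) \<omega> \<in> Some ` A}"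
  by (rule order_trans[OF ndl_stay[OF assms] emeasure_mono])
     (use X_set_P[OF Some_image_cemetery[OF assms(3)]] in auto)

lemma ndl_uniform:
  obtains c0 where "c0 > 0" "c0 \<le> 1"
    "\<And>r. \<eta>\<^sup>2 * r > R \<Longrightarrow> c0 * v r \<le> c * v (\<eta>\<^sup>2 * r)"
    "\<And>r y. \<eta>\<^sup>2 * r > R \<Longrightarrow> y \<in> ball b (\<eta>\<^sup>2 * r) \<Longrightarrow> ennreal c0 \<le> emeasure (P (Some y))
      {\<omega>\<in>\<Omega>. path \<omega> \<in> stay (cball b r) (\<Phi> (\<eta> * r)) \<and> X (ennreal (\<Phi> (\<eta> * r))) \<omega> \<in> Some ` ball b (\<eta>\<^sup>2 * r)}"
proof -
  have \<eta>2: "0 < \<eta>\<^sup>2" "\<eta>\<^sup>2 \<le> 1" using \<eta> by (auto simp: power_le_one)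
  obtain K where K: "K > 0" "\<And>r. \<eta>\<^sup>2 * r > R \<Longrightarrow> v r \<le> K * v (\<eta>\<^sup>2 * r)"
    by (rule v_doubling[OF \<eta>2]) (rule that)
  define c0 where "c0 = min 1 (c / K)"
  have c0: "c0 > 0" "c0 \<le> 1" using c_pos K by (auto simp: c0_def)
  have 1: "c0 * v r \<le> c * v (\<eta>\<^sup>2 * r)" if "\<eta>\<^sup>2 * r > R" for r
  proof -
    have "c0 * v r \<le> (c / K) * v r" by (intro mult_right_mono) (auto simp: c0_def v_def)
    also have "\<dots> \<le> (c / K) * (K * v (\<eta>\<^sup>2 * r))" using K(2)[OF that] K c_pos by (intro mult_left_mono) auto
    finally show ?thesis using K by simp
  qed
  have "ennreal c0 \<le> emeasure (P (Some y))
      {\<omega>\<in>\<Omega>. path \<omega> \<in> stay (cball b r) (\<Phi> (\<eta> * r)) \<and> X (ennreal (\<Phi> (\<eta> * r))) \<omega> \<in> Some ` ball b (\<eta>\<^sup>2 * r)}"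
    if r: "\<eta>\<^sup>2 * r > R" and y: "y \<in> ball b (\<eta>\<^sup>2 * r)" for r y
  proof -
    have "r > 0" using r R_ge_1 \<eta>2 by (smt (verit) zero_less_mult_pos)
    then have "\<eta>\<^sup>2 * r \<le> 1 * r" using \<eta>2 by (intro mult_right_mono) auto
    then have rR: "r > R" using r by simp
    have "c0 \<le> c * v (\<eta>\<^sup>2 * r) / v r" using 1[OF r] vol_center(2)[OF rR] by (simp add: pos_le_divide_eq)
    then have "ennreal c0 \<le> ennreal (c * measure \<mu> (ball b (\<eta>\<^sup>2 * r)) / v r)"
      by (intro ennreal_leI) (simp add: v_def)
    also have "\<dots> \<le> emeasure (P (Some y)) {\<omega>\<in>\<Omega>. path \<omega> \<in> stay (cball b r) (\<Phi> (\<eta> * r)) \<and> X (ennreal (\<Phi> (\<eta> * r))) \<omega> \<in> Some ` ball b (\<eta>\<^sup>2 * r)}"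
      by (rule ndl_stay[OF rR y]) auto
    finally show ?thesis .
  qed
  then show thesis using that[OF c0 1] by blast
qed

lemma survival:
  obtains c0 where "c0 > 0" "c0 \<le> 1"
    "\<And>y t. 0 \<le> t \<Longrightarrow> emeasure (P (Some y)) {\<omega>\<in>\<Omega>. X (ennreal t) \<omega> = None} \<le> ennreal (1 - c0)"
proof -
  obtain c0 where c0: "c0 > 0" "c0 \<le> 1" 
    "\<And>r y. \<eta>\<^sup>2 * r > R \<Longrightarrow> y \<in> ball b (\<eta>\<^sup>2 * r) \<Longrightarrow> ennreal c0 \<le> emeasure (P (Some y))
      {\<omega>\<in>\<Omega>. path \<omega> \<in> stay (cball b r) (\<Phi> (\<eta> * r)) \<and> X (ennreal (\<Phi> (\<eta> * r))) \<omega> \<in> Some ` ball b (\<eta>\<^sup>2 * r)}"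
    by (rule ndl_uniform) (rule that)
  have "emeasure (P (Some y)) {\<omega>\<in>\<Omega>. X (ennreal t) \<omega> = None} \<le> ennreal (1 - c0)" if t: "0 \<le> t" for y t
  proof -
    obtain r0 where r0: "r0 > 0" "\<And>r. r \<ge> r0 \<Longrightarrow> \<Phi> r \<ge> t" by (rule \<Phi>_ge_large[of t]) (rule that)
    have \<eta>2: "0 < \<eta>\<^sup>2" using \<eta> by simp
    define r where "r = max (r0 / \<eta>) ((max R (dist b y) + 1) / \<eta>\<^sup>2)"
    have "r0 / \<eta> \<le> r" "(max R (dist b y) + 1) / \<eta>\<^sup>2 \<le> r" by (auto simp: r_def)
    then have rr: "r0 \<le> \<eta> * r" "max R (dist b y) + 1 \<le> \<eta>\<^sup>2 * r"
      using \<eta> \<eta>2 by (auto simp: pos_divide_le_eq mult.commute)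
    let ?t = "\<Phi> (\<eta> * r)"
    let ?A = "{\<omega>\<in>\<Omega>. X (ennreal t) \<omega> \<in> {None}}"
    have tt: "ennreal t \<le> ennreal ?t" using r0(2)[OF rr(1)] by (rule ennreal_leI)
    let ?S = "{\<omega>\<in>\<Omega>. path \<omega> \<in> stay (cball b r) ?t \<and> X (ennreal ?t) \<omega> \<in> Some ` ball b (\<eta>\<^sup>2 * r)}"
    have disj: "?S \<subseteq> \<Omega> - ?A"
    proof
      fix \<omega> assume \<omega>: "\<omega> \<in> ?S"
      have "X (ennreal t) \<omega> \<noteq> None"
      proof
        assume "X (ennreal t) \<omega> = None"
        then have "X (ennreal ?t) \<omega> = None" using rc_paths_NoneD[OF path_rc _ tt] \<omega> by auto
        then show False using \<omega> by auto
      qed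
      then show "\<omega> \<in> \<Omega> - ?A" using \<omega> by auto
    qed
    interpret prob_space "P (Some y)" by (rule prob)
    have A: "?A \<in> events" by (rule X_set_P[OF None_cemetery])
    have "ennreal c0 \<le> emeasure (P (Some y)) ?S"
      using rr by (intro c0(3)) (auto simp: mem_ball)
    also have "\<dots> \<le> emeasure (P (Some y)) (\<Omega> - ?A)"
      using sets.compl_sets[OF A] by (intro emeasure_mono[OF disj]) (simp only: space_P)
    also have "\<dots> = ennreal (1 - prob ?A)"
      using prob_compl[OF A] by (simp add: emeasure_eq_measure space_P)
    finally have "prob ?A \<le> 1 - c0" using c0 by (subst (asm) ennreal_le_iff) auto
    then have "emeasure (P (Some y)) ?A \<le> ennreal (1 - c0)" by (simp add: emeasure_eq_measure ennreal_leI)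
    then show ?thesis by simp
  qed
  then show thesis using that c0 by blast
qed

end

section \<open>Conservativeness\<close>

lemma dense_set_between:
  fixes s t :: "'a::{linorder_topology, dense_order}"
  assumes D: "\<And>S. open S \<Longrightarrow> S \<noteq> {} \<Longrightarrow> \<exists>d\<in>D. d \<in> S" and "s < t"
  shows "\<exists>q\<in>D. s < q \<and> q < t"
proof -
  obtain z where "s < z" "z < t" using dense[OF \<open>s < t\<close>] by blast
  then have "{s<..<t} \<noteq> {}" by (metis empty_iff greaterThanLessThan_iff)
  then show ?thesis using D[of "{s<..<t}"] by auto
qed

context borel_standard_process
begin

primrec hit :: "(nat \<Rightarrow> 'a set) \<Rightarrow> nat \<Rightarrow> 'w \<Rightarrow> ennreal" where
  "hit U 0 \<omega> = 0"
| "hit U (Suc n) \<omega> = Inf {t. hit U n \<omega> < t \<and> X t \<omega> \<in> Some ` U n}"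

lemma hit_mono: "hit U n \<omega> \<le> hit U (Suc n) \<omega>"
  by (auto intro!: Inf_greatest)

lemma hit_less_iff:
  assumes \<omega>: "\<omega> \<in> \<Omega>" and U: "open (U n)"
    and D: "\<And>S. open S \<Longrightarrow> S \<noteq> {} \<Longrightarrow> \<exists>d\<in>D. d \<in> (S :: ennreal set)"
  shows "hit U (Suc n) \<omega> < t \<longleftrightarrow> (\<exists>q\<in>D. q < t \<and> hit U n \<omega> < q \<and> X q \<omega> \<in> Some ` U n)"
proof
  assume "hit U (Suc n) \<omega> < t"
  then obtain s where s: "hit U n \<omega> < s" "X s \<omega> \<in> Some ` U n" "s < t"
    by (auto simp: Inf_less_iff)
  then obtain y where y: "X s \<omega> = Some y" "y \<in> U n" by auto
  have "s < \<infinity>" using s(3) by (metis infinity_ennreal_def less_top not_less_iff_gr_or_eq order.strict_trans)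
  then obtain u where u: "u > s" "\<And>v. s \<le> v \<Longrightarrow> v < u \<Longrightarrow> X v \<omega> \<in> Some ` U n"
    using rc_paths_rightD[OF path_rc[OF \<omega>] y(1) U y(2)] by metis
  have "s < min u t" using u(1) s(3) by simp
  then obtain q where "q \<in> D" "s < q" "q < min u t" using dense_set_between[OF D] by blast
  then show "\<exists>q\<in>D. q < t \<and> hit U n \<omega> < q \<and> X q \<omega> \<in> Some ` U n"
    using u(2)[of q] s(1) by (intro bexI[of _ q]) auto
next
  assume "\<exists>q\<in>D. q < t \<and> hit U n \<omega> < q \<and> X q \<omega> \<in> Some ` U n"
  then show "hit U (Suc n) \<omega> < t" by (auto simp: Inf_less_iff)
qed

lemma stopping_time_hit:
  assumes U: "\<And>n. open (U n)"
  shows "stopping_time F (hit U n)"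
proof (induction n)
  case 0
  then show ?case using stopping_time_const[of F 0] by (simp add: hit.simps(1)[abs_def])
next
  case (Suc n)
  obtain D :: "ennreal set" where D: "countable D" "\<And>S. open S \<Longrightarrow> S \<noteq> {} \<Longrightarrow> \<exists>d\<in>D. d \<in> S"
    by (rule countable_dense_setE) (rule that)
  have less: "{\<omega>\<in>\<Omega>. hit U (Suc n) \<omega> < t} \<in> sets (F t)" for t
  proof -
    have "{\<omega>\<in>\<Omega>. hit U (Suc n) \<omega> < t} =
        (\<Union>q\<in>{q\<in>D. q < t}. {\<omega>\<in>\<Omega>. hit U n \<omega> < q} \<inter> {\<omega>\<in>\<Omega>. X q \<omega> \<in> Some ` U n})"
    proof -
      have "hit U (Suc n) \<omega> < t \<longleftrightarrow> (\<exists>q\<in>D. q < t \<and> hit U n \<omega> < q \<and> X q \<omega> \<in> Some ` U n)" if "\<omega> \<in> \<Omega>" for \<omega>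
        by (rule hit_less_iff[where D=D, OF that U D(2)])
      then show ?thesis by blast
    qed
    moreover have "{\<omega>\<in>\<Omega>. hit U n \<omega> < q} \<inter> {\<omega>\<in>\<Omega>. X q \<omega> \<in> Some ` U n} \<in> sets (F t)" if "q < t" for q
    proof (rule sets.Int)
      have "{\<omega>\<in>\<Omega>. hit U n \<omega> < q} \<in> sets (F q)"
        using stopping_time_less_const[OF Suc, of q] by (simp add: pred_def space_F)
      then show "{\<omega>\<in>\<Omega>. hit U n \<omega> < q} \<in> sets (F t)" by (rule subsetD[OF sets_F_mono, rotated]) (use that in simp)
      show "{\<omega>\<in>\<Omega>. X q \<omega> \<in> Some ` U n} \<in> sets (F t)"
        using that U by (intro X_set_F Some_image_cemetery) auto
    qed
    ultimately show ?thesis using D(1) by (auto intro!: sets.countable_UN')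
  qed
  show ?case
  proof (rule stopping_timeI)
    fix t
    show "Measurable.pred (F t) (\<lambda>\<omega>. hit U (Suc n) \<omega> \<le> t)"
    proof (cases "t < \<infinity>")
      case False
      then have "t = \<infinity>" by (metis infinity_ennreal_def less_top)
      then show ?thesis by simp
    next
      case True
      have "{\<omega>\<in>\<Omega>. hit U (Suc n) \<omega> \<le> t} \<in> sets (F s)" if s: "t < s" for s
      proof -
        have "{\<omega>\<in>\<Omega>. hit U (Suc n) \<omega> \<le> t} = \<Omega> \<inter> (\<Inter>q\<in>{q\<in>D. t < q \<and> q < s}. {\<omega>\<in>\<Omega>. hit U (Suc n) \<omega> < q})"
        proof (intro equalityI subsetI)
          fix \<omega> assume *: "\<omega> \<in> \<Omega> \<inter> (\<Inter>q\<in>{q\<in>D. t < q \<and> q < s}. {\<omega>\<in>\<Omega>. hit U (Suc n) \<omega> < q})"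
          have "hit U (Suc n) \<omega> \<le> t"
          proof (rule ccontr)
            assume "\<not> hit U (Suc n) \<omega> \<le> t"
            then have "t < min (hit U (Suc n) \<omega>) s" using s by simp
            then obtain q where q: "q \<in> D" "t < q" "q < min (hit U (Suc n) \<omega>) s"
              using dense_set_between[OF D(2)] by blast
            then have "\<omega> \<in> {\<omega>\<in>\<Omega>. hit U (Suc n) \<omega> < q}" using * by auto
            then have "hit U (Suc n) \<omega> < q" by blast
            moreover have "q < hit U (Suc n) \<omega>" using q(3) by (simp del: hit.simps)
            ultimately show False using less_asym by blast
          qed
          then show "\<omega> \<in> {\<omega>\<in>\<Omega>. hit U (Suc n) \<omega> \<le> t}" using * by auto
        qed (auto simp del: hit.simps)
        moreover have "\<Omega> \<inter> (\<Inter>q\<in>{q\<in>D. t < q \<and> q < s}. {\<omega>\<in>\<Omega>. hit U (Suc n) \<omega> < q}) \<in> sets (F s)"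
        proof -
          have "{\<omega>\<in>\<Omega>. hit U (Suc n) \<omega> < q} \<in> sets (F s)" if "q < s" for q
            by (rule subsetD[OF sets_F_mono less]) (use that in simp)
          moreover have "{q\<in>D. t < q \<and> q < s} \<noteq> {}"
            using dense_set_between[OF D(2) s] by blast
          moreover have "\<Omega> \<in> sets (F s)" using sets.top[of "F s"] by (simp add: space_F)
          moreover have "countable {q\<in>D. t < q \<and> q < s}" using D(1) by simp
          ultimately show ?thesis by (intro sets.Int sets.countable_INT') auto
        qed
        ultimately show ?thesis by simp
      qed
      then show ?thesis
        using filtration_right_continuous[OF True] by (simp add: pred_def space_F del: hit.simps)
    qed
  qed
qed

lemma X_hit:
  assumes \<omega>: "\<omega> \<in> \<Omega>" and "hit U (Suc n) \<omega> < \<infinity>"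
  obtains y where "X (hit U (Suc n) \<omega>) \<omega> = Some y" "y \<in> closure (U n)"
proof -
  define T where "T = hit U (Suc n) \<omega>"
  have T: "T < \<infinity>" "T = Inf {t. hit U n \<omega> < t \<and> X t \<omega> \<in> Some ` U n}" using assms by (auto simp: T_def)
  have near: "\<exists>t. T \<le> t \<and> t < u \<and> X t \<omega> \<in> Some ` U n" if "T < u" for u
  proof -
    obtain t where t: "hit U n \<omega> < t" "X t \<omega> \<in> Some ` U n" "t < u"
      using \<open>T < u\<close> unfolding T(2) by (auto simp: Inf_less_iff)
    moreover have "T \<le> t" unfolding T(2) using t by (intro Inf_lower) auto
    ultimately show ?thesis by blast
  qed
  show thesis
  proof (cases "X T \<omega>")
    case None
    obtain t where "T \<le> t" "X t \<omega> \<in> Some ` U n" using near[OF T(1)] by blast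
    then show ?thesis using rc_paths_NoneD[OF path_rc[OF \<omega>] None] by auto
  next
    case (Some y)
    have "y \<in> closure (U n)"
    proof (rule ccontr)
      assume "y \<notin> closure (U n)"
      then have "open (- closure (U n))" "y \<in> - closure (U n)" by auto
      then obtain u where u: "u > T" "\<And>s. T \<le> s \<Longrightarrow> s < u \<Longrightarrow> X s \<omega> \<in> Some ` (- closure (U n))"
        using rc_paths_rightD[OF path_rc[OF \<omega>] Some, of "- closure (U n)"] T(1) by metis
      obtain t where "T \<le> t" "t < u" "X t \<omega> \<in> Some ` U n" using near[OF u(1)] by blast
      then show False using u(2)[of t] closure_subset by fastforce
    qed
    then show ?thesis using that Some by (simp add: T_def)
  qed
qed

lemma hit_less_if_frequently:
  assumes "\<And>n t. t < \<zeta> \<Longrightarrow> \<exists>s. t < s \<and> s < \<zeta> \<and> X s \<omega> \<in> Some ` U n" "0 < \<zeta>"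
  shows "hit U n \<omega> < \<zeta>"
proof (induction n)
  case (Suc n)
  obtain s where s: "hit U n \<omega> < s" "s < \<zeta>" "X s \<omega> \<in> Some ` U n" using assms(1)[OF Suc] by blast
  then have "hit U (Suc n) \<omega> \<le> s" by (auto intro!: Inf_lower)
  then show ?case using s by (simp del: hit.simps)
qed (use assms in simp)

end

definition escaping :: "(nat \<Rightarrow> 'a::topological_space set) \<Rightarrow> bool" where
  "escaping U \<longleftrightarrow> (\<forall>n. open (U n)) \<and> (\<forall>x xs. (\<forall>n. xs n \<in> closure (U n)) \<longrightarrow> \<not> xs \<longlonglongrightarrow> x)"

lemma escaping_complement_compact:
  obtains K :: "nat \<Rightarrow> 'a::lc_separable_metric_space set"
  where "\<And>n. compact (K n)" "escaping (\<lambda>n. - K n)"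
proof -
  obtain B :: "'a set set" where B: "countable B" "topological_basis B"
    using ex_countable_basis by blast
  define C where "C = {S\<in>B. compact (closure S)}"
  have cov: "\<exists>S\<in>C. x \<in> S" for x :: 'a
  proof -
    have "\<exists>U K. open U \<and> compact K \<and> x \<in> U \<and> U \<subseteq> K"
      using locally_compact_UNIV[where 'a='a] unfolding locally_compact_space_def by auto
    then obtain U K where UK: "open U" "compact K" "x \<in> U" "U \<subseteq> K" by blast
    obtain S where S: "S \<in> B" "x \<in> S" "S \<subseteq> U" by (rule topological_basisE[OF B(2) UK(1,3)]) (rule that)
    have "S \<subseteq> K" using S UK by blast
    then have "closure S \<subseteq> K" using compact_imp_closed[OF UK(2)] by (rule closure_minimal)
    then have "K \<inter> closure S = closure S" by blast
    with compact_Int_closed[OF UK(2) closed_closure[of S]] have "compact (closure S)" by simp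
    then show ?thesis using S by (auto simp: C_def)
  qed
  have C: "countable C" "C \<noteq> {}" using B(1) cov by (auto simp: C_def)
  define K where "K n = (\<Union>i\<le>n. closure (from_nat_into C i))" for n :: nat
  have in_C: "from_nat_into C i \<in> C" for i using C by (simp add: from_nat_into)
  have comp: "compact (K n)" for n
    unfolding K_def using in_C by (intro compact_UN) (auto simp: C_def)
  have "\<not> xs \<longlonglongrightarrow> x" if xs: "\<forall>n. xs n \<in> closure (- K n)" for x and xs :: "nat \<Rightarrow> 'a"
  proof
    assume lim: "xs \<longlonglongrightarrow> x"
    obtain S where S: "S \<in> C" "x \<in> S" using cov by blast
    then obtain i where i: "from_nat_into C i = S" using from_nat_into_surj[OF C(1) S(1)] by blast
    have "open S" using S B(2) by (auto simp: C_def topological_basis_open)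
    then have "eventually (\<lambda>n. xs n \<in> S) sequentially" using lim S by (auto dest: topological_tendstoD)
    moreover have "eventually (\<lambda>n. xs n \<notin> S) sequentially"
      using eventually_ge_at_top[of i]
    proof eventually_elim
      case (elim n)
      have "S \<subseteq> K n" unfolding K_def using elim i closure_subset[of S] by blast
      then have "S \<inter> (- K n) = {}" by blast
      then have "S \<inter> closure (- K n) = {}" using \<open>open S\<close> by (simp add: open_Int_closure_eq_empty)
      then show ?case using xs by blast
    qed
    ultimately have "eventually (\<lambda>n. False) sequentially" by eventually_elim simp
    then show False by simp
  qed
  moreover have "open (- K n)" for n using comp compact_imp_closed by blast
  ultimately have "escaping (\<lambda>n. - K n)" unfolding escaping_def by blast
  then show thesis using that comp by blast
qed

definition alternating :: "'a::metric_space \<Rightarrow> real \<Rightarrow> real \<Rightarrow> nat \<Rightarrow> 'a set" where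
  "alternating q a a' n = (if even n then ball q a else - cball q a')"

lemma escaping_alternating:
  assumes "a < a'"
  shows "escaping (alternating q a a')"
  unfolding escaping_def
proof (intro conjI allI impI notI)
  show "open (alternating q a a' n)" for n by (auto simp: alternating_def)
next
  fix x and xs :: "nat \<Rightarrow> 'a" assume xs: "\<forall>n. xs n \<in> closure (alternating q a a' n)" and lim: "xs \<longlonglongrightarrow> x"
  have near: "dist q (xs n) \<le> a" if "even n" for n
  proof -
    have "closure (ball q a) \<subseteq> cball q a" by (intro closure_minimal) auto
    moreover have "xs n \<in> closure (ball q a)" using xs that by (metis alternating_def)
    ultimately show ?thesis by auto
  qed
  have far: "dist q (xs n) \<ge> a'" if "odd n" for n
  proof -
    have "closure (- cball q a') \<subseteq> - ball q a'" by (intro closure_minimal) auto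
    moreover have "xs n \<in> closure (- cball q a')" using xs that by (metis alternating_def)
    ultimately show ?thesis by auto
  qed
  have lim': "(\<lambda>n. dist q (xs n)) \<longlonglongrightarrow> dist q x" using lim by (intro tendsto_intros)
  have "strict_mono (\<lambda>n::nat. 2 * n)" "strict_mono (\<lambda>n::nat. 2 * n + 1)" by (auto intro: strict_monoI)
  from LIMSEQ_subseq_LIMSEQ[OF lim' this(1)] LIMSEQ_subseq_LIMSEQ[OF lim' this(2)]
  have "(\<lambda>n. dist q (xs (2 * n))) \<longlonglongrightarrow> dist q x" "(\<lambda>n. dist q (xs (2 * n + 1))) \<longlonglongrightarrow> dist q x"
    by (auto simp: o_def)
  then have "dist q x \<le> a" "a' \<le> dist q x"
    using LIMSEQ_le_const2[of "\<lambda>n. dist q (xs (2 * n))" "dist q x" a] near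
      LIMSEQ_le_const[of "\<lambda>n. dist q (xs (2 * n + 1))" "dist q x" a'] far by auto
  then show False using assms by simp
qed

text \<open>A path without a left limit at its lifetime visits the members of one of countably many
  escaping sequences of open sets in turn: either it leaves every compact set of an exhaustion
  infinitely often, or it has a cluster point that is not its limit.\<close>

lemma no_left_limit_frequently:
  fixes w :: "ennreal \<Rightarrow> 'a::lc_separable_metric_space option"
  assumes K: "\<And>n. compact (K n)"
    and D: "\<And>S::'a set. open S \<Longrightarrow> S \<noteq> {} \<Longrightarrow> \<exists>d\<in>D. d \<in> S"
    and \<zeta>: "0 < \<zeta>" and alive: "\<And>t. t < \<zeta> \<Longrightarrow> w t \<noteq> None"
    and no: "\<nexists>y. tends_to_point w y (at_left \<zeta>)"
  shows "\<exists>U\<in>insert (\<lambda>n. - K n) {alternating q a a' | q a a'. q \<in> D \<and> a \<in> \<rat> \<and> a' \<in> \<rat> \<and> a < a'}.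
      \<forall>n. \<forall>t<\<zeta>. \<exists>s. t < s \<and> s < \<zeta> \<and> w s \<in> Some ` U n"
proof -
  have ev: "eventually Q (at_left \<zeta>) \<longleftrightarrow> (\<exists>t<\<zeta>. \<forall>s>t. s < \<zeta> \<longrightarrow> Q s)" for Q
    by (rule eventually_at_left[OF \<zeta>])
  have freq: "(\<forall>t<\<zeta>. \<exists>s. t < s \<and> s < \<zeta> \<and> w s \<in> Some ` S) \<longleftrightarrow> \<not> eventually (\<lambda>s. w s \<in> Some ` (- S)) (at_left \<zeta>)" for S
  proof -
    have "w s \<in> Some ` (- S) \<longleftrightarrow> w s \<notin> Some ` S" if "s < \<zeta>" for s
      using alive[OF that] by auto
    then show ?thesis unfolding ev by blast
  qed
  have nontriv: "at_left \<zeta> \<noteq> bot"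
  proof
    assume "at_left \<zeta> = bot"
    then have "eventually (\<lambda>_. False) (at_left \<zeta>)" by simp
    then obtain t where "t < \<zeta>" "\<forall>s>t. s < \<zeta> \<longrightarrow> False" unfolding ev by blast
    then show False using dense by blast
  qed
  show ?thesis
  proof (cases "\<forall>n. \<forall>t<\<zeta>. \<exists>s. t < s \<and> s < \<zeta> \<and> w s \<in> Some ` (- K n)")
    case True
    then show ?thesis by (rule bexI[where x="\<lambda>n. - K n"]) simp
  next
    case False
    then obtain n where "\<not> (\<forall>t<\<zeta>. \<exists>s. t < s \<and> s < \<zeta> \<and> w s \<in> Some ` (- K n))" by blast
    then have inK: "eventually (\<lambda>s. w s \<in> Some ` K n) (at_left \<zeta>)" unfolding freq by simp
    define G where "G = filtermap (\<lambda>s. the (w s)) (at_left \<zeta>)"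
    have "G \<noteq> bot" using nontriv by (simp add: G_def filtermap_bot_iff)
    moreover have "eventually (\<lambda>x. x \<in> K n) G"
      unfolding G_def eventually_filtermap using inK by eventually_elim auto
    ultimately obtain y where y: "inf (nhds y) G \<noteq> bot"
      using K[of n] unfolding compact_filter by blast
    have cluster: "\<not> eventually (\<lambda>s. w s \<in> Some ` (- S)) (at_left \<zeta>)" if "open S" "y \<in> S" for S
    proof
      assume "eventually (\<lambda>s. w s \<in> Some ` (- S)) (at_left \<zeta>)"
      then have "eventually (\<lambda>x. x \<notin> S) G"
        unfolding G_def eventually_filtermap by eventually_elim auto
      moreover have "eventually (\<lambda>x. x \<in> S) (nhds y)" using that by (auto simp: eventually_nhds)
      ultimately have "eventually (\<lambda>x. False) (inf (nhds y) G)" unfolding eventually_inf by blast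
      then show False using y by (simp add: trivial_limit_def)
    qed
    obtain S where S: "open S" "y \<in> S" "\<not> eventually (\<lambda>s. w s \<in> Some ` S) (at_left \<zeta>)"
      using no unfolding tends_to_point_iff by blast
    obtain e where e: "e > 0" "ball y e \<subseteq> S" using S openE by blast
    have "ball y (e / 8) \<noteq> {}" using e by simp
    then obtain q where q: "q \<in> D" "dist y q < e / 8" using D[of "ball y (e / 8)"] by auto
    obtain a where a: "a \<in> \<rat>" "e / 4 < a" "a < e / 3" using Rats_dense_in_real[of "e / 4" "e / 3"] e by auto
    obtain a' where a': "a' \<in> \<rat>" "e / 2 < a'" "a' < 2 * e / 3" using Rats_dense_in_real[of "e / 2" "2 * e / 3"] e by auto
    have "- ball q a \<subseteq> - ball y (e / 8)"
    proof (intro Compl_anti_mono subsetI)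
      fix x assume "x \<in> ball y (e / 8)"
      then show "x \<in> ball q a" using q a dist_triangle[of q x y] by (simp add: dist_commute)
    qed
    have n1: "\<not> eventually (\<lambda>s. w s \<in> Some ` (- ball q a)) (at_left \<zeta>)"
    proof
      assume "eventually (\<lambda>s. w s \<in> Some ` (- ball q a)) (at_left \<zeta>)"
      then have "eventually (\<lambda>s. w s \<in> Some ` (- ball y (e / 8))) (at_left \<zeta>)"
        by eventually_elim (use \<open>- ball q a \<subseteq> - ball y (e / 8)\<close> in blast)
      then show False using cluster[of "ball y (e / 8)"] e by simp
    qed
    have sub: "cball q a' \<subseteq> S"
    proof
      fix x assume "x \<in> cball q a'"
      then have "x \<in> ball y e" using q a' e dist_triangle[of y x q] by (simp add: dist_commute)
      then show "x \<in> S" using e by blast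
    qed
    have n2: "\<not> eventually (\<lambda>s. w s \<in> Some ` (- (- cball q a'))) (at_left \<zeta>)"
    proof
      assume "eventually (\<lambda>s. w s \<in> Some ` (- (- cball q a'))) (at_left \<zeta>)"
      then have "eventually (\<lambda>s. w s \<in> Some ` S) (at_left \<zeta>)" by eventually_elim (use sub in auto)
      then show False using S(3) by simp
    qed
    have "\<forall>n. \<forall>t<\<zeta>. \<exists>s. t < s \<and> s < \<zeta> \<and> w s \<in> Some ` alternating q a a' n"
    proof
      fix n show "\<forall>t<\<zeta>. \<exists>s. t < s \<and> s < \<zeta> \<and> w s \<in> Some ` alternating q a a' n"
        unfolding freq using n1 n2 by (cases "even n") (simp_all add: alternating_def)
    qed
    moreover have "a < a'" using a a' e by simp
    ultimately show ?thesis using q(1) a(1) a'(1)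
      by (intro bexI[where x="alternating q a a'"]) auto
  qed
qed

lemma infsum_ennreal_ge:
  fixes g :: "'a \<Rightarrow> ennreal"
  assumes "x \<in> A" shows "g x \<le> (\<Sum>\<^sub>\<infinity>x\<in>A. g x)"
proof -
  have "(\<Sum>\<^sub>\<infinity>x\<in>{x}. g x) \<le> (\<Sum>\<^sub>\<infinity>x\<in>A. g x)"
    using assms by (intro infsum_mono_neutral nonneg_summable_on_complete) auto
  then show ?thesis by simp
qed

context borel_standard_process
begin

lemma lifetime_le_iff: "\<omega> \<in> \<Omega> \<Longrightarrow> lifetime X \<omega> \<le> t \<longleftrightarrow> X t \<omega> = None"
proof
  assume "\<omega> \<in> \<Omega>" "lifetime X \<omega> \<le> t" then show "X t \<omega> = None" by (rule cemetery)
next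
  assume "X t \<omega> = None" then show "lifetime X \<omega> \<le> t" unfolding lifetime_def by (intro Inf_lower) simp
qed

lemma measurable_lifetime: "lifetime X \<in> borel_measurable (P x)"
proof (rule borel_measurableI_le)
  fix t
  have "{\<omega> \<in> space (P x). lifetime X \<omega> \<le> t} = {\<omega>\<in>\<Omega>. X t \<omega> \<in> {None}}"
    using lifetime_le_iff by (auto simp: space_P)
  then show "{\<omega> \<in> space (P x). lifetime X \<omega> \<le> t} \<in> sets (P x)"
    using X_set_P[OF None_cemetery] by simp
qed

end

context occupation_setting
begin

text \<open>If the successive hitting times were bounded, the lifetime would be announced by them, and the
  probability of dying soon after the \<open>n\<close>-th one would tend to one, against the uniform bound
  \<open>survival\<close>.\<close>

lemma hit_unbounded:
  assumes U: "escaping U" and N: "0 \<le> (N :: real)"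
  shows "emeasure (P (Some z)) {\<omega>\<in>\<Omega>. \<forall>n. hit U n \<omega> \<le> ennreal N} = 0"
    and "{\<omega>\<in>\<Omega>. \<forall>n. hit U n \<omega> \<le> ennreal N} \<in> sets (P (Some z))"
proof -
  interpret prob_space "P (Some z)" by (rule prob)
  have Uo: "\<And>n. open (U n)" and Ue: "\<And>xs x. (\<forall>n. xs n \<in> closure (U n)) \<Longrightarrow> \<not> xs \<longlonglongrightarrow> x"
    using U unfolding escaping_def by blast+
  note st = stopping_time_hit[of U, OF Uo]
  define A where "A n = {\<omega>\<in>\<Omega>. hit U n \<omega> \<le> ennreal N}" for n
  have AF: "A n \<in> sets (F t)" if "ennreal N \<le> t" for n t
    using stopping_time_le_const[OF st that, of n] by (simp add: A_def pred_def space_F)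
  then have A: "A n \<in> events" for n using sets_F_le_P by blast
  have Apre: "A n \<in> sets (pre_sigma (hit U n))" for n
  proof (rule sets_pre_sigmaI[OF st])
    fix t
    have "{\<omega>\<in>A n. hit U n \<omega> \<le> t} = {\<omega>\<in>space (F t). hit U n \<omega> \<le> min (ennreal N) t}"
      by (auto simp: A_def space_F)
    then show "{\<omega>\<in>A n. hit U n \<omega> \<le> t} \<in> sets (F t)"
      using stopping_time_le_const[OF st, of "min (ennreal N) t" t n] by (simp add: pred_def)
  qed
  have dec: "decseq A"
  proof (rule decseq_SucI)
    show "A (Suc n) \<subseteq> A n" for n
    proof
      fix \<omega> assume "\<omega> \<in> A (Suc n)"
      then show "\<omega> \<in> A n" using order_trans[OF hit_mono[of U n \<omega>]] by (simp add: A_def del: hit.simps)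
    qed
  qed
  define B where "B = (\<Inter>n. A n)"
  have B_eq: "{\<omega>\<in>\<Omega>. \<forall>n. hit U n \<omega> \<le> ennreal N} = B" by (auto simp: B_def A_def)
  have B: "B \<in> events" unfolding B_def using A by blast
  obtain c0 where c0: "c0 > 0" "c0 \<le> 1"
    "\<And>y t. 0 \<le> t \<Longrightarrow> emeasure (P (Some y)) {\<omega>\<in>\<Omega>. X (ennreal t) \<omega> = None} \<le> ennreal (1 - c0)"
    by (rule survival) (rule that)
  have die: "emeasure (P (Some z)) {\<omega>\<in>A (Suc n). X (hit U (Suc n) \<omega> + ennreal N) \<omega> \<in> {None}}
      \<le> ennreal (1 - c0) * emeasure (P (Some z)) (A (Suc n))" for n
  proof -
    have "emeasure (P (Some z)) {\<omega>\<in>A (Suc n). X (hit U (Suc n) \<omega> + ennreal N) \<omega> \<in> {None}} =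
      (\<integral>\<^sup>+\<omega>\<in>A (Suc n). emeasure (P (X (hit U (Suc n) \<omega>) \<omega>)) {\<omega>'\<in>\<Omega>. X (ennreal N) \<omega>' \<in> {None}} \<partial>P (Some z))"
      by (rule strong_Markov[OF st Apre None_cemetery])
    also have "\<dots> \<le> (\<integral>\<^sup>+\<omega>. ennreal (1 - c0) * indicator (A (Suc n)) \<omega> \<partial>P (Some z))"
    proof (rule nn_integral_mono)
      fix \<omega>
      show "emeasure (P (X (hit U (Suc n) \<omega>) \<omega>)) {\<omega>'\<in>\<Omega>. X (ennreal N) \<omega>' \<in> {None}} * indicator (A (Suc n)) \<omega>
         \<le> ennreal (1 - c0) * indicator (A (Suc n)) \<omega>"
      proof (cases "\<omega> \<in> A (Suc n)")
        case True
        then have "\<omega> \<in> \<Omega>" "hit U (Suc n) \<omega> \<le> ennreal N" by (auto simp: A_def simp del: hit.simps)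
        moreover from this have "hit U (Suc n) \<omega> < \<infinity>"
          by (metis ennreal_less_top infinity_ennreal_def order_le_less_trans)
        ultimately obtain y where "X (hit U (Suc n) \<omega>) \<omega> = Some y" by (metis X_hit)
        then show ?thesis using c0(3)[OF N, of y] True by (simp del: hit.simps)
      qed simp
    qed
    also have "\<dots> = ennreal (1 - c0) * emeasure (P (Some z)) (A (Suc n))"
      using A by (simp add: nn_integral_cmult_indicator)
    finally show ?thesis .
  qed
  have "AE \<omega> in P (Some z). (SUP n. hit U n \<omega>) < lifetime X \<omega> \<longrightarrow>
        (\<exists>y. X (SUP n. hit U n \<omega>) \<omega> = Some y \<and> tends_to_point (\<lambda>n. X (hit U n \<omega>) \<omega>) y sequentially)"
    by (rule quasi_left_continuous[OF st]) (rule hit_mono)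
  then have "AE \<omega> in P (Some z). \<omega> \<in> B \<longrightarrow> (\<forall>n. X (hit U (Suc n) \<omega> + ennreal N) \<omega> = None)"
    using AE_space
  proof eventually_elim
    case (elim \<omega>)
    show ?case
    proof (intro impI allI)
      fix n assume "\<omega> \<in> B"
      then have hN: "hit U n \<omega> \<le> ennreal N" for n by (simp add: B_def A_def)
      have \<omega>: "\<omega> \<in> \<Omega>" using elim by (simp add: space_P)
      have "lifetime X \<omega> \<le> (SUP n. hit U n \<omega>)"
      proof (rule ccontr)
        assume "\<not> ?thesis"
        then obtain y where y: "tends_to_point (\<lambda>n. X (hit U n \<omega>) \<omega>) y sequentially" using elim by auto
        define xs where "xs n = the (X (hit U (Suc n) \<omega>) \<omega>)" for n
        have xs: "X (hit U (Suc n) \<omega>) \<omega> = Some (xs n) \<and> xs n \<in> closure (U n)" for n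
        proof -
          have "hit U (Suc n) \<omega> < \<infinity>"
            using hN[of "Suc n"] by (metis ennreal_less_top infinity_ennreal_def order_le_less_trans)
          then obtain x where "X (hit U (Suc n) \<omega>) \<omega> = Some x" "x \<in> closure (U n)"
            by (rule X_hit[OF \<omega>]) (rule that)
          then show ?thesis by (simp add: xs_def del: hit.simps)
        qed
        have "xs \<longlonglongrightarrow> y"
        proof (rule topological_tendstoI)
          fix S assume "open S" "y \<in> S"
          then have "eventually (\<lambda>n. X (hit U n \<omega>) \<omega> \<in> Some ` S) sequentially"
            using y unfolding tends_to_point_iff by blast
          then have "eventually (\<lambda>n. X (hit U (Suc n) \<omega>) \<omega> \<in> Some ` S) sequentially"
            by (subst eventually_sequentially_Suc)
          then show "eventually (\<lambda>n. xs n \<in> S) sequentially"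
            by eventually_elim (use xs in auto)
        qed
        then show False using Ue[of xs y] xs by blast
      qed
      also have "(SUP n. hit U n \<omega>) \<le> ennreal N" using hN by (intro SUP_least)
      also have "ennreal N \<le> hit U (Suc n) \<omega> + ennreal N" by simp
      finally show "X (hit U (Suc n) \<omega> + ennreal N) \<omega> = None" by (rule cemetery[OF \<omega>])
    qed
  qed
  then have bound: "emeasure (P (Some z)) B \<le> ennreal (1 - c0) * emeasure (P (Some z)) (A (Suc n))" for n
  proof -
    have "{\<omega>\<in>A (Suc n). X (hit U (Suc n) \<omega> + ennreal N) \<omega> \<in> {None}} \<in> events"
    proof -
      have T: "hit U (Suc n) \<in> borel_measurable (P (Some z))"
        by (rule measurable_stopping_time[OF st]) (auto simp: space_F space_P sets_F_le_P)
      have "{\<omega>\<in>space (P (Some z)). lifetime X \<omega> \<le> hit U (Suc n) \<omega> + ennreal N} \<in> events"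
        using measurable_lifetime T by (intro borel_measurable_le borel_measurable_add) (auto simp del: hit.simps)
      moreover have "{\<omega>\<in>A (Suc n). X (hit U (Suc n) \<omega> + ennreal N) \<omega> \<in> {None}} =
         A (Suc n) \<inter> {\<omega>\<in>space (P (Some z)). lifetime X \<omega> \<le> hit U (Suc n) \<omega> + ennreal N}"
        using lifetime_le_iff by (auto simp: A_def space_P simp del: hit.simps)
      ultimately show ?thesis using A by simp
    qed
    then have "emeasure (P (Some z)) B \<le> emeasure (P (Some z)) {\<omega>\<in>A (Suc n). X (hit U (Suc n) \<omega> + ennreal N) \<omega> \<in> {None}}"
      using \<open>AE \<omega> in P (Some z). \<omega> \<in> B \<longrightarrow> (\<forall>n. X (hit U (Suc n) \<omega> + ennreal N) \<omega> = None)\<close>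
      by (intro emeasure_mono_AE) (auto simp: B_def)
    then show ?thesis using die[of n] by (rule order_trans)
  qed
  have lim: "(\<lambda>n. measure (P (Some z)) (A n)) \<longlonglongrightarrow> measure (P (Some z)) B"
    unfolding B_def using A dec by (intro finite_Lim_measure_decseq) auto
  have "measure (P (Some z)) B \<le> (1 - c0) * measure (P (Some z)) (A (Suc n))" for n
    using bound[of n] c0 by (simp add: emeasure_eq_measure flip: ennreal_mult)
  then have "measure (P (Some z)) B \<le> (1 - c0) * measure (P (Some z)) B"
    by (intro LIMSEQ_le_const[OF tendsto_mult_left[OF LIMSEQ_Suc[OF lim]]]) auto
  then have "c0 * measure (P (Some z)) B \<le> 0" by (simp add: algebra_simps)
  then have "measure (P (Some z)) B = 0" using c0 by (simp add: mult_le_0_iff measure_le_0_iff)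
  then show "emeasure (P (Some z)) {\<omega>\<in>\<Omega>. \<forall>n. hit U n \<omega> \<le> ennreal N} = 0"
    unfolding B_eq by (simp add: emeasure_eq_measure)
  show "{\<omega>\<in>\<Omega>. \<forall>n. hit U n \<omega> \<le> ennreal N} \<in> events" using B B_eq by simp
qed

lemma no_killing: "emeasure (J x) {None} = 0"
proof -
  obtain C where C: "C > 0" "\<And>x r. r > R * dfun b x powr \<upsilon> \<Longrightarrow>
      emeasure (J x) (UNIV - Some ` ball x r) \<le> ennreal (C / \<Phi> r)"
    using tail unfolding Tail_upper_def by blast
  have sJ: "sets (J x) = sets cemetery_borel" using levy unfolding has_levy_system_def by blast
  have "emeasure (J x) {None} \<le> ennreal e" if e: "e > 0" for e
  proof -
    obtain r0 where r0: "r0 > 0" "\<And>r. r \<ge> r0 \<Longrightarrow> \<Phi> r \<ge> C / e" by (rule \<Phi>_ge_large[of "C / e"]) (rule that)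
    define r where "r = max r0 (R * dfun b x powr \<upsilon> + 1)"
    have "UNIV - Some ` ball x r \<in> sets cemetery_borel"
      using sets.compl_sets[OF Some_image_cemetery[of "ball x r"]] by simp
    then have "emeasure (J x) {None} \<le> emeasure (J x) (UNIV - Some ` ball x r)"
      by (intro emeasure_mono) (auto simp: sJ)
    also have "\<dots> \<le> ennreal (C / \<Phi> r)" by (rule C(2)) (simp add: r_def)
    also have "\<dots> \<le> ennreal e"
    proof (rule ennreal_leI)
      have "C / e \<le> \<Phi> r" by (rule r0(2)) (simp add: r_def)
      moreover have "\<Phi> r > 0" using r0(1) by (intro \<Phi>_pos) (simp add: r_def)
      ultimately show "C / \<Phi> r \<le> e" using e by (simp add: field_simps)
    qed
    finally show ?thesis .
  qed
  then have "emeasure (J x) {None} \<le> 0 + ennreal e" if "e > 0" for e using that by simp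
  then have "emeasure (J x) {None} \<le> 0" by (rule ennreal_le_epsilon)
  then show ?thesis by simp
qed

lemma survives:
  assumes t: "t > (0 :: real)"
  shows "AE \<omega> in P (Some z). X (ennreal t) \<omega> \<noteq> None"
proof -
  obtain K :: "nat \<Rightarrow> 'a set" where K: "\<And>n. compact (K n)" "escaping (\<lambda>n. - K n)"
    by (rule escaping_complement_compact) (rule that)
  obtain D :: "'a set" where D: "countable D" "\<And>S. open S \<Longrightarrow> S \<noteq> {} \<Longrightarrow> \<exists>d\<in>D. d \<in> S"
    by (rule countable_dense_setE) (rule that)
  define UU where "UU = insert (\<lambda>n. - K n) {alternating q a a' | q a a'. q \<in> D \<and> a \<in> \<rat> \<and> a' \<in> \<rat> \<and> a < a'}"
  have "UU \<subseteq> insert (\<lambda>n. - K n) ((\<lambda>(q, a, a'). alternating q a a') ` (D \<times> \<rat> \<times> \<rat>))"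
    unfolding UU_def by force
  then have UU: "countable UU"
    by (rule countable_subset) (intro countable_insert countable_image countable_SIGMA D(1) countable_rat)
  have esc: "escaping U" if "U \<in> UU" for U
    using that K(2) escaping_alternating unfolding UU_def by blast
  define E where "E U k = {\<omega>\<in>\<Omega>. \<forall>n. hit U n \<omega> \<le> ennreal (real k)}" for U and k :: nat
  have E: "E U k \<in> null_sets (P (Some z))" if "U \<in> UU" for U k
    unfolding E_def using hit_unbounded[OF esc[OF that], of "real k" z] by (intro null_setsI) auto
  define NN where "NN = (\<Union>U\<in>UU. \<Union>k. E U k)"
  have NN: "NN \<in> null_sets (P (Some z))"
    unfolding NN_def using UU E by (intro null_sets_UN') auto
  define H :: "'a \<times> 'a option \<Rightarrow> ennreal" where "H p = indicator {None} (snd p)" for p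
  have H_meas: "H \<in> borel_measurable (borel \<Otimes>\<^sub>M cemetery_borel)"
    unfolding H_def by (intro measurable_compose[OF measurable_snd] borel_measurable_indicator None_cemetery)
  have H0: "\<forall>x. H (x, Some x) = 0" by (simp add: H_def)
  have HJ: "(\<integral>\<^sup>+y. H (x, y) \<partial>J x) = 0" for x
  proof -
    have "sets (J x) = sets cemetery_borel" using levy unfolding has_levy_system_def by blast
    then show ?thesis using None_cemetery no_killing[of x] by (simp add: H_def)
  qed
  have "(\<integral>\<^sup>+\<omega>. (\<Sum>\<^sub>\<infinity>s\<in>{0<..ennreal t}. extend0 (\<lambda>x. H (x, X s \<omega>)) (left_limit X s \<omega>)) \<partial>P (Some z)) =
          (\<integral>\<^sup>+\<omega>. (\<integral>\<^sup>+s\<in>{0..t}. extend0 (\<lambda>x. \<integral>\<^sup>+y. H (x, y) \<partial>J x) (X (ennreal s) \<omega>) \<partial>lborel)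
             \<partial>P (Some z))"
    using levy H_meas H0 t unfolding has_levy_system_def by blast
  also have "\<dots> = 0" unfolding HJ by (simp add: extend0_def option.case_eq_if)
  finally have levy0: "(\<integral>\<^sup>+\<omega>. (\<Sum>\<^sub>\<infinity>s\<in>{0<..ennreal t}. extend0 (\<lambda>x. H (x, X s \<omega>)) (left_limit X s \<omega>)) \<partial>P (Some z)) = 0" .
  define G where "G = ({\<omega>\<in>\<Omega>. X (ennreal t) \<omega> \<in> {None}} - NN) \<inter> {\<omega>\<in>\<Omega>. X 0 \<omega> \<in> Some ` UNIV}"
  have G: "G \<in> sets (P (Some z))"
    unfolding G_def using X_set_P[OF None_cemetery] NN X_set_P[OF Some_image_cemetery, of UNIV] by auto
  have big: "1 \<le> (\<Sum>\<^sub>\<infinity>s\<in>{0<..ennreal t}. extend0 (\<lambda>x. H (x, X s \<omega>)) (left_limit X s \<omega>))" if \<omega>G: "\<omega> \<in> G" for \<omega>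
  proof -
    have \<omega>: "\<omega> \<in> \<Omega>" "X (ennreal t) \<omega> = None" "\<omega> \<notin> NN" using \<omega>G by (auto simp: G_def)
    obtain x0 where x0: "X 0 \<omega> = Some x0" using \<omega>G by (auto simp: G_def)
    define \<zeta> where "\<zeta> = lifetime X \<omega>"
    have \<zeta>t: "\<zeta> \<le> ennreal t" using lifetime_le_iff[OF \<omega>(1)] \<omega>(2) by (simp add: \<zeta>_def)
    have \<zeta>None: "X \<zeta> \<omega> = None" using lifetime_le_iff[OF \<omega>(1), of \<zeta>] by (simp add: \<zeta>_def)
    have alive: "X s \<omega> \<noteq> None" if "s < \<zeta>" for s
      using lifetime_le_iff[OF \<omega>(1), of s] that by (auto simp: \<zeta>_def)
    have \<zeta>0: "0 < \<zeta>"
    proof (rule ccontr)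
      assume "\<not> 0 < \<zeta>"
      then have "\<zeta> = 0" by simp
      then show False using \<zeta>None x0 by simp
    qed
    have "\<exists>y. tends_to_point (\<lambda>s. X s \<omega>) y (at_left \<zeta>)"
    proof (rule ccontr)
      assume no: "\<nexists>y. tends_to_point (\<lambda>s. X s \<omega>) y (at_left \<zeta>)"
      have "\<exists>U\<in>UU. \<forall>n. \<forall>t<\<zeta>. \<exists>s. t < s \<and> s < \<zeta> \<and> X s \<omega> \<in> Some ` U n"
        unfolding UU_def by (rule no_left_limit_frequently[OF K(1) D(2) \<zeta>0 alive no])
      then obtain U where U: "U \<in> UU" "\<And>n t. t < \<zeta> \<Longrightarrow> \<exists>s. t < s \<and> s < \<zeta> \<and> X s \<omega> \<in> Some ` U n" by blast
      have "hit U n \<omega> < \<zeta>" for n by (rule hit_less_if_frequently[OF U(2) \<zeta>0])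
      moreover obtain k where "t \<le> real k" using real_arch_simple by blast
      then have "ennreal t \<le> ennreal (real k)" by (rule ennreal_leI)
      ultimately have "hit U n \<omega> \<le> ennreal (real k)" for n
        using \<zeta>t by (meson less_imp_le order_trans)
      then have "\<omega> \<in> NN" using U(1) \<omega>(1) unfolding NN_def E_def by blast
      then show False using \<omega>(3) by simp
    qed
    then obtain y where "left_limit X \<zeta> \<omega> = Some y" unfolding left_limit_def by auto
    then have "extend0 (\<lambda>x. H (x, X \<zeta> \<omega>)) (left_limit X \<zeta> \<omega>) = 1"
      by (simp add: extend0_def H_def \<zeta>None)
    moreover have "\<zeta> \<in> {0<..ennreal t}" using \<zeta>0 \<zeta>t by simp
    ultimately show ?thesis
      using infsum_ennreal_ge[of \<zeta> "{0<..ennreal t}" "\<lambda>s. extend0 (\<lambda>x. H (x, X s \<omega>)) (left_limit X s \<omega>)"] by simp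
  qed
  have "emeasure (P (Some z)) G = (\<integral>\<^sup>+\<omega>. indicator G \<omega> \<partial>P (Some z))" using G by simp
  also have "\<dots> \<le> (\<integral>\<^sup>+\<omega>. (\<Sum>\<^sub>\<infinity>s\<in>{0<..ennreal t}. extend0 (\<lambda>x. H (x, X s \<omega>)) (left_limit X s \<omega>)) \<partial>P (Some z))"
    using big by (intro nn_integral_mono) (auto simp: indicator_def)
  finally have "G \<in> null_sets (P (Some z))" using levy0 G by auto
  from AE_not_in[OF this] AE_not_in[OF NN] normal[of "Some z"] AE_space
  show ?thesis
  proof eventually_elim
    case (elim \<omega>)
    then show ?case by (auto simp: G_def space_P)
  qed
qed

lemma conservative: "AE \<omega> in P (Some z). \<forall>t<\<infinity>. X t \<omega> \<noteq> None"
proof -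
  have "AE \<omega> in P (Some z). \<forall>n. X (ennreal (real (Suc n))) \<omega> \<noteq> None"
    unfolding AE_all_countable by (intro allI survives) simp
  then show ?thesis using AE_space
  proof eventually_elim
    case (elim \<omega>)
    have \<omega>: "\<omega> \<in> \<Omega>" using elim by (simp add: space_P)
    show ?case
    proof (intro allI impI)
      fix t :: ennreal assume "t < \<infinity>"
      then obtain n where "t < of_nat n" using ennreal_Ex_less_of_nat[of t] by auto
      then have "t \<le> ennreal (real (Suc n))" by (simp add: ennreal_of_nat_eq_real_of_nat less_imp_le order.strict_trans2)
      then show "X t \<omega> \<noteq> None" using rc_paths_NoneD[OF path_rc[OF \<omega>], of t] elim by blast
    qed
  qed
qed

section \<open>Zero-one law\<close>

definition invariant :: "(ennreal \<Rightarrow> 'a option) set \<Rightarrow> bool" where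
  "invariant E \<longleftrightarrow> E \<in> sets path_space \<and>
    (\<forall>w\<in>rc_paths. \<forall>t<\<infinity>. path_shift t w \<in> E \<longleftrightarrow> w \<in> E)"

definition harm :: "(ennreal \<Rightarrow> 'a option) set \<Rightarrow> 'a \<Rightarrow> real" where
  "harm E y = measure (P (Some y)) {\<omega>\<in>\<Omega>. path \<omega> \<in> E}"

lemma emeasure_harm: "emeasure (P (Some y)) {\<omega>\<in>\<Omega>. path \<omega> \<in> E} = ennreal (harm E y)"
  unfolding harm_def by (rule finite_measure.emeasure_eq_measure[OF prob_space.finite_measure[OF prob]])

lemma harm_nonneg: "0 \<le> harm E y" by (simp add: harm_def)

lemma harm_le_1: "harm E y \<le> 1"
  unfolding harm_def by (rule prob_space.prob_le_1[OF prob])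

lemma harm_measurable:
  assumes "E \<in> sets path_space" shows "harm E \<in> borel_measurable borel"
proof -
  have "(\<lambda>y. enn2real (emeasure (P (Some y)) {\<omega>\<in>\<Omega>. path \<omega> \<in> E})) \<in> borel_measurable borel"
    using measurable_compose[OF measurable_Some_cemetery measurable_path_law[OF assms]] by measurable
  then show ?thesis by (simp add: emeasure_harm harm_nonneg)
qed

lemma invariant_Markov:
  assumes E: "invariant E" and A: "A \<in> sets (F (ennreal t))"
  shows "emeasure (P (Some z)) {\<omega>\<in>A. path \<omega> \<in> E} =
     (\<integral>\<^sup>+\<omega>\<in>A. ennreal (harm E (the (X (ennreal t) \<omega>))) \<partial>P (Some z))"
proof -
  have A\<Omega>: "A \<subseteq> \<Omega>" using sets.sets_into_space[OF A] by (simp add: space_F)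
  have "path_shift (ennreal t) (path \<omega>) \<in> E \<longleftrightarrow> path \<omega> \<in> E" if "\<omega> \<in> A" for \<omega>
    using E path_rc[of \<omega>] that A\<Omega> unfolding invariant_def by auto
  then have "{\<omega>\<in>A. path \<omega> \<in> E} = {\<omega>\<in>A. path_shift (ennreal t) (path \<omega>) \<in> E}" by blast
  also have "emeasure (P (Some z)) \<dots> =
      (\<integral>\<^sup>+\<omega>\<in>A. emeasure (P (X (ennreal t) \<omega>)) {\<omega>'\<in>\<Omega>. path \<omega>' \<in> E} \<partial>P (Some z))"
    using E A by (intro Markov) (auto simp: invariant_def)
  also have "\<dots> = (\<integral>\<^sup>+\<omega>\<in>A. ennreal (harm E (the (X (ennreal t) \<omega>))) \<partial>P (Some z))"
  proof (rule nn_integral_cong_AE)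
    show "AE \<omega> in P (Some z). emeasure (P (X (ennreal t) \<omega>)) {\<omega>'\<in>\<Omega>. path \<omega>' \<in> E} * indicator A \<omega> =
       ennreal (harm E (the (X (ennreal t) \<omega>))) * indicator A \<omega>"
      using conservative
    proof eventually_elim
      case (elim \<omega>)
      then have "X (ennreal t) \<omega> \<noteq> None" using ennreal_less_top[of t] by simp
      then obtain y where "X (ennreal t) \<omega> = Some y" by blast
      then show ?case by (simp add: emeasure_harm)
    qed
  qed
  finally show ?thesis .
qed

lemma invariant_compl: "invariant E \<Longrightarrow> invariant (rc_paths - E)"
  unfolding invariant_def using sets.compl_sets[of E path_space] path_shift_rc_paths
  by (auto simp: space_path_space)

lemma harm_compl:
  assumes "E \<in> sets path_space" shows "harm (rc_paths - E) y = 1 - harm E y"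
proof -
  interpret prob_space "P (Some y)" by (rule prob)
  have "{\<omega>\<in>\<Omega>. path \<omega> \<in> rc_paths - E} = space (P (Some y)) - {\<omega>\<in>\<Omega>. path \<omega> \<in> E}"
    using path_rc by (auto simp: space_P)
  then show ?thesis unfolding harm_def using prob_compl[OF path_event_P[OF assms]] by simp
qed

lemma harm_lower:
  assumes E: "invariant E" and "\<And>x. i \<le> harm E x" "0 \<le> i" "i \<le> m"
    and c0: "0 \<le> c0" "c0 * v r \<le> c * v (\<eta>\<^sup>2 * r)"
    and r: "\<eta>\<^sup>2 * r > R" and y: "y \<in> ball b (\<eta>\<^sup>2 * r)"
    and half: "v (\<eta>\<^sup>2 * r) \<le> 2 * measure \<mu> {x\<in>ball b (\<eta>\<^sup>2 * r). m \<le> harm E x}"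
  shows "i + (m - i) * (c0 / 2) \<le> harm E y"
proof -
  interpret prob_space "P (Some y)" by (rule prob)
  let ?A = "{x\<in>ball b (\<eta>\<^sup>2 * r). m \<le> harm E x}"
  let ?t = "ennreal (\<Phi> (\<eta> * r))"
  let ?S = "{\<omega>\<in>\<Omega>. X ?t \<omega> \<in> Some ` ?A}"
  have \<eta>2: "0 < \<eta>\<^sup>2" "\<eta>\<^sup>2 \<le> 1" using \<eta> by (auto simp: power_le_one)
  have r0: "r > 0" using r R_ge_1 \<eta>2 by (smt (verit) zero_less_mult_pos)
  then have "\<eta>\<^sup>2 * r \<le> 1 * r" using \<eta>2 by (intro mult_right_mono) auto
  then have rR: "r > R" using r by simp
  have [measurable]: "harm E \<in> borel_measurable borel"
    using E by (intro harm_measurable) (simp add: invariant_def)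
  have "?A = ball b (\<eta>\<^sup>2 * r) \<inter> {x\<in>space borel. m \<le> harm E x}" by auto
  moreover have "{x\<in>space borel. m \<le> harm E x} \<in> sets borel" by measurable
  ultimately have A: "?A \<in> sets borel" by auto
  have S: "?S \<in> events" using X_set_P[OF Some_image_cemetery[OF A]] .
  have "c0 / 2 \<le> c * measure \<mu> ?A / v r"
  proof -
    have "c0 * v r \<le> c * (2 * measure \<mu> ?A)"
      using c0(2) mult_left_mono[OF half, of c] c_pos by linarith
    then show ?thesis using vol_center(2)[OF rR] by (simp add: field_simps)
  qed
  then have "ennreal (c0 / 2) \<le> ennreal (c * measure \<mu> ?A / v r)" by (rule ennreal_leI)
  also have "\<dots> \<le> emeasure (P (Some y)) ?S" by (rule ndl_hit[OF rR y A]) auto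
  finally have pS: "c0 / 2 \<le> prob ?S" by (simp add: emeasure_eq_measure)
  have "ennreal i + ennreal (m - i) * emeasure (P (Some y)) ?S =
      (\<integral>\<^sup>+\<omega>. ennreal i + ennreal (m - i) * indicator ?S \<omega> \<partial>P (Some y))"
    using S by (simp add: nn_integral_add nn_integral_cmult_indicator emeasure_space_1)
  also have "\<dots> \<le> (\<integral>\<^sup>+\<omega>\<in>\<Omega>. ennreal (harm E (the (X ?t \<omega>))) \<partial>P (Some y))"
  proof (rule nn_integral_mono)
    fix \<omega> assume "\<omega> \<in> space (P (Some y))"
    then have \<omega>: "\<omega> \<in> \<Omega>" by (simp add: space_P)
    show "ennreal i + ennreal (m - i) * indicator ?S \<omega> \<le> ennreal (harm E (the (X ?t \<omega>))) * indicator \<Omega> \<omega>"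
    proof (cases "\<omega> \<in> ?S")
      case True
      then have "m \<le> harm E (the (X ?t \<omega>))" by auto
      moreover have "ennreal i + ennreal (m - i) = ennreal m" using assms by (simp flip: ennreal_plus)
      ultimately show ?thesis using True \<omega> by (simp add: ennreal_leI)
    next
      case False
      then show ?thesis using \<omega> assms(2) by (simp add: ennreal_leI)
    qed
  qed
  also have "\<dots> = emeasure (P (Some y)) {\<omega>\<in>\<Omega>. path \<omega> \<in> E}"
    using invariant_Markov[OF E, of \<Omega> "\<Phi> (\<eta> * r)" y] sets.top[of "F ?t"] by (simp add: space_F)
  also have "\<dots> = ennreal (harm E y)" by (rule emeasure_harm)
  finally have "ennreal (i + (m - i) * prob ?S) \<le> ennreal (harm E y)"
    using assms by (simp add: emeasure_eq_measure ennreal_plus ennreal_mult)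
  then have "i + (m - i) * prob ?S \<le> harm E y" using harm_nonneg by (simp add: ennreal_le_iff)
  moreover have "(m - i) * (c0 / 2) \<le> (m - i) * prob ?S" using pS assms by (intro mult_left_mono) auto
  ultimately show ?thesis by linarith
qed

text \<open>Doeblin's argument: started from any two points of a large ball, the process charges the
  larger half of the ball with a probability bounded below uniformly in the radius, so the oscillation
  of an invariant function over the whole space is smaller than itself.\<close>

lemma harm_constant:
  assumes E: "invariant E"
  shows "harm E x = harm E x'"
proof -
  have Es: "E \<in> sets path_space" using E by (simp add: invariant_def)
  define i where "i = (INF x. harm E x)"
  define s where "s = (SUP x. harm E x)"
  have bdd: "bdd_below (range (harm E))" "bdd_above (range (harm E))"
    using harm_nonneg harm_le_1 by (auto intro!: bdd_belowI[of _ 0] bdd_aboveI[of _ 1])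
  have i: "i \<le> harm E x" and s: "harm E x \<le> s" for x
    unfolding i_def s_def by (auto intro: cINF_lower cSUP_upper bdd)
  have i0: "0 \<le> i" unfolding i_def by (rule cINF_greatest) (auto simp: harm_nonneg)
  have s1: "s \<le> 1" unfolding s_def by (rule cSUP_least) (auto simp: harm_le_1)
  have "s \<le> i"
  proof (rule ccontr)
    assume "\<not> s \<le> i"
    then have si: "i < s" by simp
    obtain c0 where c0: "c0 > 0" "c0 \<le> 1" "\<And>r. \<eta>\<^sup>2 * r > R \<Longrightarrow> c0 * v r \<le> c * v (\<eta>\<^sup>2 * r)"
      by (rule ndl_uniform) (rule that)
    define \<epsilon> where "\<epsilon> = (s - i) * c0 / 4"
    have \<epsilon>: "\<epsilon> > 0" using si c0 by (simp add: \<epsilon>_def)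
    obtain y where y: "harm E y < i + \<epsilon>"
    proof -
      have "(INF x. harm E x) < i + \<epsilon>" using \<epsilon> by (simp add: i_def)
      then show ?thesis using cINF_less_iff[OF _ bdd(1), of "i + \<epsilon>"] that by auto
    qed
    obtain y' where y': "s - \<epsilon> < harm E y'"
    proof -
      have "s - \<epsilon> < (SUP x. harm E x)" using \<epsilon> by (simp add: s_def)
      then show ?thesis using less_cSUP_iff[OF _ bdd(2), of "s - \<epsilon>"] that by auto
    qed
    define r where "r = (max R (max (dist b y) (dist b y')) + 1) / \<eta>\<^sup>2"
    have \<eta>2: "\<eta>\<^sup>2 * r = max R (max (dist b y) (dist b y')) + 1" using \<eta> by (simp add: r_def)
    have r: "\<eta>\<^sup>2 * r > R" "y \<in> ball b (\<eta>\<^sup>2 * r)" "y' \<in> ball b (\<eta>\<^sup>2 * r)" unfolding \<eta>2 by auto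
    define m where "m = (i + s) / 2"
    let ?B = "ball b (\<eta>\<^sup>2 * r)"
    let ?A = "{x\<in>?B. m \<le> harm E x}" and ?A' = "{x\<in>?B. 1 - m \<le> harm (rc_paths - E) x}"
    have [measurable]: "harm E \<in> borel_measurable borel" by (rule harm_measurable[OF Es])
    have A: "?A \<in> sets \<mu>" "?A' \<in> sets \<mu>"
    proof -
      have "?A = ?B \<inter> {x\<in>space borel. m \<le> harm E x}" "?A' = ?B \<inter> {x\<in>space borel. harm E x \<le> m}"
        by (auto simp: harm_compl[OF Es])
      moreover have "{x\<in>space borel. m \<le> harm E x} \<in> sets borel" "{x\<in>space borel. harm E x \<le> m} \<in> sets borel"
        by measurable
      ultimately show "?A \<in> sets \<mu>" "?A' \<in> sets \<mu>" by (auto simp: sets_\<mu>)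
    qed
    have "?B \<in> fmeasurable \<mu>"
      using vol_center(1)[OF r(1)] by (intro fmeasurableI) (auto simp: vol_def sets_\<mu>)
    then have fm: "?A \<in> fmeasurable \<mu>" "?A' \<in> fmeasurable \<mu>"
      using A by (auto intro: fmeasurableI2)
    have "v (\<eta>\<^sup>2 * r) \<le> measure \<mu> (?A \<union> ?A')"
      unfolding v_def using fm by (intro measure_mono_fmeasurable) (auto simp: harm_compl[OF Es] sets_\<mu>)
    also have "\<dots> \<le> measure \<mu> ?A + measure \<mu> ?A'" using fm by (intro measure_Un_le) auto
    finally consider "v (\<eta>\<^sup>2 * r) \<le> 2 * measure \<mu> ?A" | "v (\<eta>\<^sup>2 * r) \<le> 2 * measure \<mu> ?A'" by linarith
    then show False
    proof cases
      case 1
      have "i + (m - i) * (c0 / 2) \<le> harm E y"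
        by (rule harm_lower[OF E i i0 _ _ c0(3)[OF r(1)] r(1,2) 1]) (use si c0 in \<open>auto simp: m_def\<close>)
      moreover have "(m - i) * (c0 / 2) = \<epsilon>" by (simp add: m_def \<epsilon>_def field_simps)
      ultimately show False using y by simp
    next
      case 2
      have "(1 - s) + ((1 - m) - (1 - s)) * (c0 / 2) \<le> harm (rc_paths - E) y'"
        by (rule harm_lower[OF invariant_compl[OF E] _ _ _ _ c0(3)[OF r(1)] r(1,3) 2])
           (use si c0 s s1 in \<open>auto simp: m_def harm_compl[OF Es]\<close>)
      moreover have "((1 - m) - (1 - s)) * (c0 / 2) = \<epsilon>" by (simp add: m_def \<epsilon>_def field_simps)
      ultimately show False using y' by (simp add: harm_compl[OF Es])
    qed
  qed
  then show ?thesis using i s by (metis dual_order.trans order_antisym)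
qed

lemma zero_one_law:
  assumes E: "invariant E"
  obtains "\<And>z. AE \<omega> in P (Some z). path \<omega> \<in> E" | "\<And>z. AE \<omega> in P (Some z). path \<omega> \<notin> E"
proof -
  have Es: "E \<in> sets path_space" using E by (simp add: invariant_def)
  define p where "p = harm E b"
  have p: "harm E z = p" for z unfolding p_def by (rule harm_constant[OF E])
  let ?Q = "P (Some b)"
  interpret prob_space ?Q by (rule prob)
  let ?E = "{\<omega>\<in>\<Omega>. path \<omega> \<in> E}"
  have EP: "?E \<in> events" by (rule path_event_P[OF Es])
  define CC where "CC = (\<Union>t\<in>{..<\<infinity>}. sets (F t))"
  have CC_sub: "CC \<subseteq> Pow \<Omega>" using sets.space_closed[of "F _"] by (auto simp: CC_def space_F)
  have CC_P: "CC \<subseteq> events" using sets_F_le_P by (auto simp: CC_def)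
  have "Int_stable CC"
  proof (rule Int_stableI)
    fix A B assume "A \<in> CC" "B \<in> CC"
    then obtain s t where st: "s < \<infinity>" "t < \<infinity>" "A \<in> sets (F s)" "B \<in> sets (F t)" by (auto simp: CC_def)
    have "A \<in> sets (F (max s t))" by (rule subsetD[OF sets_F_mono st(3)]) simp
    moreover have "B \<in> sets (F (max s t))" by (rule subsetD[OF sets_F_mono st(4)]) simp
    ultimately show "A \<inter> B \<in> CC" using st unfolding CC_def by (intro UN_I[of "max s t"]) auto
  qed
  have sub: "sigma_sets \<Omega> CC \<subseteq> events"
    using sets.sigma_sets_subset[of CC ?Q] CC_P by (simp add: space_P)
  have indep: "emeasure ?Q (A \<inter> ?E) = ennreal p * emeasure ?Q A" if "A \<in> sigma_sets \<Omega> CC" for A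
    using \<open>Int_stable CC\<close> CC_sub that
  proof (induction rule: sigma_sets_induct_disjoint)
    case (basic A)
    then obtain t where t: "t < \<infinity>" "A \<in> sets (F t)" by (auto simp: CC_def)
    then have et: "ennreal (enn2real t) = t" by (simp add: less_top)
    have A\<Omega>: "A \<subseteq> \<Omega>" using basic CC_sub by blast
    have "A \<inter> ?E = {\<omega>\<in>A. path \<omega> \<in> E}" using A\<Omega> by auto
    moreover have "A \<in> sets (F (ennreal (enn2real t)))" using t et by simp
    ultimately have "emeasure ?Q (A \<inter> ?E) = (\<integral>\<^sup>+\<omega>. ennreal p * indicator A \<omega> \<partial>?Q)"
      using invariant_Markov[OF E, of A "enn2real t" b] by (simp add: p)
    also have "\<dots> = ennreal p * emeasure ?Q A" using basic CC_P by (intro nn_integral_cmult_indicator) blast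
    finally show ?case .
  next
    case empty
    then show ?case by simp
  next
    case (compl A)
    then have A: "A \<in> events" using sub by blast
    have "emeasure ?Q ((\<Omega> - A) \<inter> ?E) = emeasure ?Q (?E - A \<inter> ?E)"
      by (rule arg_cong[where f="emeasure ?Q"]) auto
    also have "\<dots> = emeasure ?Q ?E - emeasure ?Q (A \<inter> ?E)"
      using A EP by (intro emeasure_Diff) auto
    also have "\<dots> = ennreal p * 1 - ennreal p * emeasure ?Q A"
      using compl by (simp add: emeasure_harm p)
    also have "\<dots> = ennreal p * (1 - emeasure ?Q A)"
      by (rule ennreal_right_diff_distrib[symmetric]) simp
    also have "1 - emeasure ?Q A = emeasure ?Q (space ?Q - A)"
      using A by (subst emeasure_compl) (auto simp: emeasure_space_1)
    finally show ?case by (simp add: space_P)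
  next
    case (union A)
    then have A: "range A \<subseteq> events" using sub by blast
    have "emeasure ?Q ((\<Union>i. A i) \<inter> ?E) = emeasure ?Q (\<Union>i. A i \<inter> ?E)"
      by (rule arg_cong[where f="emeasure ?Q"]) auto
    also have "\<dots> = (\<Sum>i. emeasure ?Q (A i \<inter> ?E))"
      using A EP union(1) by (intro suminf_emeasure[symmetric]) (auto simp: disjoint_family_on_def)
    also have "\<dots> = (\<Sum>i. ennreal p * emeasure ?Q (A i))" using union by simp
    also have "\<dots> = ennreal p * emeasure ?Q (\<Union>i. A i)"
      using suminf_emeasure[OF A union(1)] by simp
    finally show ?case .
  qed
  have "path \<in> sigma \<Omega> CC \<rightarrow>\<^sub>M path_space"
  proof (rule measurable_path_spaceI)
    have sp: "space (sigma \<Omega> CC) = \<Omega>" using CC_sub by (simp add: space_measure_of)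
    show "path \<omega> \<in> rc_paths" if "\<omega> \<in> space (sigma \<Omega> CC)" for \<omega> using that path_rc by (simp add: sp)
    show "X t \<in> sigma \<Omega> CC \<rightarrow>\<^sub>M cemetery_borel" for t
    proof (cases "t < \<infinity>")
      case True
      then have "sets (F t) \<subseteq> sets (sigma \<Omega> CC)" using CC_sub by (auto simp: CC_def)
      then show ?thesis using sp by (rule measurable_X)
    next
      case False
      then have "t = \<infinity>" by (metis infinity_ennreal_def less_top)
      then have "X t \<omega> = None" if "\<omega> \<in> space (sigma \<Omega> CC)" for \<omega> using infinity that sp by simp
      then show ?thesis by (subst measurable_cong[where g="\<lambda>_. None"]) auto
    qed
  qed
  from measurable_sets[OF this Es] have "?E \<in> sigma_sets \<Omega> CC"
    using CC_sub by (simp add: space_measure_of vimage_def Int_def conj_commute)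
  from indep[OF this] have "ennreal p = ennreal p * ennreal p" by (simp add: emeasure_harm p)
  then have "p = p * p" using harm_nonneg[of E b] by (simp add: p_def flip: ennreal_mult)
  then consider "p = 1" | "p = 0" by auto
  then show thesis
  proof cases
    case 1
    have "AE \<omega> in P (Some z). path \<omega> \<in> E" for z
    proof -
      have "AE \<omega> in P (Some z). \<omega> \<in> {\<omega>\<in>\<Omega>. path \<omega> \<in> E}"
        using p[of z] 1 unfolding harm_def by (intro prob_space.AE_prob_1[OF prob]) simp
      then show ?thesis by eventually_elim simp
    qed
    then show ?thesis by (rule that(1))
  next
    case 2
    have "AE \<omega> in P (Some z). path \<omega> \<notin> E" for z
    proof -
      have "{\<omega>\<in>\<Omega>. path \<omega> \<in> E} \<in> null_sets (P (Some z))"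
        using emeasure_harm[of z E] p[of z] 2 path_event_P[OF Es] by (intro null_setsI) auto
      from AE_not_in[OF this] AE_space show ?thesis by eventually_elim (simp add: space_P)
    qed
    then show ?thesis by (rule that(2))
  qed
qed

lemma invariant_function_constant:
  fixes L :: "(ennreal \<Rightarrow> 'a option) \<Rightarrow> ereal"
  assumes L: "L \<in> borel_measurable path_space"
    and inv: "\<And>w t. w \<in> rc_paths \<Longrightarrow> t < \<infinity> \<Longrightarrow> L (path_shift t w) = L w"
    and b01: "\<And>w. w \<in> rc_paths \<Longrightarrow> 0 \<le> L w \<and> L w \<le> 1"
  obtains l where "0 \<le> l" "l \<le> 1" "\<And>z. AE \<omega> in P (Some z). L (path \<omega>) = ereal l"
proof -
  define E where "E a = {w\<in>space path_space. L w \<le> ereal a}" for a :: real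
  have E: "invariant (E a)" for a
    unfolding invariant_def
  proof (intro conjI ballI allI impI)
    show "E a \<in> sets path_space" unfolding E_def using L by measurable
    show "path_shift t w \<in> E a \<longleftrightarrow> w \<in> E a" if "w \<in> rc_paths" "t < \<infinity>" for w t
      using inv[OF that] path_shift_rc_paths[OF that(1), of t] that(1) by (simp add: E_def space_path_space)
  qed
  define S where "S = {a. \<forall>z. AE \<omega> in P (Some z). path \<omega> \<in> E a}"
  have nS: "AE \<omega> in P (Some z). path \<omega> \<notin> E a" if "a \<notin> S" for a z
    using that by (cases rule: zero_one_law[OF E[of a]]) (auto simp: S_def)
  have upS: "a' \<in> S" if "a \<in> S" "a \<le> a'" for a a'
  proof -
    have sub: "E a \<subseteq> E a'" using that(2) by (auto simp: E_def intro: order_trans)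
    have "AE \<omega> in P (Some z). path \<omega> \<in> E a'" for z
    proof -
      have "AE \<omega> in P (Some z). path \<omega> \<in> E a" using that(1) by (simp add: S_def)
      then show ?thesis by eventually_elim (use sub in blast)
    qed
    then show ?thesis by (simp add: S_def)
  qed
  have oneS: "1 \<in> S"
    unfolding S_def
  proof (intro CollectI allI)
    show "AE \<omega> in P (Some z). path \<omega> \<in> E 1" for z
      using AE_space by eventually_elim (use b01 path_rc in \<open>simp add: E_def space_path_space space_P one_ereal_def\<close>)
  qed
  have nonneg: "0 \<le> a" if "a \<in> S" for a
  proof (rule ccontr)
    assume "\<not> 0 \<le> a"
    interpret prob_space "P (Some b)" by (rule prob)
    have "AE \<omega> in P (Some b). path \<omega> \<in> E a" using that by (simp add: S_def)
    then have "AE \<omega> in P (Some b). False"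
    proof eventually_elim
      case (elim \<omega>)
      then have w: "path \<omega> \<in> rc_paths" "L (path \<omega>) \<le> ereal a" by (auto simp: E_def space_path_space)
      have "0 \<le> ereal a" using b01[OF w(1)] w(2) by (meson order_trans)
      then show ?case using \<open>\<not> 0 \<le> a\<close> by simp
    qed
    then show False by simp
  qed
  define l where "l = Inf S"
  have bddS: "bdd_below S" using nonneg by (rule bdd_belowI)
  have "0 \<le> l" unfolding l_def using oneS nonneg by (intro cInf_greatest) auto
  moreover have "l \<le> 1" unfolding l_def using oneS bddS by (rule cInf_lower)
  moreover have "AE \<omega> in P (Some z). L (path \<omega>) = ereal l" for z
  proof -
    have "AE \<omega> in P (Some z). path \<omega> \<in> E (l + 1 / real (Suc n))" for n
    proof -
      have "l < l + 1 / real (Suc n)" by simp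
      then obtain a where "a \<in> S" "a < l + 1 / real (Suc n)"
        unfolding l_def using oneS bddS by (metis cInf_less_iff empty_iff)
      then show ?thesis using upS[of a "l + 1 / real (Suc n)"] by (auto simp: S_def)
    qed
    then have up: "AE \<omega> in P (Some z). \<forall>n. path \<omega> \<in> E (l + 1 / real (Suc n))"
      unfolding AE_all_countable by blast
    have "AE \<omega> in P (Some z). path \<omega> \<notin> E (l - 1 / real (Suc n))" for n
    proof (rule nS)
      show "l - 1 / real (Suc n) \<notin> S"
      proof
        assume "l - 1 / real (Suc n) \<in> S"
        then have "l \<le> l - 1 / real (Suc n)" unfolding l_def using bddS by (intro cInf_lower)
        then show False by (simp add: divide_le_0_iff)
      qed
    qed
    then have lo: "AE \<omega> in P (Some z). \<forall>n. path \<omega> \<notin> E (l - 1 / real (Suc n))"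
      unfolding AE_all_countable by blast
    show ?thesis
      using up lo AE_space
    proof eventually_elim
      case (elim \<omega>)
      have w: "path \<omega> \<in> rc_paths" using elim path_rc by (simp add: space_P)
      then obtain x where x: "L (path \<omega>) = ereal x" using b01[OF w] by (cases "L (path \<omega>)") auto
      have *: "x \<le> l + 1 / real (Suc n)" "l - 1 / real (Suc n) < x" for n
        using elim w by (auto simp: E_def space_path_space x not_le)
      have "x \<le> l"
      proof (rule field_le_epsilon)
        fix e :: real assume "e > 0"
        then obtain n where "1 / real (Suc n) < e" using nat_approx_posE by blast
        then show "x \<le> l + e" using *(1)[of n] by linarith
      qed
      moreover have "l \<le> x"
      proof (rule field_le_epsilon)
        fix e :: real assume "e > 0"
        then obtain n where "1 / real (Suc n) < e" using nat_approx_posE by blast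
        then show "l \<le> x + e" using *(2)[of n] by linarith
      qed
      ultimately show ?case using x by simp
    qed
  qed
  ultimately show thesis using that by blast
qed

end

section \<open>The upper occupation density\<close>

lemma Limsup_compare:
  fixes u :: "'i \<Rightarrow> real" and v :: "'j \<Rightarrow> real"
  assumes g: "filterlim g G F"
    and le: "\<And>\<epsilon>. \<epsilon> > 0 \<Longrightarrow> eventually (\<lambda>i. u i \<le> (1 + \<epsilon>) * v (g i)) F"
    and v1: "eventually (\<lambda>j. v j \<le> 1) G"
  shows "Limsup F (\<lambda>i. ereal (u i)) \<le> Limsup G (\<lambda>j. ereal (v j))"
  unfolding Limsup_le_iff
proof (intro allI impI)
  fix y assume "Limsup G (\<lambda>j. ereal (v j)) < y"
  then obtain a where a: "Limsup G (\<lambda>j. ereal (v j)) < ereal a" "ereal a < y"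
    using ereal_dense2 by blast
  obtain a' where a': "ereal a < ereal a'" "ereal a' < y" using a(2) ereal_dense2 by blast
  define \<epsilon> where "\<epsilon> = a' - a"
  have \<epsilon>: "\<epsilon> > 0" using a' by (simp add: \<epsilon>_def)
  have "eventually (\<lambda>j. v j < a \<and> v j \<le> 1) G"
    using Limsup_lessD[OF a(1)] v1 by eventually_elim simp
  then have "eventually (\<lambda>i. v (g i) < a \<and> v (g i) \<le> 1) F"
    using g unfolding filterlim_iff by blast
  then show "eventually (\<lambda>i. ereal (u i) < y) F"
    using le[OF \<epsilon>]
  proof eventually_elim
    case (elim i)
    have "\<epsilon> * v (g i) \<le> \<epsilon> * 1" using elim \<epsilon> by (intro mult_left_mono) auto
    then have "u i < a + \<epsilon>" using elim by (simp add: algebra_simps)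
    then have "ereal (u i) < ereal a'" by (simp add: \<epsilon>_def)
    then show ?case using a'(2) by (rule less_trans)
  qed
qed

context occupation_setting
begin

definition fraction :: "'a \<Rightarrow> real \<Rightarrow> (ennreal \<Rightarrow> 'a option) \<Rightarrow> real \<Rightarrow> real" where
  "fraction x \<kappa> w r = sojourn (ball x r) (\<kappa> * tscale r) w / (\<kappa> * tscale r)"

definition upper_fraction :: "real \<Rightarrow> (ennreal \<Rightarrow> 'a option) \<Rightarrow> ereal" where
  "upper_fraction \<kappa> w = limsup (\<lambda>n. ereal (fraction b \<kappa> w (real n)))"

lemma fraction_bounds:
  assumes "w \<in> rc_paths" "\<kappa> > 0" "r \<ge> r_init"
  shows "0 \<le> fraction x \<kappa> w r" "fraction x \<kappa> w r \<le> 1"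
proof -
  have p: "\<kappa> * tscale r > 0" using assms tscale_pos by simp
  show "0 \<le> fraction x \<kappa> w r" unfolding fraction_def using p sojourn_nonneg by (intro divide_nonneg_pos)
  show "fraction x \<kappa> w r \<le> 1"
    using p sojourn_le[OF assms(1) open_ball, of "\<kappa> * tscale r" x r] by (simp add: fraction_def)
qed

lemma fraction_compare:
  assumes w: "w \<in> rc_paths" and \<kappa>: "\<kappa> > 0" and r: "r_init \<le> r" "r + dist x x' \<le> r'"
    and T: "tscale r' \<le> (1 + \<epsilon>) * tscale r"
  shows "fraction x \<kappa> w r \<le> (1 + \<epsilon>) * fraction x' \<kappa> w r'"
proof -
  have rr: "r \<le> r'" using r by (smt (verit) zero_le_dist)
  have p: "tscale r > 0" "tscale r' > 0" using tscale_pos r(1) rr by auto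
  have sub: "ball x r \<subseteq> ball x' r'"
  proof
    fix y assume "y \<in> ball x r"
    then show "y \<in> ball x' r'" using r(2) dist_triangle[of x' y x] by (simp add: dist_commute)
  qed
  have "sojourn (ball x r) (\<kappa> * tscale r) w \<le> sojourn (ball x' r') (\<kappa> * tscale r') w"
    using sub \<kappa> tscale_mono[OF r(1) rr] by (intro sojourn_mono w) auto
  also have "\<dots> = fraction x' \<kappa> w r' * (\<kappa> * tscale r')" using p \<kappa> by (simp add: fraction_def)
  also have "\<dots> \<le> fraction x' \<kappa> w r' * (\<kappa> * ((1 + \<epsilon>) * tscale r))"
    using T \<kappa> fraction_bounds(1)[OF w \<kappa>, of r' x'] r rr by (intro mult_left_mono) auto
  finally have "sojourn (ball x r) (\<kappa> * tscale r) w \<le> ((1 + \<epsilon>) * fraction x' \<kappa> w r') * (\<kappa> * tscale r)"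
    by (simp add: algebra_simps)
  then show ?thesis unfolding fraction_def[of x] using p \<kappa> by (simp add: pos_divide_le_eq)
qed

text \<open>Since the time scale is asymptotically invariant under bounded shifts of the radius, neither
  the centre of the balls nor the restriction to integer radii matters.\<close>

lemma Limsup_fraction:
  assumes w: "w \<in> rc_paths" and \<kappa>: "\<kappa> > 0"
  shows "Limsup at_top (\<lambda>r. ereal (fraction x \<kappa> w r)) = upper_fraction \<kappa> w"
proof (rule antisym)
  define d where "d = dist x b"
  show "Limsup at_top (\<lambda>r. ereal (fraction x \<kappa> w r)) \<le> upper_fraction \<kappa> w"
    unfolding upper_fraction_def
  proof (rule Limsup_compare[where g="\<lambda>r. nat \<lceil>r + d\<rceil>"])
    show "filterlim (\<lambda>r. nat \<lceil>r + d\<rceil>) sequentially at_top"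
      unfolding filterlim_at_top
    proof
      fix Z :: nat
      show "eventually (\<lambda>r. Z \<le> nat \<lceil>r + d\<rceil>) at_top"
        using eventually_ge_at_top[of "real Z"]
      proof eventually_elim
        case (elim r)
        then have "real Z \<le> r + d" by (simp add: d_def add_increasing2)
        then show ?case by linarith
      qed
    qed
    fix \<epsilon> :: real assume "\<epsilon> > 0"
    moreover have "d + 1 \<ge> 0" by (simp add: d_def)
    ultimately have "eventually (\<lambda>r. tscale (r + (d + 1)) \<le> (1 + \<epsilon>) * tscale r) at_top"
      by (intro tscale_shift_le)
    then show "eventually (\<lambda>r. fraction x \<kappa> w r \<le> (1 + \<epsilon>) * fraction b \<kappa> w (real (nat \<lceil>r + d\<rceil>))) at_top"
      using eventually_ge_at_top[of r_init]
    proof eventually_elim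
      case (elim r)
      have "0 \<le> r + d" using elim r_init(1) by (simp add: d_def)
      then have n: "r + d \<le> real (nat \<lceil>r + d\<rceil>)" "real (nat \<lceil>r + d\<rceil>) \<le> r + (d + 1)" by linarith+
      show ?case
      proof (rule fraction_compare[OF w \<kappa> elim(2)])
        show "r + dist x b \<le> real (nat \<lceil>r + d\<rceil>)" using n by (simp add: d_def)
        have "r_init \<le> real (nat \<lceil>r + d\<rceil>)" using n(1) elim(2) zero_le_dist[of x b] unfolding d_def by linarith
        then have "tscale (real (nat \<lceil>r + d\<rceil>)) \<le> tscale (r + (d + 1))" using n(2) by (rule tscale_mono)
        then show "tscale (real (nat \<lceil>r + d\<rceil>)) \<le> (1 + \<epsilon>) * tscale r" using elim(1) by linarith
      qed
    qed
  next
    show "eventually (\<lambda>n. fraction b \<kappa> w (real n) \<le> 1) sequentially"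
      using eventually_ge_at_top[of "nat \<lceil>r_init\<rceil>"]
      by eventually_elim (intro fraction_bounds(2)[OF w \<kappa>], linarith)
  qed
  show "upper_fraction \<kappa> w \<le> Limsup at_top (\<lambda>r. ereal (fraction x \<kappa> w r))"
    unfolding upper_fraction_def
  proof (rule Limsup_compare[where g="\<lambda>n. real n + d"])
    show "filterlim (\<lambda>n. real n + d) at_top sequentially"
      by (rule filterlim_at_top_mono[OF filterlim_real_sequentially]) (simp add: d_def)
    fix \<epsilon> :: real assume "\<epsilon> > 0"
    then have "eventually (\<lambda>r. tscale (r + d) \<le> (1 + \<epsilon>) * tscale r) at_top"
      by (intro tscale_shift_le) (simp add: d_def)
    then have "eventually (\<lambda>r. r_init \<le> r \<and> tscale (r + d) \<le> (1 + \<epsilon>) * tscale r) at_top"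
      using eventually_ge_at_top[of r_init] by eventually_elim simp
    then have "eventually (\<lambda>n. r_init \<le> real n \<and> tscale (real n + d) \<le> (1 + \<epsilon>) * tscale (real n)) sequentially"
      using filterlim_real_sequentially unfolding filterlim_iff by blast
    then show "eventually (\<lambda>n. fraction b \<kappa> w (real n) \<le> (1 + \<epsilon>) * fraction x \<kappa> w (real n + d)) sequentially"
      by eventually_elim (rule fraction_compare[OF w \<kappa>], auto simp: d_def dist_commute)
  next
    show "eventually (\<lambda>r. fraction x \<kappa> w r \<le> 1) at_top"
      using eventually_ge_at_top[of r_init] by eventually_elim (rule fraction_bounds(2)[OF w \<kappa>])
  qed
qed

lemma upper_fraction_01:
  assumes "w \<in> rc_paths" "\<kappa> > 0"
  shows "0 \<le> upper_fraction \<kappa> w" "upper_fraction \<kappa> w \<le> 1"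
proof -
  have ev: "eventually (\<lambda>n. real n \<ge> r_init) sequentially"
    using eventually_ge_at_top[of "nat \<lceil>r_init\<rceil>"] by eventually_elim linarith
  show "0 \<le> upper_fraction \<kappa> w" unfolding upper_fraction_def
  proof (rule le_Limsup)
    show "eventually (\<lambda>n. 0 \<le> ereal (fraction b \<kappa> w (real n))) sequentially"
      using ev by eventually_elim (use fraction_bounds(1)[OF assms] in simp)
  qed simp
  show "upper_fraction \<kappa> w \<le> 1" unfolding upper_fraction_def
    by (rule Limsup_bounded, use ev in eventually_elim) (use fraction_bounds(2)[OF assms] in \<open>simp add: one_ereal_def\<close>)
qed

lemma upper_fraction_antimono:
  assumes w: "w \<in> rc_paths" and \<kappa>: "0 < \<kappa>" "\<kappa> \<le> \<kappa>'"
  shows "upper_fraction \<kappa>' w \<le> upper_fraction \<kappa> w"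
proof -
  have \<kappa>': "\<kappa>' > 0" using \<kappa> by simp
  have "\<exists>r'\<ge>r. \<kappa> * tscale r' = \<kappa>' * tscale r" if r: "r \<ge> r_init" for r
  proof -
    have "\<kappa> * tscale r \<le> \<kappa>' * tscale r" using \<kappa> tscale_pos[OF r] by (intro mult_right_mono) auto
    then have "tscale r \<le> \<kappa>' * tscale r / \<kappa>" using \<kappa> by (simp add: pos_le_divide_eq mult.commute)
    then obtain r' where "r' \<ge> r" "tscale r' = \<kappa>' * tscale r / \<kappa>" by (rule tscale_inverse[OF r]) (rule that)
    then show ?thesis using \<kappa> by (intro exI[of _ r']) simp
  qed
  then obtain g where g: "\<And>r. r \<ge> r_init \<Longrightarrow> g r \<ge> r \<and> \<kappa> * tscale (g r) = \<kappa>' * tscale r" by metis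
  have "Limsup at_top (\<lambda>r. ereal (fraction b \<kappa>' w r)) \<le> Limsup at_top (\<lambda>r. ereal (fraction b \<kappa> w r))"
  proof (rule Limsup_compare[where g=g])
    show "filterlim g at_top at_top"
    proof (rule filterlim_at_top_mono[OF filterlim_ident])
      show "eventually (\<lambda>r. r \<le> g r) at_top"
        using eventually_ge_at_top[of r_init] by eventually_elim (use g in simp)
    qed
    fix \<epsilon> :: real assume "\<epsilon> > 0"
    show "eventually (\<lambda>r. fraction b \<kappa>' w r \<le> (1 + \<epsilon>) * fraction b \<kappa> w (g r)) at_top"
      using eventually_ge_at_top[of r_init]
    proof eventually_elim
      case (elim r)
      have "sojourn (ball b r) (\<kappa>' * tscale r) w \<le> sojourn (ball b (g r)) (\<kappa>' * tscale r) w"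
        using g[OF elim] by (intro sojourn_mono w subset_ball) auto
      then have "fraction b \<kappa>' w r \<le> fraction b \<kappa> w (g r)"
        unfolding fraction_def using g[OF elim] \<kappa>' tscale_pos[OF elim] by (simp add: divide_right_mono)
      moreover have "0 \<le> \<epsilon> * fraction b \<kappa> w (g r)"
        using \<open>\<epsilon> > 0\<close> fraction_bounds(1)[OF w \<kappa>(1), of "g r"] g[OF elim] elim by simp
      ultimately show ?case by (simp add: algebra_simps)
    qed
  next
    show "eventually (\<lambda>r. fraction b \<kappa> w r \<le> 1) at_top"
      using eventually_ge_at_top[of r_init] by eventually_elim (rule fraction_bounds(2)[OF w \<kappa>(1)])
  qed
  then show ?thesis using Limsup_fraction[OF w] \<kappa> \<kappa>' by simp
qed

lemma upper_fraction_pos: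
  assumes w: "w \<in> rc_paths" and \<kappa>: "0 < \<kappa>0" "\<kappa>0 \<le> \<kappa>" and one: "upper_fraction \<kappa>0 w = 1"
  shows "0 < upper_fraction \<kappa> w"
proof (rule ccontr)
  assume "\<not> ?thesis"
  then have "upper_fraction \<kappa> w < ereal (\<kappa>0 / (2 * \<kappa>))"
    using \<kappa> by (simp add: not_less) (metis divide_pos_pos ereal_less(2) mult_pos_pos order_le_less_trans order_less_le_trans zero_less_numeral)
  then have "eventually (\<lambda>n. fraction b \<kappa> w (real n) < \<kappa>0 / (2 * \<kappa>)) sequentially"
    unfolding upper_fraction_def by (drule_tac Limsup_lessD) simp
  moreover have "eventually (\<lambda>n. real n \<ge> r_init) sequentially"
    using eventually_ge_at_top[of "nat \<lceil>r_init\<rceil>"] by eventually_elim linarith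
  ultimately have "eventually (\<lambda>n. ereal (fraction b \<kappa>0 w (real n)) \<le> ereal (1 / 2)) sequentially"
  proof eventually_elim
    case (elim n)
    let ?T = "tscale (real n)"
    have p: "?T > 0" by (rule tscale_pos[OF elim(2)])
    have "sojourn (ball b (real n)) (\<kappa>0 * ?T) w \<le> sojourn (ball b (real n)) (\<kappa> * ?T) w"
      using \<kappa> p by (intro sojourn_mono w) auto
    also have "\<dots> = fraction b \<kappa> w (real n) * (\<kappa> * ?T)" using p \<kappa> by (simp add: fraction_def)
    also have "\<dots> \<le> \<kappa>0 / (2 * \<kappa>) * (\<kappa> * ?T)" using elim(1) p \<kappa> by (intro mult_right_mono) auto
    also have "\<dots> = 1 / 2 * (\<kappa>0 * ?T)" using \<kappa> by simp
    finally show ?case using p \<kappa> by (simp add: fraction_def pos_divide_le_eq)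
  qed
  then have "upper_fraction \<kappa>0 w \<le> ereal (1 / 2)" unfolding upper_fraction_def by (rule Limsup_bounded)
  then show False using one by (simp add: one_ereal_def)
qed

lemma upper_fraction_shift:
  assumes w: "w \<in> rc_paths" and \<kappa>: "\<kappa> > 0" and t: "t < \<infinity>"
  shows "upper_fraction \<kappa> (path_shift t w) = upper_fraction \<kappa> w"
proof -
  define u where "u = enn2real t"
  have u: "u \<ge> 0" "t = ennreal u" using t by (auto simp: u_def less_top)
  have ws: "path_shift t w \<in> rc_paths" by (rule path_shift_rc_paths[OF w])
  have close: "\<bar>fraction b \<kappa> (path_shift t w) r - fraction b \<kappa> w r\<bar> \<le> u / (\<kappa> * tscale r)" if r: "r \<ge> r_init" for r
  proof -
    define T where "T = \<kappa> * tscale r"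
    have T: "T > 0" using \<kappa> tscale_pos[OF r] by (simp add: T_def)
    let ?D = "ball b r"
    have 1: "sojourn ?D (u + T) w = sojourn ?D u w + sojourn ?D T (path_shift t w)"
      using sojourn_add[OF w open_ball u(1), of T b r] T u(2) by simp
    have 2: "sojourn ?D (T + u) w = sojourn ?D T w + sojourn ?D u (path_shift (ennreal T) w)"
      using sojourn_add[OF w open_ball _ u(1), of T b r] T by simp
    have "sojourn ?D u w \<le> u" "sojourn ?D u (path_shift (ennreal T) w) \<le> u"
      using sojourn_le[OF w open_ball u(1)] sojourn_le[OF path_shift_rc_paths[OF w] open_ball u(1)] by auto
    then have "\<bar>sojourn ?D T (path_shift t w) - sojourn ?D T w\<bar> \<le> u"
      using 1 2 sojourn_nonneg[of ?D u w] sojourn_nonneg[of ?D u "path_shift (ennreal T) w"]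
      by (simp add: add.commute abs_le_iff)
    then have "\<bar>sojourn ?D T (path_shift t w) - sojourn ?D T w\<bar> / T \<le> u / T"
      using T by (intro divide_right_mono) auto
    moreover have "fraction b \<kappa> (path_shift t w) r - fraction b \<kappa> w r = (sojourn ?D T (path_shift t w) - sojourn ?D T w) / T"
      by (simp add: fraction_def T_def diff_divide_distrib)
    ultimately show ?thesis using T by (simp add: T_def)
  qed
  have lim: "((\<lambda>n. fraction b \<kappa> (path_shift t w) (real n) - fraction b \<kappa> w (real n)) \<longlonglongrightarrow> 0)"
  proof (rule Lim_null_comparison)
    show "eventually (\<lambda>n. norm (fraction b \<kappa> (path_shift t w) (real n) - fraction b \<kappa> w (real n)) \<le> u / (\<kappa> * tscale (real n))) sequentially"
      using eventually_ge_at_top[of "nat \<lceil>r_init\<rceil>"]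
    proof eventually_elim
      case (elim n)
      then have "real n \<ge> r_init" by linarith
      then show ?case using close by simp
    qed
    have "filterlim (\<lambda>n. \<kappa> * tscale (real n)) at_top sequentially"
      using \<kappa> by (intro filterlim_tendsto_pos_mult_at_top[OF tendsto_const _ filterlim_compose[OF tscale_at_top filterlim_real_sequentially]])
    then show "(\<lambda>n. u / (\<kappa> * tscale (real n))) \<longlonglongrightarrow> 0"
      by (rule real_tendsto_divide_at_top[OF tendsto_const])
  qed
  have "upper_fraction \<kappa> (path_shift t w) =
      limsup (\<lambda>n. ereal (fraction b \<kappa> (path_shift t w) (real n) - fraction b \<kappa> w (real n)) + ereal (fraction b \<kappa> w (real n)))"
    by (simp add: upper_fraction_def)
  also have "\<dots> = 0 + limsup (\<lambda>n. ereal (fraction b \<kappa> w (real n)))"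
  proof (rule ereal_limsup_lim_add)
    show "(\<lambda>n. ereal (fraction b \<kappa> (path_shift t w) (real n) - fraction b \<kappa> w (real n))) \<longlonglongrightarrow> 0"
      using lim by (simp add: zero_ereal_def)
  qed simp
  finally show ?thesis by (simp add: upper_fraction_def)
qed

lemma limsup_constant:
  obtains f where "\<And>\<kappa>. \<kappa> > 0 \<Longrightarrow> 0 \<le> f \<kappa> \<and> f \<kappa> \<le> (1::real)"
    "\<And>\<kappa> z. \<kappa> > 0 \<Longrightarrow> AE \<omega> in P (Some z). upper_fraction \<kappa> (path \<omega>) = ereal (f \<kappa>)"
proof -
  have "\<exists>l. 0 \<le> l \<and> l \<le> 1 \<and> (\<forall>z. AE \<omega> in P (Some z). upper_fraction \<kappa> (path \<omega>) = ereal l)" if \<kappa>: "\<kappa> > 0" for \<kappa>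
  proof -
    have "upper_fraction \<kappa> \<in> borel_measurable path_space"
      unfolding upper_fraction_def fraction_def
      by (intro borel_measurable_limsup borel_measurable_ereal borel_measurable_divide measurable_sojourn borel_measurable_const) auto
    note meas = this
    have inv: "upper_fraction \<kappa> (path_shift t w) = upper_fraction \<kappa> w" if "w \<in> rc_paths" "t < \<infinity>" for w t
      by (rule upper_fraction_shift[OF that(1) \<kappa> that(2)])
    have b01: "0 \<le> upper_fraction \<kappa> w \<and> upper_fraction \<kappa> w \<le> 1" if "w \<in> rc_paths" for w
      using upper_fraction_01[OF that \<kappa>] by simp
    obtain l where "0 \<le> l" "l \<le> 1" "\<And>z. AE \<omega> in P (Some z). upper_fraction \<kappa> (path \<omega>) = ereal l"
      by (rule invariant_function_constant[OF meas inv b01]) (assumption+, rule that)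
    then show ?thesis by (intro exI[of _ l]) simp
  qed
  then have "\<exists>f. \<forall>\<kappa>>0. 0 \<le> f \<kappa> \<and> f \<kappa> \<le> 1 \<and> (\<forall>z. AE \<omega> in P (Some z). upper_fraction \<kappa> (path \<omega>) = ereal (f \<kappa>))"
    by (intro choice) blast
  then obtain f where f: "\<forall>\<kappa>>0. 0 \<le> f \<kappa> \<and> f \<kappa> \<le> 1 \<and> (\<forall>z. AE \<omega> in P (Some z). upper_fraction \<kappa> (path \<omega>) = ereal (f \<kappa>))"
    by blast
  show thesis by (rule that[of f]) (use f in simp_all)
qed

end

section \<open>Smallness for long times\<close>

context borel_standard_process
begin

definition mean_sojourn :: "'a option \<Rightarrow> 'a set \<Rightarrow> real \<Rightarrow> real" where
  "mean_sojourn z D t = enn2real (\<integral>\<^sup>+\<omega>. ennreal (sojourn D t (path \<omega>)) \<partial>P z)"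

lemma mean_sojourn:
  assumes D: "open D" and t: "0 \<le> t"
  shows "(\<integral>\<^sup>+\<omega>. ennreal (sojourn D t (path \<omega>)) \<partial>P z) = ennreal (mean_sojourn z D t)"
    and "0 \<le> mean_sojourn z D t" "mean_sojourn z D t \<le> t"
proof -
  interpret prob_space "P z" by (rule prob)
  have "(\<integral>\<^sup>+\<omega>. ennreal (sojourn D t (path \<omega>)) \<partial>P z) \<le> (\<integral>\<^sup>+\<omega>. ennreal t \<partial>P z)"
    using sojourn_le[OF path_rc D t] by (intro nn_integral_mono ennreal_leI) (simp add: space_P)
  then have le: "(\<integral>\<^sup>+\<omega>. ennreal (sojourn D t (path \<omega>)) \<partial>P z) \<le> ennreal t"
    by (simp add: emeasure_space_1)
  then have "(\<integral>\<^sup>+\<omega>. ennreal (sojourn D t (path \<omega>)) \<partial>P z) < top" by (rule order_le_less_trans) simp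
  then show eq: "(\<integral>\<^sup>+\<omega>. ennreal (sojourn D t (path \<omega>)) \<partial>P z) = ennreal (mean_sojourn z D t)"
    by (simp add: mean_sojourn_def)
  show "0 \<le> mean_sojourn z D t" by (simp add: mean_sojourn_def)
  show "mean_sojourn z D t \<le> t" using le t unfolding eq by (simp add: ennreal_le_iff)
qed

text \<open>From the smaller ball the process is in the annulus one time unit later with probability
  at least \<open>a\<close>, wherever it starts; integrating over time shows that the annulus takes a fixed
  proportion of the time away from the smaller ball.\<close>

lemma mean_sojourn_step:
  assumes B: "B' \<subseteq> B" "open B'" "open B" and a: "0 \<le> a" and t: "0 \<le> t" "0 \<le> t1"
    and escape: "\<And>y. y \<in> B' \<Longrightarrow> ennreal a \<le> emeasure (P (Some y)) {\<omega>\<in>\<Omega>. X (ennreal t1) \<omega> \<in> Some ` (B - B')}"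
  shows "(1 + a) * mean_sojourn z B' t \<le> mean_sojourn z B t + t1"
proof -
  interpret prob_space "P z" by (rule prob)
  define q where "q D s = emeasure (P z) {\<omega>\<in>\<Omega>. X (ennreal s) \<omega> \<in> Some ` D}" for D s
  define g where "g s = q (B - B') s" for s
  have cb: "Some ` B \<in> sets cemetery_borel" "Some ` B' \<in> sets cemetery_borel" "Some ` (B - B') \<in> sets cemetery_borel"
    using B by (auto intro!: Some_image_cemetery)
  have g_le: "g s \<le> 1" for s
    unfolding g_def q_def by (rule emeasure_le_1)
  have split: "q B s = g s + q B' s" for s
  proof -
    have "{\<omega>\<in>\<Omega>. X (ennreal s) \<omega> \<in> Some ` B} =
        {\<omega>\<in>\<Omega>. X (ennreal s) \<omega> \<in> Some ` (B - B')} \<union> {\<omega>\<in>\<Omega>. X (ennreal s) \<omega> \<in> Some ` B'}"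
      using B(1) by auto
    then show ?thesis unfolding g_def q_def
      using X_set_P[OF cb(2)] X_set_P[OF cb(3)] by (simp, subst plus_emeasure) auto
  qed
  have [measurable]: "q B \<in> borel_measurable borel" "q B' \<in> borel_measurable borel"
    unfolding q_def using expected_sojourn(2)[OF B(2)] expected_sojourn(2)[OF B(3)] by auto
  have "g s = q B s - q B' s" for s
  proof -
    have "q B' s \<noteq> top" using emeasure_le_1[of "{\<omega>\<in>\<Omega>. X (ennreal s) \<omega> \<in> Some ` B'}"]
      by (auto simp: q_def top_unique)
    then show ?thesis unfolding split by simp
  qed
  then have [measurable]: "g \<in> borel_measurable borel" by (subst measurable_cong[where g="\<lambda>s. q B s - q B' s"]) measurable
  have key: "ennreal a * q B' s \<le> g (t1 + s)" if s: "0 \<le> s" for s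
  proof -
    let ?C = "{\<omega>\<in>\<Omega>. X (ennreal s) \<omega> \<in> Some ` B'}"
    have C: "?C \<in> sets (F (ennreal s))" by (rule X_set_F[OF cb(2)]) simp
    have "ennreal a * q B' s = (\<integral>\<^sup>+\<omega>. ennreal a * indicator ?C \<omega> \<partial>P z)"
      unfolding q_def using X_set_P[OF cb(2)] by (simp add: nn_integral_cmult_indicator)
    also have "\<dots> \<le> (\<integral>\<^sup>+\<omega>\<in>?C. emeasure (P (X (ennreal s) \<omega>)) {\<omega>'\<in>\<Omega>. X (ennreal t1) \<omega>' \<in> Some ` (B - B')} \<partial>P z)"
      using escape by (intro nn_integral_mono) (auto simp: indicator_def)
    also have "\<dots> = emeasure (P z) {\<omega>\<in>?C. X (ennreal s + ennreal t1) \<omega> \<in> Some ` (B - B')}"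
      by (rule Markov_one[OF C cb(3), symmetric])
    also have "\<dots> \<le> emeasure (P z) {\<omega>\<in>\<Omega>. X (ennreal (t1 + s)) \<omega> \<in> Some ` (B - B')}"
      using X_set_P[OF cb(3)] s t by (intro emeasure_mono) (auto simp: add.commute)
    finally show ?thesis by (simp add: g_def q_def)
  qed
  let ?I = "\<lambda>f. (\<integral>\<^sup>+s\<in>{0..<t}. f s \<partial>lborel)"
  have "ennreal a * ?I (q B') = (\<integral>\<^sup>+s. ennreal a * (q B' s * indicator {0..<t} s) \<partial>lborel)"
    by (rule nn_integral_cmult[symmetric]) measurable
  also have "\<dots> \<le> (\<integral>\<^sup>+s. g (t1 + s) * indicator {0..<t} s \<partial>lborel)"
    using key by (intro nn_integral_mono) (auto simp: indicator_def)
  also have "\<dots> = (\<integral>\<^sup>+s. g (t1 + 1 * s) * indicator {t1..<t1 + t} (t1 + 1 * s) \<partial>lborel)"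
    by (intro nn_integral_cong) (auto simp: indicator_def)
  also have "\<dots> = (\<integral>\<^sup>+u. g u * indicator {t1..<t1 + t} u \<partial>lborel)"
    by (subst nn_integral_real_affine[where c=1 and t=t1, of "\<lambda>u. g u * indicator {t1..<t1 + t} u"]) auto
  also have "\<dots> \<le> (\<integral>\<^sup>+u. g u * indicator {0..<t} u + indicator {t..<t + t1} u \<partial>lborel)"
    using g_le t by (intro nn_integral_mono) (auto simp: indicator_def)
  also have "\<dots> = ?I g + ennreal t1"
    using t by (subst nn_integral_add) auto
  finally have 1: "ennreal a * ?I (q B') \<le> ?I g + ennreal t1" .
  have "?I (q B) = ?I g + ?I (q B')"
    unfolding split by (simp add: distrib_right nn_integral_add)
  moreover have "?I (q B) = ennreal (mean_sojourn z B t)" "?I (q B') = ennreal (mean_sojourn z B' t)"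
    using expected_sojourn(1)[where t=t and x=z, OF B(3)] expected_sojourn(1)[where t=t and x=z, OF B(2)]
      mean_sojourn(1)[OF B(3) t(1)] mean_sojourn(1)[OF B(2) t(1)] by (simp_all add: q_def)
  ultimately have "ennreal a * ennreal (mean_sojourn z B' t) + ennreal (mean_sojourn z B' t)
      \<le> ennreal (mean_sojourn z B t) + ennreal t1"
    using add_right_mono[OF 1, of "?I (q B')"] by (simp add: ac_simps)
  then have "ennreal (a * mean_sojourn z B' t + mean_sojourn z B' t) \<le> ennreal (mean_sojourn z B t + t1)"
    using a t mean_sojourn(2)[OF B(2) t(1)] mean_sojourn(2)[OF B(3) t(1)]
    by (simp add: ennreal_mult ennreal_plus)
  then have "a * mean_sojourn z B' t + mean_sojourn z B' t \<le> mean_sojourn z B t + t1"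
    using mean_sojourn(2)[OF B(3) t(1)] t by (subst (asm) ennreal_le_iff) auto
  then show ?thesis by (simp add: algebra_simps)
qed

lemma block_event_F:
  assumes D: "open D" and t: "0 \<le> t" "0 \<le> s"
  shows "{\<omega>\<in>\<Omega>. a \<le> sojourn D t (path_shift (ennreal s) (path \<omega>))} \<in> sets (F (ennreal (s + t)))"
proof -
  let ?E = "{w\<in>space path_space. a \<le> sojourn D t (path_shift (ennreal s) w)}"
  have [measurable]: "sojourn D t \<in> borel_measurable path_space" by (rule measurable_sojourn[OF D])
  have "?E \<in> sets path_space" by measurable
  then have "{\<omega>\<in>\<Omega>. path \<omega> \<in> ?E} \<in> sets (F (ennreal (s + t)))"
  proof (rule stopped_event_F)
    fix w :: "ennreal \<Rightarrow> 'a option" assume w: "w \<in> rc_paths"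
    have "sojourn D t (path_shift (ennreal s) (stopped (ennreal (s + t)) w)) = sojourn D t (path_shift (ennreal s) w)"
      using t by (simp add: ennreal_plus path_shift_stopped sojourn_stopped)
    then show "w \<in> ?E \<longleftrightarrow> stopped (ennreal (s + t)) w \<in> ?E"
      using w stopped_rc_paths[OF w] by (simp add: space_path_space)
  qed
  moreover have "{\<omega>\<in>\<Omega>. path \<omega> \<in> ?E} = {\<omega>\<in>\<Omega>. a \<le> sojourn D t (path_shift (ennreal s) (path \<omega>))}"
    using path_rc by (auto simp: space_path_space)
  ultimately show ?thesis by simp
qed

lemma blocks_bound:
  assumes D: "open D" and t: "0 \<le> t" and a: "0 \<le> a"
    and bad: "\<And>y. emeasure (P y) {\<omega>\<in>\<Omega>. m \<le> sojourn D t (path \<omega>)} \<le> ennreal a"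
    and I: "finite I"
  shows "emeasure (P z) {\<omega>\<in>\<Omega>. \<forall>i\<in>I. m \<le> sojourn D t (path_shift (ennreal (real i * t)) (path \<omega>))} \<le> ennreal (a ^ card I)"
  using I
proof (induction rule: finite_linorder_max_induct)
  case empty
  show ?case using prob_space.emeasure_space_1[OF prob, of z] by (simp add: space_P)
next
  case (insert i I)
  let ?b = "\<lambda>i \<omega>. m \<le> sojourn D t (path_shift (ennreal (real i * t)) (path \<omega>))"
  let ?C = "{\<omega>\<in>\<Omega>. \<forall>i\<in>I. ?b i \<omega>}"
  have "{\<omega>\<in>\<Omega>. ?b j \<omega>} \<in> sets (F (ennreal (real i * t)))" if "j \<in> I" for j
  proof -
    have "real j + 1 \<le> real i" using insert(2) that by force
    then have "(real j + 1) * t \<le> real i * t" using t by (intro mult_right_mono)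
    then have "real j * t + t \<le> real i * t" by (simp add: distrib_right)
    then have "ennreal (real j * t + t) \<le> ennreal (real i * t)" by (rule ennreal_leI)
    then show ?thesis
      using subsetD[OF sets_F_mono block_event_F[OF D t, of "real j * t" m]] t by auto
  qed
  moreover have "?C = \<Omega> \<inter> (\<Inter>j\<in>I. {\<omega>\<in>\<Omega>. ?b j \<omega>})" by auto
  moreover have "\<Omega> \<in> sets (F (ennreal (real i * t)))" using sets.top[of "F (ennreal (real i * t))"] by (simp add: space_F)
  ultimately have C: "?C \<in> sets (F (ennreal (real i * t)))"
    using insert(1) by (cases "I = {}") (auto intro!: sets.finite_INT)
  have CP: "?C \<in> sets (P z)" using C sets_F_le_P by blast
  let ?E = "{w\<in>space path_space. m \<le> sojourn D t w}"
  have [measurable]: "sojourn D t \<in> borel_measurable path_space" by (rule measurable_sojourn[OF D])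
  have E: "?E \<in> sets path_space" by measurable
  have "{\<omega>\<in>\<Omega>. \<forall>j\<in>insert i I. ?b j \<omega>} = {\<omega>\<in>?C. path_shift (ennreal (real i * t)) (path \<omega>) \<in> ?E}"
    using path_rc path_shift_rc_paths by (auto simp: space_path_space)
  then have "emeasure (P z) {\<omega>\<in>\<Omega>. \<forall>j\<in>insert i I. ?b j \<omega>} =
      (\<integral>\<^sup>+\<omega>\<in>?C. emeasure (P (X (ennreal (real i * t)) \<omega>)) {\<omega>'\<in>\<Omega>. path \<omega>' \<in> ?E} \<partial>P z)"
    using Markov[OF E C] by simp
  also have "\<dots> \<le> (\<integral>\<^sup>+\<omega>. ennreal a * indicator ?C \<omega> \<partial>P z)"
  proof (rule nn_integral_mono)
    fix \<omega>
    have "{\<omega>'\<in>\<Omega>. path \<omega>' \<in> ?E} = {\<omega>\<in>\<Omega>. m \<le> sojourn D t (path \<omega>)}" using path_rc by (auto simp: space_path_space)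
    then show "emeasure (P (X (ennreal (real i * t)) \<omega>)) {\<omega>'\<in>\<Omega>. path \<omega>' \<in> ?E} * indicator ?C \<omega> \<le> ennreal a * indicator ?C \<omega>"
      using bad by (intro mult_right_mono) auto
  qed
  also have "\<dots> = ennreal a * emeasure (P z) ?C" using CP by (rule nn_integral_cmult_indicator)
  also have "\<dots> \<le> ennreal a * ennreal (a ^ card I)" using insert(3) by (rule mult_left_mono) simp
  also have "\<dots> = ennreal (a ^ card (insert i I))"
    using a insert(1,2) by (subst card_insert_disjoint) (auto simp: ennreal_mult)
  finally show ?case .
qed

end

context occupation_setting
begin

lemma mean_sojourn_small:
  assumes \<epsilon>: "\<epsilon> > 0"
  obtains K where "K > 0" "\<And>\<sigma> z t. \<sigma> > 2 * R \<Longrightarrow> K * \<phi> \<sigma> \<le> t \<Longrightarrow> 0 \<le> t \<Longrightarrow>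
    mean_sojourn z (ball b \<sigma>) t \<le> \<epsilon> * t"
proof -
  obtain c0 where c0: "c0 > 0" "c0 \<le> 1" "\<And>r. \<eta>\<^sup>2 * r > R \<Longrightarrow> c0 * v r \<le> c * v (\<eta>\<^sup>2 * r)"
    by (rule ndl_uniform) (rule that)
  obtain \<delta> where \<delta>: "0 < \<delta>" "\<delta> < 1" "\<And>r. \<delta> * r > R \<Longrightarrow> 2 * v (\<delta> * r) \<le> v r"
    by (rule v_reverse_doubling) (rule that)
  define a where "a = c0 / 2"
  have a: "a > 0" using c0 by (simp add: a_def)
  have \<eta>2: "0 < \<eta>\<^sup>2" "\<eta>\<^sup>2 \<le> 1" using \<eta> by (auto simp: power_le_one)
  have step: "(1 + a) * mean_sojourn z (ball b (\<delta> * \<rho>)) t \<le> mean_sojourn z (ball b \<rho>) t + \<Phi> (\<rho> / \<eta>)"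
    if \<rho>: "\<delta> * \<rho> > R" and t: "0 \<le> t" for \<rho> t z
  proof (rule mean_sojourn_step)
    have \<rho>0: "\<rho> > 0" using \<rho> R_ge_1 \<delta> by (smt (verit) zero_less_mult_pos)
    then have "\<delta> * \<rho> \<le> 1 * \<rho>" using \<delta> by (intro mult_right_mono) auto
    then have \<rho>R: "\<rho> > R" "\<delta> * \<rho> \<le> \<rho>" using \<rho> by auto
    show "0 \<le> a" "0 \<le> t" using a t by auto
    show "0 \<le> \<Phi> (\<rho> / \<eta>)" using \<Phi>_pos[of "\<rho> / \<eta>"] \<rho>0 \<eta> by (simp add: less_imp_le)
    show "ball b (\<delta> * \<rho>) \<subseteq> ball b \<rho>" using \<rho>R by (intro subset_ball) auto
    fix y assume y: "y \<in> ball b (\<delta> * \<rho>)"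
    define r where "r = \<rho> / \<eta>\<^sup>2"
    have r: "\<eta>\<^sup>2 * r = \<rho>" "\<eta> * r = \<rho> / \<eta>" using \<eta> by (auto simp: r_def power2_eq_square)
    have "\<rho> \<le> r" using \<eta>2 \<rho>0 by (simp add: r_def pos_le_divide_eq mult_le_cancel_left1)
    then have rR: "r > R" using \<rho>R by simp
    let ?A = "ball b \<rho> - ball b (\<delta> * \<rho>)"
    have "measure \<mu> ?A = v \<rho> - v (\<delta> * \<rho>)"
      unfolding v_def using vol_center(1)[OF \<rho>R(1)] \<rho>R
      by (intro measure_Diff) (auto simp: vol_def sets_\<mu>)
    then have "v \<rho> \<le> 2 * measure \<mu> ?A" using \<delta>(3)[OF \<rho>] by simp
    then have "c * v \<rho> \<le> c * (2 * measure \<mu> ?A)" using c_pos by (intro mult_left_mono) auto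
    moreover have "c0 * v r \<le> c * v \<rho>" using c0(3)[of r] r(1) \<rho>R by simp
    ultimately have "a \<le> c * measure \<mu> ?A / v r"
      using vol_center(2)[OF rR] by (simp add: a_def field_simps)
    then have "ennreal a \<le> ennreal (c * measure \<mu> ?A / v r)" by (rule ennreal_leI)
    also have "\<dots> \<le> emeasure (P (Some y)) {\<omega>\<in>\<Omega>. X (ennreal (\<Phi> (\<eta> * r))) \<omega> \<in> Some ` ?A}"
      using y \<rho>R by (intro ndl_hit rR) (auto simp: r(1))
    finally show "ennreal a \<le> emeasure (P (Some y)) {\<omega>\<in>\<Omega>. X (ennreal (\<Phi> (\<rho> / \<eta>))) \<omega> \<in> Some ` ?A}"
      by (simp add: r(2))
  qed auto
  have iter: "mean_sojourn z (ball b (\<delta> ^ n * \<rho>)) t \<le> t / (1 + a) ^ n + real n * \<Phi> (\<rho> / \<eta>)"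
    if "\<delta> ^ n * \<rho> > R" "0 \<le> t" "\<rho> > 0" for n \<rho> t z
    using that
  proof (induction n)
    case 0
    then show ?case using mean_sojourn(3)[OF open_ball] by simp
  next
    case (Suc n)
    have "\<delta> ^ Suc n * \<rho> \<le> \<delta> ^ n * \<rho>"
      using \<delta> Suc.prems by (intro mult_right_mono) (auto simp: mult_le_cancel_right1)
    then have IH: "mean_sojourn z (ball b (\<delta> ^ n * \<rho>)) t \<le> t / (1 + a) ^ n + real n * \<Phi> (\<rho> / \<eta>)"
      using Suc by simp
    have "\<delta> ^ n \<le> 1" using \<delta> by (simp add: power_le_one)
    then have "\<delta> ^ n * \<rho> / \<eta> \<le> \<rho> / \<eta>" using Suc.prems \<eta> by (intro divide_right_mono) (auto simp: mult_le_cancel_right1)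
    then have p: "\<Phi> (\<delta> ^ n * \<rho> / \<eta>) \<le> \<Phi> (\<rho> / \<eta>)" using Suc.prems \<delta> \<eta> by (intro \<Phi>_mono) auto
    have "(1 + a) * mean_sojourn z (ball b (\<delta> ^ Suc n * \<rho>)) t \<le> mean_sojourn z (ball b (\<delta> ^ n * \<rho>)) t + \<Phi> (\<delta> ^ n * \<rho> / \<eta>)"
      using step[of "\<delta> ^ n * \<rho>" t z] Suc.prems by (simp add: mult.assoc)
    also have "\<dots> \<le> t / (1 + a) ^ n + real (Suc n) * \<Phi> (\<rho> / \<eta>)"
      using IH p by (simp add: algebra_simps)
    finally have "mean_sojourn z (ball b (\<delta> ^ Suc n * \<rho>)) t \<le> (t / (1 + a) ^ n + real (Suc n) * \<Phi> (\<rho> / \<eta>)) / (1 + a)"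
      using a by (simp add: pos_le_divide_eq mult.commute)
    also have "\<dots> = t / (1 + a) ^ Suc n + real (Suc n) * \<Phi> (\<rho> / \<eta>) / (1 + a)"
      by (simp add: add_divide_distrib mult.commute)
    also have "real (Suc n) * \<Phi> (\<rho> / \<eta>) / (1 + a) \<le> real (Suc n) * \<Phi> (\<rho> / \<eta>)"
    proof -
      have "0 \<le> real (Suc n) * \<Phi> (\<rho> / \<eta>)" using \<Phi>_pos[of "\<rho> / \<eta>"] Suc.prems \<eta> by (simp add: less_imp_le)
      then show ?thesis using a by (simp add: pos_divide_le_eq mult_le_cancel_left1 del: of_nat_Suc)
    qed
    finally show ?case by simp
  qed
  obtain n where n: "2 / \<epsilon> < (1 + a) ^ n" using real_arch_pow[of "1 + a" "2 / \<epsilon>"] a by auto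
  define k where "k = 1 / (\<delta> ^ n * \<eta>)"
  have k: "k > 0" using \<delta> \<eta> by (simp add: k_def)
  obtain C where C: "C > 0" "\<And>r. r > R \<Longrightarrow> \<Phi> (k * r) \<le> C * \<Phi> r" by (rule \<Phi>_doubling[OF k]) (rule that)
  obtain C' where C': "C' > 0" "\<And>r. r > 2 * R \<Longrightarrow> \<Phi> r \<le> C' * \<phi> r" by (rule \<Phi>_le_\<phi>) (rule that)
  define K where "K = 2 * (real n + 1) * C * C' / \<epsilon>"
  have K: "K > 0" using C C' \<epsilon> by (simp add: K_def)
  have "mean_sojourn z (ball b \<sigma>) t \<le> \<epsilon> * t" if \<sigma>: "\<sigma> > 2 * R" and t: "K * \<phi> \<sigma> \<le> t" "0 \<le> t" for \<sigma> z t
  proof -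
    define \<rho> where "\<rho> = \<sigma> / \<delta> ^ n"
    have \<sigma>R: "\<sigma> > R" "\<sigma> > 0" using \<sigma> R_ge_1 by auto
    have \<rho>: "\<delta> ^ n * \<rho> = \<sigma>" "\<rho> > 0" "\<rho> / \<eta> = k * \<sigma>" using \<delta> \<sigma>R by (auto simp: \<rho>_def k_def)
    have "mean_sojourn z (ball b \<sigma>) t \<le> t / (1 + a) ^ n + real n * \<Phi> (k * \<sigma>)"
      using iter[of n \<rho> t z] \<rho> t \<sigma>R by simp
    also have "t / (1 + a) ^ n \<le> \<epsilon> / 2 * t"
    proof -
      have p: "(1 + a) ^ n > 0" using a by simp
      have "2 < (1 + a) ^ n * \<epsilon>" using n \<epsilon> by (simp add: pos_divide_less_eq)
      then have "2 * t \<le> ((1 + a) ^ n * \<epsilon>) * t" using t by (intro mult_right_mono) auto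
      then show ?thesis using p by (simp add: pos_divide_le_eq mult_ac)
    qed
    also have "real n * \<Phi> (k * \<sigma>) \<le> (real n + 1) * (C * (C' * \<phi> \<sigma>))"
    proof (rule mult_mono)
      have "\<Phi> (k * \<sigma>) \<le> C * \<Phi> \<sigma>" by (rule C(2)[OF \<sigma>R(1)])
      also have "\<dots> \<le> C * (C' * \<phi> \<sigma>)" using C'(2)[OF \<sigma>] C by (intro mult_left_mono) auto
      finally show "\<Phi> (k * \<sigma>) \<le> C * (C' * \<phi> \<sigma>)" .
      show "0 \<le> \<Phi> (k * \<sigma>)" using \<Phi>_pos[of "k * \<sigma>"] k \<sigma>R by (simp add: less_imp_le)
    qed auto
    also have "\<dots> = \<epsilon> / 2 * (K * \<phi> \<sigma>)" using \<epsilon> by (simp add: K_def)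
    also have "\<dots> \<le> \<epsilon> / 2 * t" using t \<epsilon> by (intro mult_left_mono) auto
    finally show ?thesis by (simp add: field_simps)
  qed
  then show thesis using that K by blast
qed

lemma sojourn_deviation:
  assumes \<epsilon>: "\<epsilon> > 0"
  obtains K where "K > 0" "\<And>\<sigma> z N. \<sigma> > 2 * R \<Longrightarrow> \<sigma> \<ge> r_init \<Longrightarrow> emeasure (P z)
     {\<omega>\<in>\<Omega>. 2 * \<epsilon> * (real N * (K * \<phi> \<sigma>)) < sojourn (ball b \<sigma>) (real N * (K * \<phi> \<sigma>)) (path \<omega>)} \<le> ennreal ((1/2) ^ N)"
proof -
  obtain k :: nat where k: "1 / \<epsilon> \<le> real k" using real_arch_simple by blast
  define a where "a = (1/4 :: real) ^ k"
  have a: "a > 0" by (simp add: a_def)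
  obtain K where K: "K > 0" "\<And>\<sigma> z t. \<sigma> > 2 * R \<Longrightarrow> K * \<phi> \<sigma> \<le> t \<Longrightarrow> 0 \<le> t \<Longrightarrow>
    mean_sojourn z (ball b \<sigma>) t \<le> (\<epsilon> * a) * t"
    using mean_sojourn_small[of "\<epsilon> * a"] \<epsilon> a by (metis mult_pos_pos)
  have "emeasure (P z) {\<omega>\<in>\<Omega>. 2 * \<epsilon> * (real N * (K * \<phi> \<sigma>)) < sojourn (ball b \<sigma>) (real N * (K * \<phi> \<sigma>)) (path \<omega>)} \<le> ennreal ((1/2) ^ N)"
    if \<sigma>: "\<sigma> > 2 * R" "\<sigma> \<ge> r_init" for \<sigma> z N
  proof -
    define t where "t = K * \<phi> \<sigma>"
    let ?D = "ball b \<sigma>"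
    have t: "t > 0" using K \<phi>_pos[OF \<sigma>(2)] by (simp add: t_def)
    have bad: "emeasure (P y) {\<omega>\<in>\<Omega>. \<epsilon> * t \<le> sojourn ?D t (path \<omega>)} \<le> ennreal a" for y
    proof -
      interpret prob_space "P y" by (rule prob)
      let ?B = "{\<omega>\<in>\<Omega>. \<epsilon> * t \<le> sojourn ?D t (path \<omega>)}"
      have "{\<omega>\<in>\<Omega>. path \<omega> \<in> {w\<in>space path_space. \<epsilon> * t \<le> sojourn ?D t w}} \<in> events"
        using measurable_sojourn[OF open_ball, of b \<sigma> t] by (intro path_event_P) measurable
      also have "{\<omega>\<in>\<Omega>. path \<omega> \<in> {w\<in>space path_space. \<epsilon> * t \<le> sojourn ?D t w}} = ?B"
        using path_rc by (auto simp: space_path_space)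
      finally have B: "?B \<in> events" .
      have "ennreal (\<epsilon> * t) * emeasure (P y) ?B = (\<integral>\<^sup>+\<omega>. ennreal (\<epsilon> * t) * indicator ?B \<omega> \<partial>P y)"
        using B by (rule nn_integral_cmult_indicator[symmetric])
      also have "\<dots> \<le> (\<integral>\<^sup>+\<omega>. ennreal (sojourn ?D t (path \<omega>)) \<partial>P y)"
        by (intro nn_integral_mono) (auto simp: indicator_def intro: ennreal_leI)
      also have "\<dots> = ennreal (mean_sojourn y ?D t)" using t by (intro mean_sojourn) auto
      also have "\<dots> \<le> ennreal ((\<epsilon> * a) * t)" using K(2)[OF \<sigma>(1), of t y] t by (intro ennreal_leI) (simp add: t_def)
      finally have "ennreal ((\<epsilon> * t) * prob ?B) \<le> ennreal ((\<epsilon> * a) * t)"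
        using \<epsilon> t by (simp add: emeasure_eq_measure ennreal_mult)
      then have "(\<epsilon> * t) * prob ?B \<le> (\<epsilon> * t) * a" using \<epsilon> a t by (subst (asm) ennreal_le_iff) (auto simp: mult_ac)
      then have "prob ?B \<le> a" using \<epsilon> t by simp
      then show ?thesis by (simp add: emeasure_eq_measure ennreal_leI)
    qed
    interpret prob_space "P z" by (rule prob)
    let ?b = "\<lambda>i \<omega>. \<epsilon> * t \<le> sojourn ?D t (path_shift (ennreal (real i * t)) (path \<omega>))"
    define JJ where "JJ = {J. J \<subseteq> {..<N} \<and> \<epsilon> * real N \<le> real (card J)}"
    define S where "S J = {\<omega>\<in>\<Omega>. \<forall>i\<in>J. ?b i \<omega>}" for J
    have JJ: "finite JJ" "card JJ \<le> 2 ^ N"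
    proof -
      have "JJ \<subseteq> Pow {..<N}" by (auto simp: JJ_def)
      then show "finite JJ" by (rule finite_subset) simp
      have "card JJ \<le> card (Pow {..<N})" using \<open>JJ \<subseteq> Pow {..<N}\<close> by (intro card_mono) auto
      then show "card JJ \<le> 2 ^ N" by (simp add: card_Pow)
    qed
    have S: "S J \<in> events" if "J \<in> JJ" for J
    proof -
      have fin: "finite J" using that by (auto simp: JJ_def intro: finite_subset)
      have "{\<omega>\<in>\<Omega>. ?b i \<omega>} \<in> events" for i
        using block_event_F[OF open_ball, of t "real i * t" "\<epsilon> * t" b \<sigma>] t sets_F_le_P by auto
      moreover have "S J = space (P z) \<inter> (\<Inter>i\<in>J. {\<omega>\<in>\<Omega>. ?b i \<omega>})" by (auto simp: S_def space_P)
      ultimately show ?thesis using fin by (cases "J = {}") (auto intro!: sets.finite_INT)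
    qed
    have "{\<omega>\<in>\<Omega>. 2 * \<epsilon> * (real N * t) < sojourn ?D (real N * t) (path \<omega>)} \<subseteq> (\<Union>J\<in>JJ. S J)"
    proof
      fix \<omega> assume "\<omega> \<in> {\<omega>\<in>\<Omega>. 2 * \<epsilon> * (real N * t) < sojourn ?D (real N * t) (path \<omega>)}"
      then have \<omega>: "\<omega> \<in> \<Omega>" "2 * \<epsilon> * (real N * t) < sojourn ?D (real N * t) (path \<omega>)" by auto
      note w = path_rc[OF \<omega>(1)]
      define J where "J = {i\<in>{..<N}. ?b i \<omega>}"
      have "sojourn ?D (real N * t) (path \<omega>) = (\<Sum>i<N. sojourn ?D t (path_shift (ennreal (real i * t)) (path \<omega>)))"
        using t by (intro sojourn_blocks w) auto
      also have "\<dots> \<le> (\<Sum>i<N. \<epsilon> * t + (if i \<in> J then t else 0))"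
      proof (rule sum_mono)
        fix i assume "i \<in> {..<N}"
        then show "sojourn ?D t (path_shift (ennreal (real i * t)) (path \<omega>)) \<le> \<epsilon> * t + (if i \<in> J then t else 0)"
          using sojourn_le[OF path_shift_rc_paths[OF w] open_ball, of t b \<sigma> "ennreal (real i * t)"] t \<epsilon>
          by (auto simp: J_def not_le add_increasing)
      qed
      also have "\<dots> = real N * (\<epsilon> * t) + real (card J) * t"
      proof -
        have "{..<N} \<inter> J = J" by (auto simp: J_def)
        then show ?thesis by (simp add: sum.distrib sum.If_cases)
      qed
      finally have "real N * (\<epsilon> * t) < real (card J) * t" using \<omega>(2) by (simp add: algebra_simps)
      then have "(\<epsilon> * real N) * t < real (card J) * t" by (simp add: mult_ac)
      then have "\<epsilon> * real N < real (card J)" using t by simp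
      then have "J \<in> JJ" by (auto simp: JJ_def J_def)
      moreover have "\<omega> \<in> S J" using \<omega>(1) by (auto simp: S_def J_def)
      ultimately show "\<omega> \<in> (\<Union>J\<in>JJ. S J)" by blast
    qed
    then have "emeasure (P z) {\<omega>\<in>\<Omega>. 2 * \<epsilon> * (real N * t) < sojourn ?D (real N * t) (path \<omega>)} \<le> emeasure (P z) (\<Union>J\<in>JJ. S J)"
      using S JJ(1) by (intro emeasure_mono) auto
    also have "\<dots> \<le> (\<Sum>J\<in>JJ. emeasure (P z) (S J))"
      using S JJ(1) by (intro emeasure_subadditive_finite) auto
    also have "\<dots> \<le> (\<Sum>J\<in>JJ. ennreal ((1/4) ^ N))"
    proof (rule sum_mono)
      fix J assume J: "J \<in> JJ"
      then have "finite J" by (auto simp: JJ_def intro: finite_subset)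
      then have "emeasure (P z) (S J) \<le> ennreal (a ^ card J)"
        unfolding S_def using t a by (intro blocks_bound bad) auto
      also have "a ^ card J = (1/4) ^ (k * card J)" by (simp add: a_def power_mult)
      also have "ennreal \<dots> \<le> ennreal ((1/4) ^ N)"
      proof (intro ennreal_leI power_decreasing)
        have "1 \<le> \<epsilon> * real k" using k \<epsilon> by (simp add: pos_divide_le_eq mult.commute)
        then have "1 * real N \<le> (\<epsilon> * real k) * real N" by (intro mult_right_mono) auto
        also have "\<dots> = real k * (\<epsilon> * real N)" by simp
        also have "\<dots> \<le> real k * real (card J)" using J by (intro mult_left_mono) (auto simp: JJ_def)
        finally have "real N \<le> real (k * card J)" by simp
        then show "N \<le> k * card J" by (simp only: of_nat_le_iff)
      qed auto
      finally show "emeasure (P z) (S J) \<le> ennreal ((1/4) ^ N)" .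
    qed
    also have "\<dots> = ennreal (real (card JJ) * (1/4) ^ N)" by (simp add: ennreal_mult ennreal_of_nat_eq_real_of_nat)
    also have "\<dots> \<le> ennreal ((1/2) ^ N)"
    proof (rule ennreal_leI)
      have "real (card JJ) \<le> real (2 ^ N)" using JJ(2) by (simp only: of_nat_le_iff)
      then have "real (card JJ) * (1/4) ^ N \<le> 2 ^ N * (1/4) ^ N" by (intro mult_right_mono) auto
      also have "\<dots> = (1/2 :: real) ^ N" by (simp add: power_mult_distrib[symmetric])
      finally show "real (card JJ) * (1/4) ^ N \<le> (1/2) ^ N" .
    qed
    finally show ?thesis by (simp add: t_def)
  qed
  then show thesis using that K(1) by blast
qed

end

lemma stay_concat:
  assumes "w \<in> stay C t" "path_shift (ennreal t) w \<in> stay C u" "0 \<le> t"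
  shows "w \<in> stay C (t + u)"
proof -
  have "w (ennreal s) \<in> Some ` C" if s: "0 \<le> s" "s < t + u" for s
  proof (cases "s < t")
    case True then show ?thesis using assms(1) s by (simp add: stay_def)
  next
    case False
    then have "path_shift (ennreal t) w (ennreal (s - t)) \<in> Some ` C"
      using assms(2) s by (simp add: stay_def)
    then show ?thesis using False assms(3) by (simp add: path_shift_def flip: ennreal_plus)
  qed
  then show ?thesis using assms(1) by (simp add: stay_def)
qed

lemma stay_mono: "w \<in> stay C t \<Longrightarrow> u \<le> t \<Longrightarrow> w \<in> stay C u"
  by (simp add: stay_def)

lemma stay_stopped: "w \<in> rc_paths \<Longrightarrow> stopped (ennreal t) w \<in> stay C t \<longleftrightarrow> w \<in> stay C t"
proof -
  have "stopped (ennreal t) w (ennreal s) = w (ennreal s)" if "0 \<le> s" "s < t" for s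
    using that by (auto simp: stopped_def min_def ennreal_leI)
  moreover assume "w \<in> rc_paths"
  ultimately show ?thesis using stopped_rc_paths[of w "ennreal t"] by (simp add: stay_def)
qed

lemma sojourn_stay:
  assumes "w \<in> stay C t" "C \<subseteq> D" "0 \<le> t"
  shows "sojourn D t w = t"
proof -
  have "w (ennreal s) \<in> Some ` D" if "s \<in> {0..<t}" for s
    using assms(1) that image_mono[OF assms(2), of Some] by (auto simp: stay_def)
  then have "{s \<in> {0..<t}. w (ennreal s) \<in> Some ` D} = {0..<t}" by blast
  then show ?thesis using assms(3) by (simp add: sojourn_def)
qed

text \<open>If the union of the \<open>A n\<close> had probability \<open>p < c0\<close>, then the first
  occurrences would have probabilities at least \<open>b n * (c0 - p)\<close>, which are not summable.\<close>

lemma conditional_Borel_Cantelli: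
  assumes "prob_space M"
    and A: "\<And>n. A n \<in> sets M" and G: "\<And>n. G n \<in> sets M"
    and PG: "\<And>n. n \<ge> m \<Longrightarrow> c0 \<le> measure M (G n)" and bn: "\<And>n. 0 \<le> b n"
    and first: "\<And>n. n \<ge> m \<Longrightarrow> b n * measure M ((space M - (\<Union>j\<in>{m..<n}. A j)) \<inter> G n)
        \<le> measure M ((space M - (\<Union>j\<in>{m..<n}. A j)) \<inter> A n)"
    and div: "\<not> summable (b :: nat \<Rightarrow> real)"
  shows "c0 \<le> measure M (\<Union>n\<in>{m..}. A n)"
proof (rule ccontr)
  interpret prob_space M by fact
  define U where "U = (\<Union>n\<in>{m..}. A n)"
  define D where "D n = (if n \<ge> m then (space M - (\<Union>j\<in>{m..<n}. A j)) \<inter> A n else {})" for n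
  assume "\<not> c0 \<le> measure M (\<Union>n\<in>{m..}. A n)"
  then have p: "prob U < c0" by (simp add: U_def)
  have U: "U \<in> events" unfolding U_def using A by auto
  have D: "range D \<subseteq> events" unfolding D_def using A by auto
  have "disjoint_family D"
    unfolding disjoint_family_on_def
  proof (intro ballI impI)
    fix i j :: nat assume "i \<noteq> j"
    then consider "i < j" | "j < i" by linarith
    then show "D i \<inter> D j = {}" by cases (auto simp: D_def)
  qed
  from finite_measure_UNION[OF D this] have "summable (\<lambda>n. prob (D n))" by (rule sums_summable)
  then have "summable (\<lambda>n. b n * (c0 - prob U))"
  proof (rule summable_comparison_test_ev[rotated])
    show "eventually (\<lambda>n. norm (b n * (c0 - prob U)) \<le> prob (D n)) sequentially"
      using eventually_ge_at_top[of m]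
    proof eventually_elim
      case (elim n)
      let ?C = "space M - (\<Union>j\<in>{m..<n}. A j)"
      have C: "?C \<in> events" using A by auto
      have "prob (G n) \<le> prob ((?C \<inter> G n) \<union> U)"
        using C G U sets.sets_into_space[OF G, of n] by (intro finite_measure_mono) (auto simp: U_def)
      also have "\<dots> \<le> prob (?C \<inter> G n) + prob U" using C G U by (intro measure_Un_le) auto
      finally have "c0 - prob U \<le> prob (?C \<inter> G n)" using PG[OF elim] by simp
      then have "b n * (c0 - prob U) \<le> b n * prob (?C \<inter> G n)" using bn by (intro mult_left_mono) auto
      also have "\<dots> \<le> prob (D n)" using first[OF elim] elim by (simp add: D_def)
      finally show ?case using bn[of n] p by simp
    qed
  qed
  from summable_mult2[OF this, of "inverse (c0 - prob U)"] have "summable b" using p by (simp add: mult.assoc)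
  then show False using div by simp
qed

context borel_standard_process
begin

lemma stay_event_F:
  assumes C: "closed C" and "0 \<le> s" "0 \<le> t"
  shows "{\<omega>\<in>\<Omega>. path_shift (ennreal s) (path \<omega>) \<in> stay C t} \<in> sets (F (ennreal (s + t)))"
proof -
  let ?E = "path_shift (ennreal s) -` stay C t \<inter> space path_space"
  have "?E \<in> sets path_space" by (rule measurable_sets[OF measurable_path_shift stay_sets[OF C]])
  then have "{\<omega>\<in>\<Omega>. path \<omega> \<in> ?E} \<in> sets (F (ennreal (s + t)))"
  proof (rule stopped_event_F)
    fix w :: "ennreal \<Rightarrow> 'a option" assume w: "w \<in> rc_paths"
    have "path_shift (ennreal s) (stopped (ennreal (s + t)) w) = stopped (ennreal t) (path_shift (ennreal s) w)"
      using assms by (simp add: ennreal_plus path_shift_stopped)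
    then show "w \<in> ?E \<longleftrightarrow> stopped (ennreal (s + t)) w \<in> ?E"
      using w stopped_rc_paths[OF w] stay_stopped[OF path_shift_rc_paths[OF w]] by (simp add: space_path_space)
  qed
  moreover have "{\<omega>\<in>\<Omega>. path \<omega> \<in> ?E} = {\<omega>\<in>\<Omega>. path_shift (ennreal s) (path \<omega>) \<in> stay C t}"
    using path_rc by (auto simp: space_path_space)
  ultimately show ?thesis by simp
qed

lemma stay_iterate:
  assumes c0: "0 < c0"
    and one: "\<And>y. y \<in> B \<Longrightarrow> ennreal c0 \<le> emeasure (P (Some y)) {\<omega>\<in>\<Omega>. path \<omega> \<in> stay C \<tau> \<and> X (ennreal \<tau>) \<omega> \<in> Some ` B}"
    and C: "closed C" and B: "B \<in> sets borel" and \<tau>: "0 \<le> \<tau>" and y: "y \<in> B"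
  shows "ennreal (c0 ^ k) \<le> emeasure (P (Some y)) {\<omega>\<in>\<Omega>. path \<omega> \<in> stay C (real k * \<tau>)}"
  using y
proof (induction k arbitrary: y)
  case 0
  have "{\<omega>\<in>\<Omega>. path \<omega> \<in> stay C (real 0 * \<tau>)} = \<Omega>" using path_rc by (auto simp: stay_def)
  then show ?case using prob_space.emeasure_space_1[OF prob, of "Some y"] by (simp add: space_P)
next
  case (Suc k)
  let ?A = "{\<omega>\<in>\<Omega>. path \<omega> \<in> stay C \<tau> \<and> X (ennreal \<tau>) \<omega> \<in> Some ` B}"
  let ?E = "stay C (real k * \<tau>)"
  have sh0: "path_shift (ennreal 0) w = w" for w :: "ennreal \<Rightarrow> 'a option" by (simp add: path_shift_def)
  have "?A = {\<omega>\<in>\<Omega>. path \<omega> \<in> stay C \<tau>} \<inter> {\<omega>\<in>\<Omega>. X (ennreal \<tau>) \<omega> \<in> Some ` B}" by auto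
  moreover have "{\<omega>\<in>\<Omega>. path \<omega> \<in> stay C \<tau>} \<in> sets (F (ennreal \<tau>))"
    using stay_event_F[OF C order_refl \<tau>] unfolding sh0 by simp
  ultimately have A: "?A \<in> sets (F (ennreal \<tau>))" using X_set_F[OF Some_image_cemetery[OF B] order_refl] by simp
  then have AP: "?A \<in> sets (P (Some y))" using sets_F_le_P by blast
  have "ennreal (c0 ^ Suc k) = ennreal (c0 ^ k) * ennreal c0" using c0 by (simp add: mult.commute flip: ennreal_mult)
  also have "\<dots> \<le> ennreal (c0 ^ k) * emeasure (P (Some y)) ?A" using one[OF Suc.prems] by (rule mult_left_mono) simp
  also have "\<dots> = (\<integral>\<^sup>+\<omega>. ennreal (c0 ^ k) * indicator ?A \<omega> \<partial>P (Some y))"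
    using AP by (rule nn_integral_cmult_indicator[symmetric])
  also have "\<dots> \<le> (\<integral>\<^sup>+\<omega>\<in>?A. emeasure (P (X (ennreal \<tau>) \<omega>)) {\<omega>'\<in>\<Omega>. path \<omega>' \<in> ?E} \<partial>P (Some y))"
    using Suc.IH by (intro nn_integral_mono) (auto simp: indicator_def)
  also have "\<dots> = emeasure (P (Some y)) {\<omega>\<in>?A. path_shift (ennreal \<tau>) (path \<omega>) \<in> ?E}"
    by (rule Markov[OF stay_sets[OF C] A, symmetric])
  also have "\<dots> \<le> emeasure (P (Some y)) {\<omega>\<in>\<Omega>. path \<omega> \<in> stay C (real (Suc k) * \<tau>)}"
  proof (rule emeasure_mono)
    have "real (Suc k) * \<tau> = \<tau> + real k * \<tau>" by (simp add: distrib_right)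
    then show "{\<omega>\<in>?A. path_shift (ennreal \<tau>) (path \<omega>) \<in> ?E} \<subseteq> {\<omega>\<in>\<Omega>. path \<omega> \<in> stay C (real (Suc k) * \<tau>)}"
      using stay_concat[where C=C and t=\<tau> and u="real k * \<tau>"] \<tau> by auto
    show "{\<omega>\<in>\<Omega>. path \<omega> \<in> stay C (real (Suc k) * \<tau>)} \<in> sets (P (Some y))"
      by (rule path_event_P[OF stay_sets[OF C]])
  qed
  finally show ?case .
qed

end

context occupation_setting
begin

lemma upper_fraction_small:
  assumes \<epsilon>: "\<epsilon> > 0"
  obtains \<kappa> where "\<kappa> > 0" "AE \<omega> in P (Some b). upper_fraction \<kappa> (path \<omega>) \<le> ereal \<epsilon>"
proof -
  interpret prob_space "P (Some b)" by (rule prob)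
  define e where "e = \<epsilon> / 24"
  have e: "e > 0" using \<epsilon> by (simp add: e_def)
  obtain K where K: "K > 0" "\<And>\<sigma> z N. \<sigma> > 2 * R \<Longrightarrow> \<sigma> \<ge> r_init \<Longrightarrow> emeasure (P z)
     {\<omega>\<in>\<Omega>. 2 * e * (real N * (K * \<phi> \<sigma>)) < sojourn (ball b \<sigma>) (real N * (K * \<phi> \<sigma>)) (path \<omega>)} \<le> ennreal ((1/2) ^ N)"
    by (rule sojourn_deviation[OF e]) (rule that)
  define \<kappa> where "\<kappa> = 4 * K"
  have \<kappa>: "\<kappa> > 0" using K by (simp add: \<kappa>_def)
  define a0 where "a0 = max r_init (2 * R + 1)"
  have a0: "a0 \<ge> r_init" "a0 > 2 * R" "a0 > 1" using R_ge_1 by (auto simp: a0_def)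
  obtain n0 :: nat where n0: "max 2 (ln (\<phi> a0)) \<le> real n0" using real_arch_simple by blast
  have "\<exists>r\<ge>a0. \<phi> r = exp (real n)" if "n \<ge> n0" for n
  proof -
    have "ln (\<phi> a0) \<le> real n" using n0 that by linarith
    then have "\<phi> a0 \<le> exp (real n)" using \<phi>_pos[OF a0(1)] by (metis exp_le_cancel_iff exp_ln)
    then show ?thesis using \<phi>_inverse[OF a0(3)] by metis
  qed
  then obtain rr where rr: "\<And>n. n \<ge> n0 \<Longrightarrow> rr n \<ge> a0" "\<And>n. n \<ge> n0 \<Longrightarrow> \<phi> (rr n) = exp (real n)" by metis
  have n_ge: "real n \<ge> 2" if "n \<ge> n0" for n using that n0 by linarith
  have ln2: "ln 2 \<ge> (1/2 :: real)"
    using ln_2_less_1 ln_le_minus_one[of "1/2 :: real"] by (simp add: ln_div)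
  have ln_n: "ln (real n) \<ge> 1/2" if "n \<ge> n0" for n
  proof -
    have "ln 2 \<le> ln (real n)" using n_ge[OF that] by (intro ln_mono) auto
    then show ?thesis using ln2 by linarith
  qed
  have T: "tscale (rr n) = exp (real n) * ln (real n)" if "n \<ge> n0" for n
    unfolding tscale_def rr(2)[OF that] by simp
  define N where "N n = nat \<lceil>4 * ln (real n)\<rceil>" for n :: nat
  have N: "4 * ln (real n) \<le> real (N n)" "real (N n) \<le> 8 * ln (real n)" if "n \<ge> n0" for n
    using ln_n[OF that] unfolding N_def by linarith+
  define A where "A n = (if n \<ge> n0 then {\<omega>\<in>\<Omega>. 2 * e * (real (N n) * (K * \<phi> (rr n)))
      < sojourn (ball b (rr n)) (real (N n) * (K * \<phi> (rr n))) (path \<omega>)} else {})" for n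
  have A: "A n \<in> events" for n
  proof (cases "n \<ge> n0")
    case True
    let ?E = "{w\<in>space path_space. 2 * e * (real (N n) * (K * \<phi> (rr n))) < sojourn (ball b (rr n)) (real (N n) * (K * \<phi> (rr n))) w}"
    have "?E \<in> sets path_space"
      using measurable_sojourn[OF open_ball, of b "rr n" "real (N n) * (K * \<phi> (rr n))"] by measurable
    then have "{\<omega>\<in>\<Omega>. path \<omega> \<in> ?E} \<in> events" by (rule path_event_P)
    moreover have "{\<omega>\<in>\<Omega>. path \<omega> \<in> ?E} = A n" using True path_rc by (auto simp: A_def space_path_space)
    ultimately show ?thesis by simp
  qed (simp add: A_def)
  have PA: "prob (A n) \<le> inverse (real n ^ 2)" for n
  proof (cases "n \<ge> n0")
    case True
    have "emeasure (P (Some b)) (A n) \<le> ennreal ((1/2) ^ N n)"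
      using K(2)[of "rr n" "Some b" "N n"] rr(1)[OF True] a0 True by (simp add: A_def)
    then have "prob (A n) \<le> (1/2) ^ N n" by (simp add: emeasure_eq_measure)
    also have "(1/2 :: real) ^ N n = exp (- (real (N n) * ln 2))"
      by (simp add: exp_minus exp_of_nat_mult power_one_over inverse_eq_divide)
    also have "\<dots> \<le> exp (- (2 * ln (real n)))"
    proof -
      have "(4 * ln (real n)) * (1/2) \<le> real (N n) * ln 2"
        using N(1)[OF True] ln2 by (intro mult_mono) auto
      then show ?thesis by simp
    qed
    also have "\<dots> = inverse (real n ^ 2)"
      using n_ge[OF True] by (simp add: exp_minus exp_double)
    finally show ?thesis .
  qed (simp add: A_def)
  have "AE \<omega> in P (Some b). eventually (\<lambda>n. \<omega> \<in> space (P (Some b)) - A n) sequentially"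
  proof (rule borel_cantelli_AE1[OF A])
    show "emeasure (P (Some b)) (A n) < \<infinity>" for n by (simp add: emeasure_eq_measure)
    show "summable (\<lambda>n. prob (A n))"
      by (rule summable_comparison_test[OF _ inverse_power_summable[of 2]]) (use PA in auto)
  qed
  then have "AE \<omega> in P (Some b). upper_fraction \<kappa> (path \<omega>) \<le> ereal \<epsilon>"
    using AE_space
  proof eventually_elim
    case (elim \<omega>)
    have \<omega>: "\<omega> \<in> \<Omega>" using elim(2) by (simp add: space_P)
    note w = path_rc[OF \<omega>]
    obtain n1 where n1: "\<And>n. n \<ge> n1 \<Longrightarrow> \<omega> \<notin> A n" using elim(1) unfolding eventually_sequentially by auto
    have soj: "sojourn (ball b (rr n)) (\<kappa> * tscale (rr n)) (path \<omega>) \<le> 4 * e * (\<kappa> * tscale (rr n))"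
      if n: "n \<ge> n0" "n \<ge> n1" for n
    proof -
      let ?t = "real (N n) * (K * exp (real n))"
      have "\<kappa> * tscale (rr n) = (4 * ln (real n)) * (K * exp (real n))" by (simp add: \<kappa>_def T[OF n(1)])
      also have "\<dots> \<le> ?t" using N(1)[OF n(1)] K by (intro mult_right_mono) auto
      finally have "sojourn (ball b (rr n)) (\<kappa> * tscale (rr n)) (path \<omega>) \<le> sojourn (ball b (rr n)) ?t (path \<omega>)"
        by (intro sojourn_mono w) auto
      also have "\<dots> \<le> 2 * e * ?t" using n1[OF n(2)] n(1) \<omega> rr(2)[OF n(1)] by (auto simp: A_def)
      also have "\<dots> \<le> 2 * e * ((8 * ln (real n)) * (K * exp (real n)))"
        using N(2)[OF n(1)] K e by (intro mult_left_mono mult_right_mono) auto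
      also have "\<dots> = 4 * e * (\<kappa> * tscale (rr n))" by (simp add: \<kappa>_def T[OF n(1)])
      finally show ?thesis .
    qed
    have bound: "fraction b \<kappa> (path \<omega>) r \<le> \<epsilon>"
      if r: "r \<ge> r_init" "\<phi> r \<ge> exp (real (max n0 n1))" for r
    proof -
      define n where "n = nat \<lfloor>ln (\<phi> r)\<rfloor>"
      have \<phi>r: "\<phi> r > 0" by (rule \<phi>_pos[OF r(1)])
      have lnr: "real (max n0 n1) \<le> ln (\<phi> r)" using r(2) \<phi>r by (metis exp_le_cancel_iff exp_ln)
      then have n: "real n \<le> ln (\<phi> r)" "ln (\<phi> r) < real (Suc n)" "max n0 n1 \<le> n"
        unfolding n_def by linarith+
      then have nn: "n \<ge> n0" "Suc n \<ge> n0" "Suc n \<ge> n1" by auto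
      have lo: "exp (real n) \<le> \<phi> r" using n(1) \<phi>r by (metis exp_le_cancel_iff exp_ln)
      have hi: "\<phi> r \<le> \<phi> (rr (Suc n))"
        unfolding rr(2)[OF nn(2)] using n(2) \<phi>r by (metis exp_le_cancel_iff exp_ln less_imp_le)
      have r1: "1 < r" "1 < rr (Suc n)" using r(1) r_init(1) rr(1)[OF nn(2)] a0 by auto
      have rle: "r \<le> rr (Suc n)" by (rule \<phi>_le_imp_le[OF r1 hi])
      have "ln (real n) \<le> ln (ln (\<phi> r))" using n(1) n_ge[OF nn(1)] by (intro ln_mono) auto
      then have Tr: "exp (real n) * ln (real n) \<le> tscale r"
        unfolding tscale_def using lo ln_n[OF nn(1)] \<phi>r by (intro mult_mono) auto
      have "exp (real (Suc n)) * ln (real (Suc n)) \<le> (3 * exp (real n)) * (2 * ln (real n))"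
      proof (rule mult_mono)
        show "exp (real (Suc n)) \<le> 3 * exp (real n)"
          using exp_le by (simp add: exp_add)
        have "real (Suc n) \<le> real n * real n"
        proof -
          have "2 * real n \<le> real n * real n" using n_ge[OF nn(1)] by (intro mult_right_mono) auto
          then show ?thesis unfolding of_nat_Suc using n_ge[OF nn(1)] by linarith
        qed
        then have "ln (real (Suc n)) \<le> ln (real n * real n)" using n_ge[OF nn(1)] by (intro ln_mono) auto
        then show "ln (real (Suc n)) \<le> 2 * ln (real n)" using n_ge[OF nn(1)] by (simp add: ln_mult)
      qed auto
      then have Tn: "tscale (rr (Suc n)) \<le> 6 * tscale r" using Tr T[OF nn(2)] by linarith
      have "sojourn (ball b r) (\<kappa> * tscale r) (path \<omega>) \<le> sojourn (ball b (rr (Suc n))) (\<kappa> * tscale (rr (Suc n))) (path \<omega>)"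
        using rle \<kappa> tscale_mono[OF r(1) rle] by (intro sojourn_mono w subset_ball) auto
      also have "\<dots> \<le> 4 * e * (\<kappa> * tscale (rr (Suc n)))" by (rule soj[OF nn(2,3)])
      also have "\<dots> \<le> 4 * e * (\<kappa> * (6 * tscale r))" using Tn e \<kappa> by (intro mult_left_mono) auto
      also have "\<dots> = \<epsilon> * (\<kappa> * tscale r)" by (simp add: e_def)
      finally show ?thesis using \<kappa> tscale_pos[OF r(1)] by (simp add: fraction_def pos_divide_le_eq)
    qed
    have "eventually (\<lambda>r. exp (real (max n0 n1)) \<le> \<phi> r) at_top"
      using \<phi>_at_top unfolding filterlim_at_top by blast
    then have "eventually (\<lambda>r. fraction b \<kappa> (path \<omega>) r \<le> \<epsilon>) at_top"
      using eventually_ge_at_top[of r_init] by eventually_elim (rule bound)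
    then have "eventually (\<lambda>n. fraction b \<kappa> (path \<omega>) (real n) \<le> \<epsilon>) sequentially"
      using filterlim_real_sequentially unfolding filterlim_iff by blast
    then have "eventually (\<lambda>n. ereal (fraction b \<kappa> (path \<omega>) (real n)) \<le> ereal \<epsilon>) sequentially" by simp
    then show ?case unfolding upper_fraction_def by (rule Limsup_bounded)
  qed
  then show thesis using that \<kappa> by blast
qed

section \<open>Full occupation for short times\<close>

lemma upper_fraction_eq_1:
  obtains \<kappa> where "\<kappa> > 0" "\<not> (AE \<omega> in P (Some b). upper_fraction \<kappa> (path \<omega>) < 1)"
proof -
  interpret prob_space "P (Some b)" by (rule prob)
  obtain c0 where c0: "c0 > 0" "c0 \<le> 1"
    "\<And>r y. \<eta>\<^sup>2 * r > R \<Longrightarrow> y \<in> ball b (\<eta>\<^sup>2 * r) \<Longrightarrow> ennreal c0 \<le> emeasure (P (Some y))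
      {\<omega>\<in>\<Omega>. path \<omega> \<in> stay (cball b r) (\<Phi> (\<eta> * r)) \<and> X (ennreal (\<Phi> (\<eta> * r))) \<omega> \<in> Some ` ball b (\<eta>\<^sup>2 * r)}"
    by (rule ndl_uniform) (rule that)
  have \<eta>2: "0 < \<eta>\<^sup>2" "\<eta>\<^sup>2 \<le> 1" using \<eta> by (auto simp: power_le_one)
  obtain C1 where C1: "C1 > 0" "\<And>r. r > R + 2 \<Longrightarrow> \<phi> r \<le> C1 * \<Phi> r" by (rule \<phi>_le_\<Phi>) (rule that)
  have "2 / \<eta> > 0" using \<eta> by simp
  then obtain C2 where C2: "C2 > 0" "\<And>r. r > R \<Longrightarrow> \<Phi> (2 / \<eta> * r) \<le> C2 * \<Phi> r"
    by (rule \<Phi>_doubling) (rule that)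
  define M where "M = 1 / (1 - ln c0)"
  have lnc0: "ln c0 \<le> 0" using c0 by simp
  have "(- ln c0) / (1 - ln c0) \<le> 1" using lnc0 by (subst pos_divide_le_eq) auto
  then have M: "0 < M" "M \<le> 1" "M * (- ln c0) \<le> 1" using lnc0 by (auto simp: M_def divide_le_eq)
  define \<kappa> where "\<kappa> = M / (2 * C1 * C2)"
  have \<kappa>: "\<kappa> > 0" using M C1 C2 by (simp add: \<kappa>_def)
  define ra where "ra = (R + 1) / \<eta>\<^sup>2"
  have ra: "\<eta>\<^sup>2 * ra = R + 1" "ra > 0" using \<eta> R_ge_1 by (auto simp: ra_def)
  define a0 where "a0 = max r_init (max (R + 3) (max (2 * ra) (2 * (R + 1) / \<eta>)))"
  have a0: "a0 \<ge> r_init" "a0 > R + 2" "a0 \<ge> 2 * ra" "a0 \<ge> 2 * (R + 1) / \<eta>" "a0 > 1"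
    using R_ge_1 by (auto simp: a0_def)
  obtain n0 :: nat where n0: "max (max 3 (ln (\<phi> a0))) (\<Phi> (\<eta> * ra) / \<kappa> + 1) \<le> real n0" using real_arch_simple by blast
  have pred_le: "n \<ge> n0 - 1" if "n \<ge> n0" for n using that by linarith
  have "\<exists>r\<ge>a0. \<phi> r = exp (real n ^ 2)" if "n \<ge> n0 - 1" for n
  proof -
    have n2: "real n \<ge> 2" "real n + 1 \<ge> ln (\<phi> a0)" using n0 that by linarith+
    have "2 * real n \<le> real n * real n" using n2 by (intro mult_right_mono) auto
    then have "ln (\<phi> a0) \<le> real n ^ 2" unfolding power2_eq_square using n2 by linarith
    then have "\<phi> a0 \<le> exp (real n ^ 2)" using \<phi>_pos[OF a0(1)] by (metis exp_le_cancel_iff exp_ln)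
    then show ?thesis using \<phi>_inverse[OF a0(5)] by metis
  qed
  then obtain rr where rr: "\<And>n. n \<ge> n0 - 1 \<Longrightarrow> rr n \<ge> a0" "\<And>n. n \<ge> n0 - 1 \<Longrightarrow> \<phi> (rr n) = exp (real n ^ 2)" by metis
  define T where "T n = \<kappa> * (exp (real n ^ 2) * (2 * ln (real n)))" for n :: nat
  define \<rho> where "\<rho> n = rr n / 2" for n
  define \<tau> where "\<tau> n = \<Phi> (\<eta> * \<rho> n)" for n
  have n_ge: "real n \<ge> 2" if "n \<ge> n0 - 1" for n using n0 that by linarith
  have T_eq: "T n = \<kappa> * tscale (rr n)" if "n \<ge> n0 - 1" for n
    unfolding T_def tscale_def rr(2)[OF that] using n_ge[OF that] by (simp add: ln_realpow)
  have T_nonneg: "0 \<le> T n" if "n \<ge> n0 - 1" for n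
    unfolding T_def using \<kappa> n_ge[OF that] by (intro mult_nonneg_nonneg) auto
  have \<tau>_pos: "\<tau> n > 0" if "n \<ge> n0 - 1" for n
    unfolding \<tau>_def \<rho>_def using \<eta> rr(1)[OF that] a0 by (intro \<Phi>_pos mult_pos_pos) auto
  have \<tau>_nonneg: "0 \<le> \<tau> n" if "n \<ge> n0" for n
    using \<tau>_pos[of n] that by linarith
  have T_le: "T n \<le> M * ln (real n) * \<tau> n" if n: "n \<ge> n0 - 1" for n
  proof -
    have "2 * (R + 1) / \<eta> \<le> rr n" using rr(1)[OF n] a0 by linarith
    then have "R + 1 \<le> \<eta> * \<rho> n" unfolding \<rho>_def using \<eta> by (simp add: field_simps)
    then have R\<rho>: "R < \<eta> * \<rho> n" by linarith
    have "exp (real n ^ 2) \<le> C1 * \<Phi> (rr n)" using C1(2)[of "rr n"] rr[OF n] a0 by simp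
    also have "\<Phi> (rr n) = \<Phi> (2 / \<eta> * (\<eta> * \<rho> n))" unfolding \<rho>_def using \<eta> by simp
    also have "\<dots> \<le> C2 * \<tau> n" unfolding \<tau>_def by (rule C2(2)[OF R\<rho>])
    finally have "exp (real n ^ 2) \<le> C1 * (C2 * \<tau> n)" using C1 by simp
    then have "T n \<le> \<kappa> * ((C1 * (C2 * \<tau> n)) * (2 * ln (real n)))"
      unfolding T_def using \<kappa> n_ge[OF n] by (intro mult_left_mono mult_right_mono) auto
    also have "\<dots> = M * ln (real n) * \<tau> n" using C1 C2 by (simp add: \<kappa>_def)
    finally show ?thesis .
  qed
  have T_step: "T (n - 1) \<le> exp (- real n) * T n" if n: "n \<ge> n0" for n
  proof -
    have n3: "real n \<ge> 3" using n0 n by linarith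
    then have n1: "real (n - 1) = real n - 1" by linarith
    have "exp (real (n - 1) ^ 2) * (2 * ln (real (n - 1))) \<le> exp (real n ^ 2 - real n) * (2 * ln (real n))"
    proof (rule mult_mono)
      show "exp (real (n - 1) ^ 2) \<le> exp (real n ^ 2 - real n)"
        unfolding n1 using n3 by (simp add: power2_eq_square algebra_simps)
      show "2 * ln (real (n - 1)) \<le> 2 * ln (real n)" unfolding n1 using n3 by simp
      show "0 \<le> 2 * ln (real (n - 1))" unfolding n1 using n3 by simp
    qed simp
    also have "\<dots> = exp (- real n) * (exp (real n ^ 2) * (2 * ln (real n)))" by (simp add: exp_diff exp_minus field_simps)
    finally show ?thesis unfolding T_def using \<kappa> by (simp add: mult_left_mono mult.left_commute)
  qed
  have T_mono: "T (n - 1) \<le> T n" if n: "n \<ge> n0" for n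
  proof -
    have "exp (- real n) * T n \<le> 1 * T n" using T_nonneg[of n] n by (intro mult_right_mono) auto
    then show ?thesis using T_step[OF n] by simp
  qed
  have T_mono': "T j \<le> T n" if "n0 \<le> j" "j \<le> n" for j n
    using that(2,1)
  proof (induction n rule: dec_induct)
    case (step n)
    then show ?case using T_mono[of "Suc n"] by simp
  qed simp
  have T_le_\<tau>: "T (n - 1) \<le> \<tau> n" if n: "n \<ge> n0" for n
  proof -
    have n3: "real n \<ge> 3" using n0 n by linarith
    have "T (n - 1) \<le> exp (- real n) * (M * ln (real n) * \<tau> n)"
      using T_step[OF n] T_le[of n] n by (meson exp_ge_zero mult_left_mono order_trans diff_le_self le_trans)
    also have "M * ln (real n) \<le> 1 * real n"
      using M n3 ln_le_minus_one[of "real n"] by (intro mult_mono) auto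
    then have "exp (- real n) * (M * ln (real n) * \<tau> n) \<le> exp (- real n) * (1 * real n * \<tau> n)"
      using \<tau>_nonneg[OF n] by (intro mult_left_mono mult_right_mono) auto
    also have "exp (- real n) * (1 * real n * \<tau> n) \<le> 1 * \<tau> n"
    proof -
      have "real n \<le> exp (real n)" using exp_ge_add_one_self[of "real n"] by linarith
      then have "exp (- real n) * real n \<le> 1" by (simp add: exp_minus field_simps)
      then have "(exp (- real n) * real n) * \<tau> n \<le> 1 * \<tau> n" using \<tau>_nonneg[OF n] by (intro mult_right_mono) auto
      then show ?thesis by (simp add: mult_ac)
    qed
    finally show ?thesis by simp
  qed
  have T_ge: "\<Phi> (\<eta> * ra) \<le> T (n - 1)" if n: "n \<ge> n0" for n
  proof -
    let ?m = "n - 1"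
    have m: "?m \<ge> n0 - 1" using n by simp
    have "\<Phi> (\<eta> * ra) / \<kappa> \<le> real ?m" using n0 n by linarith
    also have "\<dots> \<le> exp (real ?m ^ 2)"
    proof -
      have "real ?m * 1 \<le> real ?m * real ?m" using n_ge[OF m] by (intro mult_left_mono) auto
      moreover have "real ?m ^ 2 \<le> exp (real ?m ^ 2)" using exp_ge_add_one_self[of "real ?m ^ 2"] by linarith
      ultimately show ?thesis by (simp add: power2_eq_square)
    qed
    also have "\<dots> \<le> tscale (rr ?m)" using tscale_ge_\<phi>[of "rr ?m"] rr[OF m] a0 by simp
    finally show ?thesis unfolding T_eq[OF m] using \<kappa> by (simp add: pos_divide_le_eq mult.commute)
  qed
  define A where "A n = (if n \<ge> n0 then {\<omega>\<in>\<Omega>. path_shift (ennreal (T (n - 1))) (path \<omega>) \<in> stay (cball b (\<rho> n)) (T n - T (n - 1))} else {})" for n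
  define G where "G n = {\<omega>\<in>\<Omega>. X (ennreal (T (n - 1))) \<omega> \<in> Some ` ball b (\<eta>\<^sup>2 * \<rho> n)}" for n
  have AF: "A n \<in> sets (F (ennreal (T n)))" for n
  proof (cases "n \<ge> n0")
    case True
    then show ?thesis
      using stay_event_F[OF closed_cball, of "T (n - 1)" "T n - T (n - 1)" b "\<rho> n"] T_mono[OF True] T_nonneg[of "n - 1"]
      by (simp add: A_def)
  qed (simp add: A_def)
  have A: "A n \<in> events" for n using AF sets_F_le_P by blast
  have G: "G n \<in> events" for n unfolding G_def by (intro X_set_P Some_image_cemetery) simp
  have PG: "c0 \<le> prob (G n)" if n: "n \<ge> n0" for n
  proof -
    have \<rho>a: "ra \<le> \<rho> n" using rr(1)[OF pred_le[OF n]] a0 by (simp add: \<rho>_def)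
    have "0 < \<eta> * r" if "r \<in> {ra..\<rho> n}" for r using that \<eta> ra by simp
    then have cont: "continuous_on {ra..\<rho> n} (\<lambda>r. \<Phi> (\<eta> * r))"
      by (intro continuous_on_compose2[OF \<Phi>_cont] continuous_intros) blast
    have "\<Phi> (\<eta> * \<rho> n) \<ge> T (n - 1)" using T_le_\<tau>[OF n] by (simp add: \<tau>_def)
    then obtain r where r: "ra \<le> r" "r \<le> \<rho> n" "\<Phi> (\<eta> * r) = T (n - 1)"
      using IVT'[of "\<lambda>r. \<Phi> (\<eta> * r)" ra "T (n - 1)" "\<rho> n"] T_ge[OF n] \<rho>a cont by blast
    have "\<eta>\<^sup>2 * ra \<le> \<eta>\<^sup>2 * r" using r \<eta>2 by (intro mult_left_mono) auto
    then have rR: "\<eta>\<^sup>2 * r > R" using ra by simp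
    then have "b \<in> ball b (\<eta>\<^sup>2 * r)" using R_ge_1 by simp
    from c0(3)[OF rR this]
    have "ennreal c0 \<le> emeasure (P (Some b)) {\<omega>\<in>\<Omega>. path \<omega> \<in> stay (cball b r) (T (n - 1)) \<and> X (ennreal (T (n - 1))) \<omega> \<in> Some ` ball b (\<eta>\<^sup>2 * r)}"
      unfolding r(3) .
    also have "\<dots> \<le> emeasure (P (Some b)) (G n)"
    proof (rule emeasure_mono[OF _ G])
      have "ball b (\<eta>\<^sup>2 * r) \<subseteq> ball b (\<eta>\<^sup>2 * \<rho> n)" using r \<eta>2 by (intro subset_ball mult_left_mono) auto
      then show "{\<omega>\<in>\<Omega>. path \<omega> \<in> stay (cball b r) (T (n - 1)) \<and> X (ennreal (T (n - 1))) \<omega> \<in> Some ` ball b (\<eta>\<^sup>2 * r)} \<subseteq> G n"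
        unfolding G_def by blast
    qed
    finally show ?thesis by (simp add: emeasure_eq_measure)
  qed
  have stay_lower: "ennreal (c0 / real n) \<le> emeasure (P (Some y)) {\<omega>\<in>\<Omega>. path \<omega> \<in> stay (cball b (\<rho> n)) (T n - T (n - 1))}"
    if n: "n \<ge> n0" and y: "y \<in> ball b (\<eta>\<^sup>2 * \<rho> n)" for n y
  proof -
    have n3: "real n \<ge> 3" using n0 n by linarith
    define k where "k = nat \<lceil>M * ln (real n)\<rceil>"
    have Mln: "0 \<le> M * ln (real n)" using M n3 by simp
    then have k: "M * ln (real n) \<le> real k" "real k \<le> M * ln (real n) + 1" unfolding k_def by linarith+
    have "T n - T (n - 1) \<le> M * ln (real n) * \<tau> n" using T_le[OF pred_le[OF n]] T_nonneg[OF diff_le_mono[OF n]] by linarith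
    also have "\<dots> \<le> real k * \<tau> n" using k \<tau>_nonneg[OF n] by (intro mult_right_mono) auto
    finally have Tk: "T n - T (n - 1) \<le> real k * \<tau> n" .
    have "ra \<le> \<rho> n" using rr(1)[OF pred_le[OF n]] a0 by (simp add: \<rho>_def)
    then have "\<eta>\<^sup>2 * ra \<le> \<eta>\<^sup>2 * \<rho> n" using \<eta>2 by (intro mult_left_mono) auto
    then have rR: "\<eta>\<^sup>2 * \<rho> n > R" using ra by simp
    have "c0 / real n \<le> c0 ^ k"
    proof -
      have "- (M * ln (real n)) * (- ln c0) \<ge> - ln (real n)"
      proof -
        have "(M * (- ln c0)) * ln (real n) \<le> 1 * ln (real n)" using M(3) n3 by (intro mult_right_mono) auto
        then show ?thesis by (simp add: algebra_simps)
      qed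
      then have "exp (- ln (real n)) \<le> exp (M * ln (real n) * ln c0)" by (simp add: mult_ac)
      then have "c0 * exp (- ln (real n)) \<le> c0 * c0 powr (M * ln (real n))"
        using c0 by (intro mult_left_mono) (auto simp: powr_def)
      also have "\<dots> = c0 powr (M * ln (real n) + 1)" using c0 by (simp add: powr_add)
      also have "\<dots> \<le> c0 powr (real k)" using k c0 by (intro powr_mono') auto
      also have "\<dots> = c0 ^ k" using c0 by (simp add: powr_realpow)
      finally show ?thesis using n3 by (simp add: exp_minus divide_inverse)
    qed
    then have "ennreal (c0 / real n) \<le> ennreal (c0 ^ k)" by (rule ennreal_leI)
    also have "\<dots> \<le> emeasure (P (Some y)) {\<omega>\<in>\<Omega>. path \<omega> \<in> stay (cball b (\<rho> n)) (real k * \<tau> n)}"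
    proof (rule stay_iterate[OF c0(1) _ closed_cball _ _ y])
      show "ennreal c0 \<le> emeasure (P (Some y)) {\<omega>\<in>\<Omega>. path \<omega> \<in> stay (cball b (\<rho> n)) (\<tau> n) \<and> X (ennreal (\<tau> n)) \<omega> \<in> Some ` ball b (\<eta>\<^sup>2 * \<rho> n)}"
        if "y \<in> ball b (\<eta>\<^sup>2 * \<rho> n)" for y
        using c0(3)[OF rR that] by (simp add: \<tau>_def)
      show "0 \<le> \<tau> n" by (rule \<tau>_nonneg[OF n])
    qed simp
    also have "\<dots> \<le> emeasure (P (Some y)) {\<omega>\<in>\<Omega>. path \<omega> \<in> stay (cball b (\<rho> n)) (T n - T (n - 1))}"
      using path_event_P[OF stay_sets[OF closed_cball]] stay_mono[OF _ Tk] by (intro emeasure_mono) auto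
    finally show ?thesis .
  qed
  have first: "c0 / real n * prob ((space (P (Some b)) - (\<Union>j\<in>{m..<n}. A j)) \<inter> G n)
        \<le> prob ((space (P (Some b)) - (\<Union>j\<in>{m..<n}. A j)) \<inter> A n)" if m: "m \<ge> n0" and n: "n \<ge> m" for m n
  proof -
    let ?C = "space (P (Some b)) - (\<Union>j\<in>{m..<n}. A j)"
    let ?t = "ennreal (T (n - 1))"
    let ?E = "stay (cball b (\<rho> n)) (T n - T (n - 1))"
    have nn: "n \<ge> n0" using m n by simp
    have "A j \<in> sets (F ?t)" if "j \<in> {m..<n}" for j
    proof (rule subsetD[OF sets_F_mono AF])
      show "ennreal (T j) \<le> ?t" using that m by (intro ennreal_leI T_mono') auto
    qed
    then have C: "?C \<in> sets (F ?t)"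
      using sets.top[of "F ?t"] by (intro sets.Diff sets.finite_UN) (auto simp: space_P space_F)
    have CP: "?C \<in> events" using C sets_F_le_P by blast
    have "ennreal (c0 / real n) * emeasure (P (Some b)) (?C \<inter> G n) = (\<integral>\<^sup>+\<omega>. ennreal (c0 / real n) * indicator (?C \<inter> G n) \<omega> \<partial>P (Some b))"
      using CP G by (intro nn_integral_cmult_indicator[symmetric]) auto
    also have "\<dots> \<le> (\<integral>\<^sup>+\<omega>\<in>?C. emeasure (P (X ?t \<omega>)) {\<omega>'\<in>\<Omega>. path \<omega>' \<in> ?E} \<partial>P (Some b))"
      using stay_lower[OF nn] by (intro nn_integral_mono) (auto simp: indicator_def G_def)
    also have "\<dots> = emeasure (P (Some b)) {\<omega>\<in>?C. path_shift ?t (path \<omega>) \<in> ?E}"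
      by (rule Markov[OF stay_sets[OF closed_cball] C, symmetric])
    also have "{\<omega>\<in>?C. path_shift ?t (path \<omega>) \<in> ?E} = ?C \<inter> A n"
      using nn by (auto simp: A_def space_P)
    finally have "ennreal (c0 / real n * prob (?C \<inter> G n)) \<le> ennreal (prob (?C \<inter> A n))"
      using c0 by (simp add: emeasure_eq_measure flip: ennreal_mult)
    then show ?thesis by (simp add: ennreal_le_iff)
  qed
  have div: "\<not> summable (\<lambda>n. c0 / real n)"
  proof
    assume "summable (\<lambda>n. c0 / real n)"
    from summable_mult[OF this, of "inverse c0"] have "summable (\<lambda>n. inverse (real n))"
      using c0 by (simp add: field_simps)
    then show False using not_summable_harmonic[where 'a=real] by simp
  qed
  have union: "c0 \<le> prob (\<Union>n\<in>{m..}. A n)" if "m \<ge> n0" for m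
    by (rule conditional_Borel_Cantelli[OF prob_space_axioms A G _ _ first[OF that] div])
       (use PG c0 that in auto)
  define I where "I = (\<Inter>m. \<Union>n\<in>{m + n0..}. A n)"
  have I_meas: "I \<in> events" unfolding I_def using A by auto
  have "(\<lambda>m. prob (\<Union>n\<in>{m + n0..}. A n)) \<longlonglongrightarrow> prob I"
    unfolding I_def
  proof (rule finite_Lim_measure_decseq)
    show "range (\<lambda>m. \<Union>n\<in>{m + n0..}. A n) \<subseteq> events" using A by auto
    show "decseq (\<lambda>m. \<Union>n\<in>{m + n0..}. A n)" by (intro decseq_SucI UN_mono) auto
  qed
  then have "c0 \<le> prob I" by (rule LIMSEQ_le_const) (use union in auto)
  have on_I: "1 \<le> upper_fraction \<kappa> (path \<omega>)" if \<omega>: "\<omega> \<in> \<Omega>" "\<omega> \<in> I" for \<omega>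
  proof (rule ccontr)
    note w = path_rc[OF \<omega>(1)]
    assume "\<not> ?thesis"
    then have "Limsup at_top (\<lambda>r. ereal (fraction b \<kappa> (path \<omega>) r)) < 1"
      using Limsup_fraction[OF w \<kappa>, of b] by simp
    then obtain a where a: "Limsup at_top (\<lambda>r. ereal (fraction b \<kappa> (path \<omega>) r)) < ereal a" "ereal a < 1"
      using ereal_dense2 by blast
    have "a < 1" using a(2) by (simp add: one_ereal_def)
    obtain r1 where r1: "\<And>r. r \<ge> r1 \<Longrightarrow> fraction b \<kappa> (path \<omega>) r < a"
      using Limsup_lessD[OF a(1)] unfolding eventually_at_top_linorder by auto
    obtain m :: nat where m: "max (1 / (1 - a)) (ln (max 1 (\<phi> (max r1 2)))) \<le> real m" using real_arch_simple by blast
    obtain n where n: "n \<ge> m + n0" "\<omega> \<in> A n" using \<omega>(2) unfolding I_def by blast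
    then have nn: "n \<ge> n0" "n \<ge> n0 - 1" by auto
    have n3: "real n \<ge> 3" using n0 nn by linarith
    have sh: "path_shift (ennreal (T (n - 1))) (path \<omega>) \<in> stay (cball b (\<rho> n)) (T n - T (n - 1))"
      using n nn by (simp add: A_def)
    have rpos: "rr n > 0" using rr(1)[OF nn(2)] a0 by simp
    have "sojourn (ball b (rr n)) (T (n - 1) + (T n - T (n - 1))) (path \<omega>) =
        sojourn (ball b (rr n)) (T (n - 1)) (path \<omega>) + sojourn (ball b (rr n)) (T n - T (n - 1)) (path_shift (ennreal (T (n - 1))) (path \<omega>))"
      using T_mono[OF nn(1)] T_nonneg[OF diff_le_mono[OF nn(1)]] by (intro sojourn_add w) auto
    moreover have "sojourn (ball b (rr n)) (T n - T (n - 1)) (path_shift (ennreal (T (n - 1))) (path \<omega>)) = T n - T (n - 1)"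
      using T_mono[OF nn(1)] rpos by (intro sojourn_stay[OF sh]) (auto simp: \<rho>_def)
    ultimately have "T n - T (n - 1) \<le> sojourn (ball b (rr n)) (T n) (path \<omega>)"
      using sojourn_nonneg[of "ball b (rr n)" "T (n - 1)" "path \<omega>"] by simp
    moreover have "T (n - 1) \<le> (1 - a) * T n"
    proof -
      have "1 / (1 - a) \<le> real n" using m n by simp
      also have "\<dots> \<le> exp (real n)" using exp_ge_add_one_self[of "real n"] by linarith
      finally have "exp (- real n) \<le> 1 - a" using \<open>a < 1\<close> by (simp add: exp_minus field_simps)
      then have "exp (- real n) * T n \<le> (1 - a) * T n" using T_nonneg[OF nn(2)] by (rule mult_right_mono)
      then show ?thesis using T_step[OF nn(1)] by simp
    qed
    ultimately have "a * T n \<le> sojourn (ball b (rr n)) (T n) (path \<omega>)" by (simp add: algebra_simps)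
    moreover have "T n > 0" unfolding T_eq[OF nn(2)] using \<kappa> tscale_pos[of "rr n"] rr(1)[OF nn(2)] a0 by simp
    ultimately have "a \<le> fraction b \<kappa> (path \<omega>) (rr n)"
      unfolding fraction_def T_eq[OF nn(2), symmetric] by (simp add: pos_le_divide_eq)
    moreover have "rr n \<ge> r1"
    proof -
      have "ln (max 1 (\<phi> (max r1 2))) \<le> real n" using m n by simp
      also have "\<dots> \<le> real n ^ 2" using n3 by (simp add: power2_eq_square)
      finally have "exp (ln (max 1 (\<phi> (max r1 2)))) \<le> exp (real n ^ 2)" by (simp only: exp_le_cancel_iff)
      moreover have "exp (ln (max 1 (\<phi> (max r1 2)))) = max 1 (\<phi> (max r1 2))" by (rule exp_ln) simp
      ultimately have "\<phi> (max r1 2) \<le> \<phi> (rr n)" unfolding rr(2)[OF nn(2)] by linarith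
      moreover have "1 < rr n" using rr(1)[OF nn(2)] a0(5) by linarith
      ultimately have "max r1 2 \<le> rr n" by (intro \<phi>_le_imp_le[of "max r1 2" "rr n"]) simp_all
      then show ?thesis by simp
    qed
    ultimately show False using r1[of "rr n"] by simp
  qed
  have "\<not> (AE \<omega> in P (Some b). upper_fraction \<kappa> (path \<omega>) < 1)"
  proof
    assume "AE \<omega> in P (Some b). upper_fraction \<kappa> (path \<omega>) < 1"
    then have "AE \<omega> in P (Some b). \<omega> \<notin> I"
      using AE_space
    proof eventually_elim
      case (elim \<omega>)
      then show ?case using on_I[of \<omega>] by (auto simp: space_P not_less[symmetric])
    qed
    then have "prob I = 0" using I_meas by (simp add: prob_eq_0)
    then show False using \<open>c0 \<le> prob I\<close> c0 by simp
  qed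
  then show thesis using that \<kappa> by blast
qed

lemma occupation_law:
  "\<exists>f :: real \<Rightarrow> real.
    (\<forall>\<kappa>>0. 0 < f \<kappa> \<and> f \<kappa> \<le> 1) \<and>
    antimono_on {0<..} f \<and>
    (\<forall>x. \<forall>\<kappa>>0. \<forall>z. AE \<omega> in P (Some z).
       Limsup at_top (\<lambda>r. ereal (occupation_time X (ball x r) (\<kappa> * \<phi> r * ln (ln (\<phi> r))) \<omega>
                                  / (\<kappa> * \<phi> r * ln (ln (\<phi> r))))) = ereal (f \<kappa>)) \<and>
    (\<exists>\<kappa>0>0. \<forall>\<kappa>. 0 < \<kappa> \<and> \<kappa> \<le> \<kappa>0 \<longrightarrow> f \<kappa> = 1) \<and>
    (f \<longlongrightarrow> 0) at_top"
proof -
  interpret prob_space "P (Some b)" by (rule prob)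
  obtain f where f: "\<And>\<kappa>. \<kappa> > 0 \<Longrightarrow> 0 \<le> f \<kappa> \<and> f \<kappa> \<le> (1::real)"
    "\<And>\<kappa> z. \<kappa> > 0 \<Longrightarrow> AE \<omega> in P (Some z). upper_fraction \<kappa> (path \<omega>) = ereal (f \<kappa>)"
    by (rule limsup_constant) (rule that)
  have witness: "\<exists>\<omega>\<in>\<Omega>. Q \<omega>" if "AE \<omega> in P (Some b). Q \<omega>" for Q
  proof (rule ccontr)
    assume no: "\<not> ?thesis"
    have "AE \<omega> in P (Some b). False" using that AE_space by eventually_elim (use no in \<open>auto simp: space_P\<close>)
    then show False by simp
  qed
  have anti: "f \<kappa>' \<le> f \<kappa>" if "0 < \<kappa>" "\<kappa> \<le> \<kappa>'" for \<kappa> \<kappa>'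
  proof -
    have "AE \<omega> in P (Some b). upper_fraction \<kappa> (path \<omega>) = ereal (f \<kappa>) \<and> upper_fraction \<kappa>' (path \<omega>) = ereal (f \<kappa>')"
      using f(2)[of \<kappa> b] f(2)[of \<kappa>' b] that by auto
    then obtain \<omega> where "\<omega> \<in> \<Omega>" "upper_fraction \<kappa> (path \<omega>) = ereal (f \<kappa>)" "upper_fraction \<kappa>' (path \<omega>) = ereal (f \<kappa>')"
      using witness by blast
    then show ?thesis using upper_fraction_antimono[OF path_rc that] by force
  qed
  obtain \<kappa>0 where \<kappa>0: "\<kappa>0 > 0" "\<not> (AE \<omega> in P (Some b). upper_fraction \<kappa>0 (path \<omega>) < 1)"
    by (rule upper_fraction_eq_1) (rule that)
  have "f \<kappa>0 = 1"
  proof (rule ccontr)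
    assume "f \<kappa>0 \<noteq> 1"
    then have less: "f \<kappa>0 < 1" using f(1)[OF \<kappa>0(1)] by simp
    have "AE \<omega> in P (Some b). upper_fraction \<kappa>0 (path \<omega>) < 1"
      using f(2)[OF \<kappa>0(1), of b] by eventually_elim (use less in \<open>simp add: one_ereal_def\<close>)
    then show False using \<kappa>0(2) by simp
  qed
  then have f1: "f \<kappa> = 1" if "0 < \<kappa>" "\<kappa> \<le> \<kappa>0" for \<kappa>
    using anti[OF that] f(1)[OF that(1)] by simp
  have pos: "0 < f \<kappa>" if "\<kappa> > 0" for \<kappa>
  proof (cases "\<kappa> \<le> \<kappa>0")
    case False
    have "AE \<omega> in P (Some b). upper_fraction \<kappa> (path \<omega>) = ereal (f \<kappa>) \<and> upper_fraction \<kappa>0 (path \<omega>) = ereal (f \<kappa>0)"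
      using f(2)[OF that, of b] f(2)[OF \<kappa>0(1), of b] by auto
    then obtain \<omega> where "\<omega> \<in> \<Omega>" "upper_fraction \<kappa> (path \<omega>) = ereal (f \<kappa>)" "upper_fraction \<kappa>0 (path \<omega>) = ereal (f \<kappa>0)"
      using witness by blast
    then show ?thesis
      using upper_fraction_pos[OF path_rc \<kappa>0(1), of \<omega> \<kappa>] False \<open>f \<kappa>0 = 1\<close> by (simp add: one_ereal_def)
  qed (use f1 that in simp)
  have lim: "(f \<longlongrightarrow> 0) at_top"
  proof (rule tendstoI)
    fix e :: real assume "e > 0"
    then have "e / 2 > 0" by simp
    then obtain \<kappa>1 where \<kappa>1: "\<kappa>1 > 0" "AE \<omega> in P (Some b). upper_fraction \<kappa>1 (path \<omega>) \<le> ereal (e / 2)"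
      by (rule upper_fraction_small) (rule that)
    have "AE \<omega> in P (Some b). upper_fraction \<kappa>1 (path \<omega>) = ereal (f \<kappa>1) \<and> upper_fraction \<kappa>1 (path \<omega>) \<le> ereal (e / 2)"
      using f(2)[OF \<kappa>1(1), of b] \<kappa>1(2) by auto
    from witness[OF this] have "f \<kappa>1 \<le> e / 2" by force
    show "eventually (\<lambda>\<kappa>. dist (f \<kappa>) 0 < e) at_top"
      using eventually_ge_at_top[of \<kappa>1]
    proof eventually_elim
      case (elim \<kappa>)
      then show ?case using anti[OF \<kappa>1(1) elim] \<open>f \<kappa>1 \<le> e / 2\<close> f(1)[of \<kappa>] \<kappa>1(1) \<open>e > 0\<close> by simp
    qed
  qed
  have law: "AE \<omega> in P (Some z). Limsup at_top (\<lambda>r. ereal (occupation_time X (ball x r) (\<kappa> * \<phi> r * ln (ln (\<phi> r))) \<omega>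
        / (\<kappa> * \<phi> r * ln (ln (\<phi> r))))) = ereal (f \<kappa>)" if "\<kappa> > 0" for x \<kappa> z
    using f(2)[OF that, of z] AE_space
  proof eventually_elim
    case (elim \<omega>)
    then have w: "path \<omega> \<in> rc_paths" using path_rc by (simp add: space_P)
    have "occupation_time X (ball x r) (\<kappa> * \<phi> r * ln (ln (\<phi> r))) \<omega> / (\<kappa> * \<phi> r * ln (ln (\<phi> r))) = fraction x \<kappa> (path \<omega>) r" for r
      unfolding fraction_def tscale_def using occupation_time_eq_sojourn[where X=X and \<omega>=\<omega>, OF w open_ball] by (simp add: mult.assoc)
    then show ?case using Limsup_fraction[OF w that, of x] elim(1) by simp
  qed
  show ?thesis
  proof (intro exI[of _ f] conjI allI impI)
    show "antimono_on {0<..} f" using anti by (auto intro!: monotone_onI)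
    show "\<exists>\<kappa>0>0. \<forall>\<kappa>. 0 < \<kappa> \<and> \<kappa> \<le> \<kappa>0 \<longrightarrow> f \<kappa> = 1" using \<kappa>0(1) f1 by blast
  qed (use pos f(1) law lim in auto)
qed

end

theorem theorem2p6:
  fixes b :: "'a::lc_separable_metric_space"
    and \<mu> :: "'a measure"
    and \<Omega> :: "'w set"
    and F :: "ennreal \<Rightarrow> 'w measure"
    and X :: "ennreal \<Rightarrow> 'w \<Rightarrow> 'a option"
    and P :: "'a option \<Rightarrow> 'w measure"
    and J :: "'a \<Rightarrow> 'a option measure"
    and R \<upsilon> :: real
    and \<Phi> \<phi> :: "real \<Rightarrow> real"
  assumes "radon_measure \<mu>" and "full_support \<mu>"
    and "borel_standard_process \<Omega> F X P"
    and "has_levy_system P X J"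
    and "R \<ge> 1" and "0 < \<upsilon>" and "\<upsilon> < 1"
    and "\<And>s. s > 0 \<Longrightarrow> \<Phi> s > 0"
    and "mono_on {0<..} \<Phi>" and "continuous_on {0<..} \<Phi>"
    and "VRD b \<mu> R \<upsilon>"
    and "ULS R \<Phi>"
    and "Tail_upper b J R \<Phi> \<upsilon>"
    and "NDL b \<mu> P X R \<Phi> \<upsilon>"
    and "\<And>r. r > 1 \<Longrightarrow> \<phi> r = integral {1..r} (\<lambda>s. \<Phi> s / s)"
  shows "\<exists>f :: real \<Rightarrow> real.
    (\<forall>\<kappa>>0. 0 < f \<kappa> \<and> f \<kappa> \<le> 1) \<and>
    antimono_on {0<..} f \<and>
    (\<forall>x. \<forall>\<kappa>>0. \<forall>z. AE \<omega> in P (Some z).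
       Limsup at_top (\<lambda>r. ereal (occupation_time X (ball x r) (\<kappa> * \<phi> r * ln (ln (\<phi> r))) \<omega>
                                  / (\<kappa> * \<phi> r * ln (ln (\<phi> r))))) = ereal (f \<kappa>)) \<and>
    (\<exists>\<kappa>0>0. \<forall>\<kappa>. 0 < \<kappa> \<and> \<kappa> \<le> \<kappa>0 \<longrightarrow> f \<kappa> = 1) \<and>
    (f \<longlongrightarrow> 0) at_top"
proof -
  have center: "R * dfun b b powr \<upsilon> = R" by (simp add: dfun_def)
  obtain \<eta> c where \<eta>: "0 < \<eta>" "\<eta> < 1" and c: "0 < c"
    and ndl: "\<forall>x r. r > R * dfun b x powr \<upsilon> \<longrightarrow> (\<exists>p. heat_kernel \<mu> P X (ball x r) p \<and>
        (\<forall>y\<in>ball x (\<eta>\<^sup>2 * r). \<forall>z\<in>ball x (\<eta>\<^sup>2 * r). p (\<Phi> (\<eta> * r)) y z \<ge> ennreal c / vol \<mu> x r))"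
    using \<open>NDL b \<mu> P X R \<Phi> \<upsilon>\<close> unfolding NDL_def by blast
  interpret occupation_setting \<Omega> F X P R \<Phi> \<phi> b \<mu> J \<upsilon> \<eta> c
  proof (intro occupation_setting.intro occupation_setting_axioms.intro growth_scale.intro)
    show "sets \<mu> = sets borel" using \<open>radon_measure \<mu>\<close> by (simp add: radon_measure_def)
    show "\<exists>p. heat_kernel \<mu> P X (ball b r) p \<and>
        (\<forall>y\<in>ball b (\<eta>\<^sup>2 * r). \<forall>z\<in>ball b (\<eta>\<^sup>2 * r). p (\<Phi> (\<eta> * r)) y z \<ge> ennreal c / vol \<mu> b r)"
      if "r > R" for r
      using ndl[rule_format, of b r] that by (simp only: center)
  qed (use assms \<eta> c in auto)
  show ?thesis by (rule occupation_law)
qed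

end
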